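(* Let $-\infty<a\le b<\infty$, let $J\in L^\infty(\mathbb R)$ be real-valued with $J\equiv-1$ on $(-\infty,a)$ and $J\equiv1$ on $(b,\infty)$, and let $V\in L^\infty(\mathbb R)$ be real-valued. Let $\tau f=-f''+Vf$, and in $L^2(\mathbb R)$ let $Tf=\tau f$, $\operatorname{dom}(T)=W^{2,2}(\mathbb R)$; $J$ also denotes the operator of multiplication by $J$. Assume that there exist $m_-,m_+>0$ such that $\lim_{x\to\pm\infty}V(x)=m_\pm$. (i) Let $H_n\subset W^{2,2}(\mathbb R)$, $n\in\mathbb N$, be finite-dimensional subspaces with $P_{H_n}\to I$ strongly as $n\to\infty$. Assume that $T_{H_n}P_{H_n}f\to Tf$ as $n\to\infty$ for all $f\in W^{2,2}(\mathbb R)$. Then the approximation of the pencil $\lambda\mapsto T-\lambda J$ by $\lambda\mapsto T_{H_n}-\lambda J_{H_n}$, $n\in\mathbb N$, is free of spectral pollution; it is even spectrally exact if $T$ is uniformly positive. (ii) Define $$T_nf=\tau f,\quad\operatorname{dom}(T_n)=\{f\in W^{2,2}(-n,n):f(\pm n)=0\},\qquad J_nf=Jf,\quad\operatorname{dom}(J_n)=L^2(-n,n).$$ Then the approximation of the pencil $\lambda\mapsto T-\lambda J$ by $\lambda\mapsto T_n-\lambda J_n$, $n\in\mathbb N$, is free of spectral pollution; it is even spectrally exact if $T$ is uniformly positive.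
   Context: For a closed subspace $U$ of a Hilbert space, $P_U$ is the orthogonal projection onto $U$, and for an operator $S$ with $U\subset\operatorname{dom}(S)$, $S_U=P_US|_U$. For a pencil $\lambda\mapsto A-\lambda B$ with $\operatorname{dom}(A)\subseteq\operatorname{dom}(B)$, $\sigma(A,B)=\{\lambda\in\mathbb C:0\in\sigma(A-\lambda B)\}$. The approximation of $\lambda\mapsto A-\lambda B$ by pencils $\lambda\mapsto A_n-\lambda B_n$, $n\in\mathbb N$, is free of spectral pollution if there is no $\lambda\notin\sigma(A,B)$ for which there exist an infinite set $I\subseteq\mathbb N$ and $\lambda_n\in\sigma(A_n,B_n)$, $n\in I$, with $\lambda_n\to\lambda$. It is spectrally exact if it is free of spectral pollution and every $\lambda\in\sigma(A,B)$ is the limit of some $\lambda_n\in\sigma(A_n,B_n)$, $n\in\mathbb N$. $T$ uniformly positive means $T\ge c$ for some constant $c>0$.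
   Formalization: In spectral exactness, λ_n ∈ σ(A_n,B_n) is required only for all sufficiently large n, not every n ∈ ℕ, since finitely many approximating spectra can be empty (e.g. H_n={0}, or J=0 on (-n,n) with T_n invertible). *)

theory Defs
  imports "HOL-Analysis.Analysis"
begin

section \<open>Complex Hilbert spaces\<close>

text \<open>The inner product is linear in its first argument. Its real part is the \<open>inner\<close> of the
  underlying real inner product space, so norm and topology are those of \<open>real_inner\<close>.\<close>

class complex_inner = real_inner +
  fixes scaleC :: "complex \<Rightarrow> 'a \<Rightarrow> 'a" (infixr \<open>*\<^sub>C\<close> 75)
    and cinner :: "'a \<Rightarrow> 'a \<Rightarrow> complex"
  assumes scaleC_add_right: "z *\<^sub>C (x + y) = z *\<^sub>C x + z *\<^sub>C y"
    and scaleC_add_left: "(z + w) *\<^sub>C x = z *\<^sub>C x + w *\<^sub>C x"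
    and scaleC_scaleC: "z *\<^sub>C w *\<^sub>C x = (z * w) *\<^sub>C x"
    and scaleC_of_real: "complex_of_real r *\<^sub>C x = r *\<^sub>R x"
    and cinner_commute: "cinner x y = cnj (cinner y x)"
    and cinner_add_left: "cinner (x + x') y = cinner x y + cinner x' y"
    and cinner_scaleC_left: "cinner (z *\<^sub>C x) y = z * cinner x y"
    and inner_eq_Re_cinner: "inner x y = Re (cinner x y)"

class complex_hilbert = complex_inner + complete_space

global_interpretation complex_vector:
  vector_space "scaleC :: complex \<Rightarrow> 'a \<Rightarrow> 'a :: complex_inner"
  defines cspan = complex_vector.span
proof unfold_locales
  fix x :: 'a
  show "1 *\<^sub>C x = x"
    using scaleC_of_real[of 1 x] by simp
qed (simp_all add: scaleC_add_right scaleC_add_left scaleC_scaleC)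

definition finite_dimensional_subspace :: "'a::complex_inner set \<Rightarrow> bool" where
  "finite_dimensional_subspace U \<longleftrightarrow> (\<exists>B. finite B \<and> U = cspan B)"

definition orth_proj :: "'a::complex_hilbert set \<Rightarrow> 'a \<Rightarrow> 'a" where
  "orth_proj U f = (THE g. g \<in> U \<and> (\<forall>u\<in>U. cinner (f - g) u = 0))"

text \<open>The compression \<open>P\<^sub>U S|\<^sub>U\<close>; it is to be read as an operator in \<open>U\<close> with domain \<open>U\<close>.\<close>

definition compression :: "'a::complex_hilbert set \<Rightarrow> ('a \<Rightarrow> 'a) \<Rightarrow> 'a \<Rightarrow> 'a" where
  "compression U S f = orth_proj U (S f)"

section \<open>Operators, pencils and their spectra\<close>

text \<open>An operator in a Hilbert space is given by three arguments: the Hilbert space \<open>H\<close>, as a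
  closed subspace of an ambient space; the domain \<open>D \<subseteq> H\<close>; and a map \<open>A\<close>, only whose values
  on \<open>D\<close> matter and which maps \<open>D\<close> into \<open>H\<close>.\<close>

definition op_spectrum ::
    "'a::complex_hilbert set \<Rightarrow> 'a set \<Rightarrow> ('a \<Rightarrow> 'a) \<Rightarrow> complex set" where
  "op_spectrum H D A =
     {z. \<not> (bij_betw (\<lambda>f. A f - z *\<^sub>C f) D H \<and>
            (\<exists>C. \<forall>f\<in>D. norm f \<le> C * norm (A f - z *\<^sub>C f)))}"

text \<open>For pencils \<open>\<lambda> \<mapsto> A - \<lambda>B\<close>, the argument \<open>D\<close> is the domain of \<open>A\<close>, which is contained in that
  of \<open>B\<close>.\<close>

definition pencil_spectrum ::
    "'a::complex_hilbert set \<Rightarrow> 'a set \<Rightarrow> ('a \<Rightarrow> 'a) \<Rightarrow> ('a \<Rightarrow> 'a) \<Rightarrow> complex set" where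
  "pencil_spectrum H D A B = {z. 0 \<in> op_spectrum H D (\<lambda>f. A f - z *\<^sub>C B f)}"

definition uniformly_positive :: "'a::complex_hilbert set \<Rightarrow> ('a \<Rightarrow> 'a) \<Rightarrow> bool" where
  "uniformly_positive D A \<longleftrightarrow>
     (\<exists>c>0. \<forall>f\<in>D. cinner (A f) f \<in> \<real> \<and> Re (cinner (A f) f) \<ge> c * (norm f)\<^sup>2)"

text \<open>In the next two definitions \<open>\<Sigma>\<close> is the spectrum of the limit pencil and \<open>\<Sigma>n n\<close> that of the
  \<open>n\<close>-th approximating pencil.\<close>

definition free_of_spectral_pollution :: "complex set \<Rightarrow> (nat \<Rightarrow> complex set) \<Rightarrow> bool" where
  "free_of_spectral_pollution \<Sigma> \<Sigma>n \<longleftrightarrow>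
     \<not> (\<exists>z. z \<notin> \<Sigma> \<and>
          (\<exists>I l. infinite I \<and> (\<forall>n\<in>I. l n \<in> \<Sigma>n n) \<and>
                 (l \<longlongrightarrow> z) (inf sequentially (principal I))))"

text \<open>Finitely many of the approximating spectra may be empty (the space may be trivial, or \<open>B\<^sub>n = 0\<close>
  and \<open>A\<^sub>n\<close> invertible), so \<open>l n \<in> \<Sigma>n n\<close> can only be required for all large \<open>n\<close>.\<close>

definition spectrally_exact :: "complex set \<Rightarrow> (nat \<Rightarrow> complex set) \<Rightarrow> bool" where
  "spectrally_exact \<Sigma> \<Sigma>n \<longleftrightarrow>
     free_of_spectral_pollution \<Sigma> \<Sigma>n \<and>
     (\<forall>z\<in>\<Sigma>. \<exists>l. (\<forall>\<^sub>F n in sequentially. l n \<in> \<Sigma>n n) \<and> l \<longlonglongrightarrow> z)"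

section \<open>The Hilbert space of square-integrable functions on the real line\<close>

definition square_integrable :: "(real \<Rightarrow> complex) \<Rightarrow> bool" where
  "square_integrable f \<longleftrightarrow>
     f \<in> borel_measurable lebesgue \<and> integrable lebesgue (\<lambda>x. (cmod (f x))\<^sup>2)"

lemma square_integrable_measurable [measurable_dest]:
  "square_integrable f \<Longrightarrow> f \<in> borel_measurable lebesgue"
  by (simp add: square_integrable_def)

lemma square_integrable_bound:
  assumes "g \<in> borel_measurable lebesgue" "square_integrable f"
    and "AE x in lebesgue. cmod (g x) \<le> C * cmod (f x)"
  shows "square_integrable g"
proof -
  have "integrable lebesgue (\<lambda>x. (cmod (g x))\<^sup>2)"
  proof (rule Bochner_Integration.integrable_bound)
    show "integrable lebesgue (\<lambda>x. C\<^sup>2 * (cmod (f x))\<^sup>2)"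
      using assms(2) by (simp add: square_integrable_def)
    show "(\<lambda>x. (cmod (g x))\<^sup>2) \<in> borel_measurable lebesgue"
      using assms(1) by measurable
    show "AE x in lebesgue. norm ((cmod (g x))\<^sup>2) \<le> norm (C\<^sup>2 * (cmod (f x))\<^sup>2)"
      using assms(3)
    proof eventually_elim
      case (elim x)
      then have "(cmod (g x))\<^sup>2 \<le> (C * cmod (f x))\<^sup>2" by (intro power_mono) auto
      then show ?case by (simp add: power_mult_distrib)
    qed
  qed
  then show ?thesis using assms(1) by (simp add: square_integrable_def)
qed

lemma square_integrable_zero: "square_integrable (\<lambda>_. 0)"
  by (simp add: square_integrable_def)

lemma square_integrable_add:
  assumes "square_integrable f" "square_integrable g"
  shows "square_integrable (\<lambda>x. f x + g x)"
proof -
  have m: "f \<in> borel_measurable lebesgue" "g \<in> borel_measurable lebesgue"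
    using assms by (auto simp: square_integrable_def)
  have "integrable lebesgue (\<lambda>x. (cmod (f x + g x))\<^sup>2)"
  proof (rule Bochner_Integration.integrable_bound)
    show "integrable lebesgue (\<lambda>x. 2 * (cmod (f x))\<^sup>2 + 2 * (cmod (g x))\<^sup>2)"
      using assms by (simp add: square_integrable_def)
    show "(\<lambda>x. (cmod (f x + g x))\<^sup>2) \<in> borel_measurable lebesgue"
      using m by measurable
    have "(cmod (u + v))\<^sup>2 \<le> 2 * (cmod u)\<^sup>2 + 2 * (cmod v)\<^sup>2" for u v
    proof -
      have "(cmod (u + v))\<^sup>2 \<le> (cmod u + cmod v)\<^sup>2"
        by (intro power_mono norm_triangle_ineq) auto
      also have "\<dots> \<le> 2 * (cmod u)\<^sup>2 + 2 * (cmod v)\<^sup>2"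
        using sum_squares_bound[of "cmod u" "cmod v"] by (simp add: power2_sum)
      finally show ?thesis .
    qed
    then show "AE x in lebesgue.
        norm ((cmod (f x + g x))\<^sup>2) \<le> norm (2 * (cmod (f x))\<^sup>2 + 2 * (cmod (g x))\<^sup>2)"
      by simp
  qed
  then show ?thesis using m by (simp add: square_integrable_def)
qed

lemma square_integrable_mult:
  assumes "square_integrable f" shows "square_integrable (\<lambda>x. z * f x)"
proof (rule square_integrable_bound[OF _ assms])
  show "(\<lambda>x. z * f x) \<in> borel_measurable lebesgue"
    by (rule borel_measurable_times[OF borel_measurable_const square_integrable_measurable[OF assms]])
  show "AE x in lebesgue. cmod (z * f x) \<le> cmod z * cmod (f x)"
    by (simp add: norm_mult)
qed

lemma square_integrable_diff:
  assumes "square_integrable f" "square_integrable g"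
  shows "square_integrable (\<lambda>x. f x - g x)"
  using square_integrable_add[OF assms(1) square_integrable_mult[OF assms(2), of "-1"]]
  by (simp only: mult_minus1 add_uminus_conv_diff)

lemma integrable_cinner:
  assumes "square_integrable f" "square_integrable g"
  shows "integrable lebesgue (\<lambda>x. f x * cnj (g x))"
proof (rule Bochner_Integration.integrable_bound)
  show "integrable lebesgue (\<lambda>x. (cmod (f x))\<^sup>2 + (cmod (g x))\<^sup>2)"
    using assms by (simp add: square_integrable_def)
  have m: "f \<in> borel_measurable lebesgue" "g \<in> borel_measurable lebesgue"
    using assms by (auto simp: square_integrable_def)
  show "(\<lambda>x. f x * cnj (g x)) \<in> borel_measurable lebesgue"
    by (intro borel_measurable_times m measurable_compose[OF m(2)] borel_measurable_continuous_onI
        continuous_intros)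
  have "cmod u * cmod v \<le> (cmod u)\<^sup>2 + (cmod v)\<^sup>2" for u v
  proof -
    have "0 \<le> cmod u * cmod v" by simp
    then show ?thesis
      using sum_squares_bound[of "cmod u" "cmod v"] by linarith
  qed
  then show "AE x in lebesgue. norm (f x * cnj (g x)) \<le> norm ((cmod (f x))\<^sup>2 + (cmod (g x))\<^sup>2)"
    by (simp add: norm_mult)
qed

definition L2_rel :: "(real \<Rightarrow> complex) \<Rightarrow> (real \<Rightarrow> complex) \<Rightarrow> bool" where
  "L2_rel f g \<longleftrightarrow> square_integrable f \<and> square_integrable g \<and> (AE x in lebesgue. f x = g x)"

lemma part_equivp_L2_rel: "part_equivp L2_rel"
proof (rule part_equivpI)
  show "\<exists>f. L2_rel f f"
    using square_integrable_zero by (auto simp: L2_rel_def)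
  show "symp L2_rel"
    by (auto simp: symp_def L2_rel_def elim!: eventually_mono)
  show "transp L2_rel"
    unfolding transp_def L2_rel_def by (auto elim: eventually_elim2)
qed

quotient_type L2 = "real \<Rightarrow> complex" / partial: L2_rel
  by (rule part_equivp_L2_rel)

instantiation L2 :: complex_inner
begin

lift_definition zero_L2 :: L2 is "\<lambda>_. 0"
  by (simp add: L2_rel_def square_integrable_zero)

lift_definition plus_L2 :: "L2 \<Rightarrow> L2 \<Rightarrow> L2" is "\<lambda>f g x. f x + g x"
  by (auto simp: L2_rel_def square_integrable_add elim: eventually_elim2)

lift_definition minus_L2 :: "L2 \<Rightarrow> L2 \<Rightarrow> L2" is "\<lambda>f g x. f x - g x"
  by (auto simp: L2_rel_def square_integrable_diff elim: eventually_elim2)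

lift_definition scaleC_L2 :: "complex \<Rightarrow> L2 \<Rightarrow> L2" is "\<lambda>z f x. z * f x"
  by (auto simp: L2_rel_def square_integrable_mult elim: eventually_mono)

lift_definition cinner_L2 :: "L2 \<Rightarrow> L2 \<Rightarrow> complex" is
  "\<lambda>f g. \<integral>x. f x * cnj (g x) \<partial>lebesgue"
  unfolding L2_rel_def
  by (intro integral_cong_AE) (auto intro!: borel_measurable_integrable integrable_cinner
      elim: eventually_elim2)

definition uminus_L2 :: "L2 \<Rightarrow> L2" where "uminus_L2 f = (-1) *\<^sub>C f"
definition scaleR_L2 :: "real \<Rightarrow> L2 \<Rightarrow> L2" where "scaleR_L2 r f = complex_of_real r *\<^sub>C f"
definition inner_L2 :: "L2 \<Rightarrow> L2 \<Rightarrow> real" where "inner_L2 f g = Re (cinner f g)"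
definition norm_L2 :: "L2 \<Rightarrow> real" where "norm_L2 f = sqrt (inner f f)"
definition dist_L2 :: "L2 \<Rightarrow> L2 \<Rightarrow> real" where "dist_L2 f g = norm (f - g)"
definition sgn_L2 :: "L2 \<Rightarrow> L2" where "sgn_L2 f = inverse (norm f) *\<^sub>R f"
definition uniformity_L2 :: "(L2 \<times> L2) filter" where
  "uniformity_L2 = (INF e\<in>{0<..}. principal {(x, y). dist x y < e})"
definition open_L2 :: "L2 set \<Rightarrow> bool" where
  "open_L2 U \<longleftrightarrow> (\<forall>x\<in>U. \<forall>\<^sub>F (x', y) in uniformity. x' = x \<longrightarrow> y \<in> U)"

instance
proof
  fix f g h :: L2 and r s :: real and z w :: complex and U :: "L2 set"
  have CA: "z *\<^sub>C (f + g) = z *\<^sub>C f + z *\<^sub>C g" for z and f g :: L2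
    by transfer (auto simp: L2_rel_def algebra_simps
        intro!: square_integrable_mult square_integrable_add square_integrable_diff)
  have CB: "(z + w) *\<^sub>C f = z *\<^sub>C f + w *\<^sub>C f" for z w and f :: L2
    by transfer (auto simp: L2_rel_def distrib_right
        intro!: square_integrable_mult square_integrable_add)
  have CC: "z *\<^sub>C w *\<^sub>C f = (z * w) *\<^sub>C f" for z w and f :: L2
    by transfer (auto simp: L2_rel_def mult.assoc intro!: square_integrable_mult)
  have C1: "1 *\<^sub>C f = f" for f :: L2
    by transfer (auto simp: L2_rel_def)
  have ICA: "cinner (f + g) h = cinner f h + cinner g h" for f g h :: L2
    by transfer (simp add: L2_rel_def distrib_right integrable_cinner)
  have ICS: "cinner (z *\<^sub>C f) g = z * cinner f g" for z and f g :: L2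
    by transfer (simp add: mult.assoc)
  have "(\<integral>x. F x * cnj (G x) \<partial>lebesgue) = cnj (\<integral>x. G x * cnj (F x) \<partial>lebesgue)"
    for F G :: "real \<Rightarrow> complex"
    using Bochner_Integration.integral_cnj[of lebesgue "\<lambda>x. G x * cnj (F x)"]
    by (simp add: mult.commute del: Bochner_Integration.integral_cnj)
  then have ICC: "cinner f g = cnj (cinner g f)" for f g :: L2
    by transfer
  show "f + g + h = f + (g + h)"
    by transfer (auto simp: L2_rel_def add.assoc intro!: square_integrable_add)
  show "f + g = g + f"
    by transfer (auto simp: L2_rel_def add.commute intro!: square_integrable_add)
  show "0 + f = f"
    by transfer (simp add: L2_rel_def)
  show "- f + f = 0"
    unfolding uminus_L2_def
    by transfer (auto simp: L2_rel_def square_integrable_zero)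
  show "f - g = f + - g"
    unfolding uminus_L2_def
    by transfer (simp add: L2_rel_def square_integrable_diff)
  show "r *\<^sub>R (f + g) = r *\<^sub>R f + r *\<^sub>R g" by (simp add: scaleR_L2_def CA)
  show "(r + s) *\<^sub>R f = r *\<^sub>R f + s *\<^sub>R f" by (simp add: scaleR_L2_def CB)
  show "r *\<^sub>R s *\<^sub>R f = (r * s) *\<^sub>R f" by (simp add: scaleR_L2_def CC)
  show "1 *\<^sub>R f = f" by (simp add: scaleR_L2_def C1)
  show "sgn f = inverse (norm f) *\<^sub>R f" by (simp add: sgn_L2_def)
  show "dist f g = norm (f - g)" by (simp add: dist_L2_def)
  show "uniformity = (INF e\<in>{0<..}. principal {(x :: L2, y). dist x y < e})"
    by (simp add: uniformity_L2_def)
  show "open U \<longleftrightarrow> (\<forall>x\<in>U. \<forall>\<^sub>F (x', y) in uniformity. x' = x \<longrightarrow> y \<in> U)"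
    by (simp add: open_L2_def)
  show "z *\<^sub>C (f + g) = z *\<^sub>C f + z *\<^sub>C g" by (rule CA)
  show "(z + w) *\<^sub>C f = z *\<^sub>C f + w *\<^sub>C f" by (rule CB)
  show "z *\<^sub>C w *\<^sub>C f = (z * w) *\<^sub>C f" by (rule CC)
  show "complex_of_real r *\<^sub>C f = r *\<^sub>R f" by (simp add: scaleR_L2_def)
  show "cinner f g = cnj (cinner g f)" by (rule ICC)
  show "cinner (f + g) h = cinner f h + cinner g h" by (rule ICA)
  show "cinner (z *\<^sub>C f) g = z * cinner f g" by (rule ICS)
  show "inner f g = Re (cinner f g)" by (simp add: inner_L2_def)
  show "inner f g = inner g f"
    unfolding inner_L2_def by (subst ICC) simp
  show "inner (f + g) h = inner f h + inner g h" by (simp add: inner_L2_def ICA)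
  show "inner (r *\<^sub>R f) g = r * inner f g" by (simp add: inner_L2_def scaleR_L2_def ICS)
  have self: "(\<integral>x. F x * cnj (F x) \<partial>lebesgue) = complex_of_real (\<integral>x. (cmod (F x))\<^sup>2 \<partial>lebesgue)"
    for F :: "real \<Rightarrow> complex"
    by (simp add: complex_norm_square[symmetric] del: of_real_power)
  show "0 \<le> inner f f"
    unfolding inner_L2_def by transfer (simp only: self, simp)
  show "inner f f = 0 \<longleftrightarrow> f = 0"
    unfolding inner_L2_def
    by transfer (simp only: self, simp add: L2_rel_def integral_nonneg_eq_0_iff_AE
        square_integrable_def)
  show "norm f = sqrt (inner f f)" by (simp add: norm_L2_def)
qed

end

lemma abs_rep_L2: "abs_L2 (rep_L2 f) = f"
  by (rule Quotient3_abs_rep[OF Quotient3_L2])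

lemma square_integrable_rep_L2: "square_integrable (rep_L2 f)"
  using Quotient3_rep_reflp[OF Quotient3_L2, of f] by (simp add: L2_rel_def)

lemma norm_diff_abs_L2:
  assumes "square_integrable F" "square_integrable G"
  shows "ennreal ((norm (abs_L2 F - abs_L2 G))\<^sup>2) =
    (\<integral>\<^sup>+x. ennreal ((cmod (F x - G x))\<^sup>2) \<partial>lebesgue)"
proof -
  have d: "square_integrable (\<lambda>x. F x - G x)"
    using assms by (rule square_integrable_diff)
  have "abs_L2 F - abs_L2 G = abs_L2 (\<lambda>x. F x - G x)"
    using assms by (simp add: minus_L2.abs_eq L2_rel_def)
  moreover have "(norm (abs_L2 (\<lambda>x. F x - G x)))\<^sup>2 = (\<integral>x. (cmod (F x - G x))\<^sup>2 \<partial>lebesgue)"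
    using d unfolding power2_norm_eq_inner[of "abs_L2 _"] inner_eq_Re_cinner
    by (simp add: cinner_L2.abs_eq L2_rel_def complex_norm_square[symmetric] del: of_real_power
        complex_cnj_diff)
  moreover have "(\<integral>\<^sup>+x. ennreal ((cmod (F x - G x))\<^sup>2) \<partial>lebesgue) =
      ennreal (\<integral>x. (cmod (F x - G x))\<^sup>2 \<partial>lebesgue)"
    using d by (intro nn_integral_eq_integral) (auto simp: square_integrable_def)
  ultimately show ?thesis by simp
qed

instance L2 :: complex_hilbert
proof
  fix X :: "nat \<Rightarrow> L2"
  assume X: "Cauchy X"
  have "\<forall>k. \<exists>M. \<forall>m\<ge>M. \<forall>n\<ge>M. norm (X m - X n) < (1/2)^k"
    using CauchyD[OF X] by simp
  then obtain M where M: "\<And>k m n. m \<ge> M k \<Longrightarrow> n \<ge> M k \<Longrightarrow> norm (X m - X n) < (1/2)^k"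
    by metis
  define r where "r k = (\<Sum>i\<le>k. Suc (M i))" for k
  have r: "strict_mono r"
    by (auto simp: r_def strict_mono_Suc_iff)
  have rM: "r k \<ge> M k" for k
    using member_le_sum[of k "{..k}" "\<lambda>i. Suc (M i)"] by (simp add: r_def)
  have rX: "norm (X (r j) - X (r k)) < (1/2)^k" if "j \<ge> k" for j k
    using M[of k "r j" "r k"] rM[of k] strict_mono_mono[OF r] that
    by (meson monoD order_trans)
  define F where "F k = rep_L2 (X (r k))" for k
  have F: "square_integrable (F k)" for k
    by (simp add: F_def square_integrable_rep_L2)
  have Fm [measurable]: "F k \<in> borel_measurable lebesgue" for k
    using F by (simp add: square_integrable_def)
  have XF: "X (r k) = abs_L2 (F k)" for k
    by (simp add: F_def abs_rep_L2)
  have FF: "(\<integral>\<^sup>+x. ennreal ((cmod (F j x - F k x))\<^sup>2) \<partial>lebesgue) \<le> ennreal ((1/4)^k)"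
    if "j \<ge> k" for j k
  proof -
    have "(norm (X (r j) - X (r k)))\<^sup>2 \<le> ((1/2)^k)\<^sup>2"
      using rX[OF that] by (intro power_mono) auto
    also have "\<dots> = (1/4 :: real)^k"
      by (simp add: power2_eq_square power_mult_distrib[symmetric])
    finally show ?thesis
      unfolding norm_diff_abs_L2[OF F F, symmetric] XF by (rule ennreal_leI)
  qed
  define d where "d k x = cmod (F (Suc k) x - F k x)" for k x
  have dm [measurable]: "d k \<in> borel_measurable lebesgue" for k
    unfolding d_def by measurable
  have "(\<integral>\<^sup>+x. (\<Sum>k. ennreal (2^k * (d k x)\<^sup>2)) \<partial>lebesgue) =
      (\<Sum>k. \<integral>\<^sup>+x. ennreal (2^k * (d k x)\<^sup>2) \<partial>lebesgue)"
    by (intro nn_integral_suminf) measurable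
  also have "\<dots> \<le> (\<Sum>k. ennreal ((1/2)^k))"
  proof (intro suminf_le allI)
    fix k
    have "(\<integral>\<^sup>+x. ennreal (2^k * (d k x)\<^sup>2) \<partial>lebesgue) =
        ennreal (2^k) * (\<integral>\<^sup>+x. ennreal ((d k x)\<^sup>2) \<partial>lebesgue)"
      by (simp add: ennreal_mult nn_integral_cmult)
    also have "\<dots> \<le> ennreal (2^k) * ennreal ((1/4)^k)"
      using FF[of k "Suc k"] by (intro mult_left_mono) (auto simp: d_def)
    also have "\<dots> = ennreal ((1/2)^k)"
      by (simp add: ennreal_mult[symmetric] power_mult_distrib[symmetric])
    finally show "(\<integral>\<^sup>+x. ennreal (2^k * (d k x)\<^sup>2) \<partial>lebesgue) \<le> ennreal ((1/2)^k)" .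
  qed auto
  also have "\<dots> = ennreal (\<Sum>k. (1/2)^k)"
    by (intro suminf_ennreal2) auto
  also have "\<dots> < \<infinity>"
    by simp
  finally have fin: "(\<integral>\<^sup>+x. (\<Sum>k. ennreal (2^k * (d k x)\<^sup>2)) \<partial>lebesgue) \<noteq> \<infinity>"
    by simp
  have "AE x in lebesgue. (\<Sum>k. ennreal (2^k * (d k x)\<^sup>2)) \<noteq> \<infinity>"
    by (rule nn_integral_PInf_AE[OF _ fin]) measurable
  then have conv: "AE x in lebesgue. (\<lambda>k. F k x) \<longlonglongrightarrow> lim (\<lambda>k. F k x)"
  proof eventually_elim
    case (elim x)
    then have "summable (\<lambda>k. 2^k * (d k x)\<^sup>2)"
      by (intro summable_suminf_not_top) (auto simp: d_def)
    then have "Bseq (\<lambda>k. 2^k * (d k x)\<^sup>2)"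
      by (intro convergent_imp_Bseq) (auto simp: convergent_def dest: summable_LIMSEQ_zero)
    then obtain S where S: "\<And>k. norm (2^k * (d k x)\<^sup>2) \<le> S"
      by (auto simp: Bseq_def)
    have "d k x \<le> sqrt S * (sqrt (1/2))^k" for k
    proof -
      have "(d k x)\<^sup>2 \<le> S * (1/2)^k"
        using S[of k] by (simp add: field_simps)
      then have "sqrt ((d k x)\<^sup>2) \<le> sqrt (S * (1/2)^k)"
        by (rule real_sqrt_le_mono)
      then show ?thesis
        by (simp add: real_sqrt_mult real_sqrt_power d_def)
    qed
    then have *: "norm (d k x) \<le> sqrt S * (sqrt (1/2))^k" for k
      by (simp add: d_def)
    have "norm (sqrt (1/2)) < 1"
      by simp
    then have "summable (\<lambda>k. sqrt S * (sqrt (1/2))^k)"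
      by (intro summable_mult summable_geometric)
    then have "summable (\<lambda>k. d k x)"
      by (rule summable_comparison_test'[where N = 0]) (rule *)
    then have "summable (\<lambda>k. F (Suc k) x - F k x)"
      unfolding d_def by (rule summable_norm_cancel)
    then have "(\<lambda>n. \<Sum>k<n. F (Suc k) x - F k x) \<longlonglongrightarrow> (\<Sum>k. F (Suc k) x - F k x)"
      by (rule summable_LIMSEQ)
    then have "(\<lambda>n. (F n x - F 0 x) + F 0 x) \<longlonglongrightarrow> (\<Sum>k. F (Suc k) x - F k x) + F 0 x"
      unfolding sum_lessThan_telescope[of "\<lambda>k. F k x"] by (intro tendsto_intros)
    then show ?case
      by (auto simp: convergent_LIMSEQ_iff[symmetric] convergent_def)
  qed
  define G where "G x = lim (\<lambda>k. F k x)" for x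
  have Gm [measurable]: "G \<in> borel_measurable lebesgue"
    unfolding G_def by measurable
  have GF: "(\<integral>\<^sup>+x. ennreal ((cmod (G x - F k x))\<^sup>2) \<partial>lebesgue) \<le> ennreal ((1/4)^k)" for k
  proof -
    have "(\<integral>\<^sup>+x. ennreal ((cmod (G x - F k x))\<^sup>2) \<partial>lebesgue) =
        (\<integral>\<^sup>+x. liminf (\<lambda>j. ennreal ((cmod (F j x - F k x))\<^sup>2)) \<partial>lebesgue)"
    proof (rule nn_integral_cong_AE)
      show "AE x in lebesgue. ennreal ((cmod (G x - F k x))\<^sup>2) =
          liminf (\<lambda>j. ennreal ((cmod (F j x - F k x))\<^sup>2))"
        using conv
      proof eventually_elim
        case (elim x)
        then have "(\<lambda>j. ennreal ((cmod (F j x - F k x))\<^sup>2)) \<longlonglongrightarrow> ennreal ((cmod (G x - F k x))\<^sup>2)"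
          unfolding G_def by (intro tendsto_intros)
        then show ?case
          by (rule lim_imp_Liminf[OF sequentially_bot, symmetric])
      qed
    qed
    also have "\<dots> \<le> liminf (\<lambda>j. \<integral>\<^sup>+x. ennreal ((cmod (F j x - F k x))\<^sup>2) \<partial>lebesgue)"
      by (rule nn_integral_liminf) measurable
    also have "\<dots> \<le> liminf (\<lambda>j. ennreal ((1/4)^k))"
      using FF[of k] by (intro Liminf_mono) (auto simp: eventually_sequentially)
    also have "\<dots> = ennreal ((1/4)^k)"
      by (simp add: Liminf_const)
    finally show ?thesis .
  qed
  have "square_integrable (\<lambda>x. G x - F 0 x)"
    unfolding square_integrable_def using le_less_trans[OF GF[of 0] ennreal_less_top]
    by (auto intro!: integrableI_bounded)
  from square_integrable_add[OF this F[of 0]] have G: "square_integrable G"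
    by simp
  have "norm (X (r k) - abs_L2 G) \<le> (1/2)^k" for k
  proof -
    have "ennreal ((norm (abs_L2 G - X (r k)))\<^sup>2) \<le> ennreal ((1/4)^k)"
      unfolding XF norm_diff_abs_L2[OF G F] by (rule GF)
    then have "(norm (abs_L2 G - X (r k)))\<^sup>2 \<le> ((1/2)^k)\<^sup>2"
      by (simp add: power2_eq_square power_mult_distrib[symmetric])
    then have "norm (abs_L2 G - X (r k)) \<le> (1/2)^k"
      by (rule power2_le_imp_le) simp
    then show ?thesis by (simp add: norm_minus_commute)
  qed
  moreover have "(\<lambda>k. (1/2)^k) \<longlonglongrightarrow> (0::real)"
    by (rule LIMSEQ_power_zero) simp
  ultimately have "(\<lambda>k. X (r k) - abs_L2 G) \<longlonglongrightarrow> 0"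
    by (intro Lim_null_comparison[of "\<lambda>k. X (r k) - abs_L2 G" "\<lambda>k. (1/2)^k"]) auto
  then have "(X \<circ> r) \<longlonglongrightarrow> abs_L2 G"
    by (simp add: LIM_zero_iff comp_def)
  with X r show "convergent X"
    using Cauchy_converges_subseq convergent_def by blast
qed

section \<open>Multiplication operators and Sobolev spaces\<close>

definition L_infinity :: "(real \<Rightarrow> real) set" where
  "L_infinity = {V \<in> borel_measurable lebesgue. \<exists>C. AE x in lebesgue. \<bar>V x\<bar> \<le> C}"

text \<open>Multiplication by \<open>V\<close>; the value for \<open>V \<notin> L\<^sup>\<infinity>\<close> is junk.\<close>

lift_definition mult_op :: "(real \<Rightarrow> real) \<Rightarrow> L2 \<Rightarrow> L2" is
  "\<lambda>V f. if V \<in> L_infinity then (\<lambda>x. complex_of_real (V x) * f x) else (\<lambda>_. 0)"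
proof -
  have sq: "square_integrable (\<lambda>x. complex_of_real (V x) * f x)"
    if V: "V \<in> L_infinity" and f: "square_integrable f" for V f
  proof -
    obtain C where "AE x in lebesgue. \<bar>V x\<bar> \<le> C"
      using V by (auto simp: L_infinity_def)
    then have "AE x in lebesgue. cmod (complex_of_real (V x) * f x) \<le> C * cmod (f x)"
      by eventually_elim (simp add: norm_mult mult_right_mono)
    then show ?thesis
      using V f by (intro square_integrable_bound[OF _ f])
        (auto simp: L_infinity_def square_integrable_def)
  qed
  fix V f g
  assume "L2_rel f g"
  then show "L2_rel (if V \<in> L_infinity then \<lambda>x. complex_of_real (V x) * f x else (\<lambda>_. 0))
      (if V \<in> L_infinity then \<lambda>x. complex_of_real (V x) * g x else (\<lambda>_. 0))"
    by (auto simp: L2_rel_def sq square_integrable_zero elim: eventually_mono)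
qed

text \<open>The limit at \<open>F\<close> of a function determined only up to null sets.\<close>

definition ess_tendsto :: "(real \<Rightarrow> real) \<Rightarrow> real \<Rightarrow> real filter \<Rightarrow> bool" where
  "ess_tendsto V m F \<longleftrightarrow> (\<exists>W. (AE x in lebesgue. W x = V x) \<and> (W \<longlongrightarrow> m) F)"

lift_definition agree_on :: "real set \<Rightarrow> L2 \<Rightarrow> (real \<Rightarrow> complex) \<Rightarrow> bool" is
  "\<lambda>S f u. AE x in lebesgue. x \<in> S \<longrightarrow> f x = u x"
  by (intro ext iffI) (auto simp: L2_rel_def elim: eventually_elim2)

text \<open>\<open>L\<^sup>2(S)\<close> is identified with a closed subspace of \<open>L\<^sup>2(\<real>)\<close> via extension by zero.\<close>

definition L2_on :: "real set \<Rightarrow> L2 set" where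
  "L2_on S = {f. agree_on (- S) f (\<lambda>_. 0)}"

definition test_functions :: "real set \<Rightarrow> (real \<Rightarrow> real) set" where
  "test_functions S =
     {\<phi>. (\<forall>k x. (deriv ^^ k) \<phi> differentiable (at x)) \<and>
         (\<exists>K. compact K \<and> K \<subseteq> S \<and> (\<forall>x. x \<notin> K \<longrightarrow> \<phi> x = 0))}"

text \<open>\<open>g\<close> is the weak derivative of \<open>f\<close> on the open set \<open>S\<close>.\<close>

lift_definition has_weak_deriv_on :: "real set \<Rightarrow> L2 \<Rightarrow> L2 \<Rightarrow> bool" is
  "\<lambda>S f g. \<forall>\<phi>\<in>test_functions S.
     (\<integral>x. deriv \<phi> x *\<^sub>R f x \<partial>lebesgue) = - (\<integral>x. \<phi> x *\<^sub>R g x \<partial>lebesgue)"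
proof -
  have eq: "(\<integral>x. \<psi> x *\<^sub>R f x \<partial>lebesgue) = (\<integral>x. \<psi> x *\<^sub>R g x \<partial>lebesgue)"
    if fg: "L2_rel f g" and \<psi>: "\<And>x. \<psi> differentiable (at x)" for f g and \<psi> :: "real \<Rightarrow> real"
  proof (rule integral_cong_AE)
    have "continuous_on UNIV \<psi>"
      using \<psi> by (simp add: continuous_on_eq_continuous_within differentiable_imp_continuous_within)
    then have "\<psi> \<in> borel_measurable lebesgue"
      by (intro measurable_completion) (simp add: borel_measurable_continuous_onI)
    then show "(\<lambda>x. \<psi> x *\<^sub>R f x) \<in> borel_measurable lebesgue"
        "(\<lambda>x. \<psi> x *\<^sub>R g x) \<in> borel_measurable lebesgue"
      using fg by (auto simp: L2_rel_def square_integrable_def)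
    have "AE x in lebesgue. f x = g x"
      using fg by (simp add: L2_rel_def)
    then show "AE x in lebesgue. \<psi> x *\<^sub>R f x = \<psi> x *\<^sub>R g x"
      by eventually_elim simp
  qed
  have test: "\<phi> differentiable (at x)" "deriv \<phi> differentiable (at x)"
    if "\<phi> \<in> test_functions S" for \<phi> S and x :: real
  proof -
    have "(deriv ^^ k) \<phi> differentiable (at x)" for k
      using that by (simp add: test_functions_def)
    from this[of 0] this[of 1] show "\<phi> differentiable (at x)" "deriv \<phi> differentiable (at x)"
      by simp_all
  qed
  fix S and f f' g g' :: "real \<Rightarrow> complex"
  assume "L2_rel f f'" "L2_rel g g'"
  then show "(\<forall>\<phi>\<in>test_functions S.
        (\<integral>x. deriv \<phi> x *\<^sub>R f x \<partial>lebesgue) = - (\<integral>x. \<phi> x *\<^sub>R g x \<partial>lebesgue)) =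
      (\<forall>\<phi>\<in>test_functions S.
        (\<integral>x. deriv \<phi> x *\<^sub>R f' x \<partial>lebesgue) = - (\<integral>x. \<phi> x *\<^sub>R g' x \<partial>lebesgue))"
    by (intro ball_cong refl) (simp add: eq test)
qed

definition weak_deriv :: "real set \<Rightarrow> L2 \<Rightarrow> L2" where
  "weak_deriv S f = (THE g. g \<in> L2_on S \<and> has_weak_deriv_on S f g)"

definition W22 :: "real set \<Rightarrow> L2 set" where
  "W22 S = {f \<in> L2_on S. \<exists>g\<in>L2_on S. \<exists>h\<in>L2_on S.
     has_weak_deriv_on S f g \<and> has_weak_deriv_on S g h}"

definition schroedinger :: "(real \<Rightarrow> real) \<Rightarrow> real set \<Rightarrow> L2 \<Rightarrow> L2" where
  "schroedinger V S f = - weak_deriv S (weak_deriv S f) + mult_op V f"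

text \<open>Boundary values are those of the representative that is continuous up to the boundary.\<close>

definition W22_dirichlet :: "real \<Rightarrow> L2 set" where
  "W22_dirichlet r = {f \<in> W22 {-r<..<r}. \<exists>u. continuous_on {-r..r} u \<and>
     agree_on {-r<..<r} f u \<and> u (-r) = 0 \<and> u r = 0}"

end

theory Submission
  imports Defs "HOL-Computational_Algebra.Polynomial"
begin

text \<open>Let \<open>S(z) = T - z J\<close> and let \<open>S\<^sub>n(z)\<close> be an approximating pencil. If \<open>z\<close> is not in the
  spectrum, then some real combination \<open>Re + t Im\<close> of the form of \<open>S(z)\<close> is the form of \<open>T - \<mu> J\<close>
  with \<open>- m_minus < \<mu> < m_plus\<close>: for real \<open>z\<close> because singular sequences at infinity exclude the
  other values, and for nonreal \<open>z\<close> with \<open>\<mu> = 0\<close>. The potential \<open>V - \<mu> J\<close> is positive near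
  infinity, so by Poincare's inequality on small intervals this form is positive definite up to a
  finite-rank term \<open>C \<Sum> |\<langle>f, \<phi>\<rangle>|\<^sup>2\<close>, uniformly in \<open>n\<close>. As every \<open>\<phi>\<close> is in the range of
  \<open>S(cnj z)\<close>, the finite-rank term tends to \<open>0\<close> along almost-kernel elements of \<open>S\<^sub>n(z)\<close>, and hence
  \<open>S\<^sub>n(\<zeta>)\<close> is invertible for large \<open>n\<close> and \<open>\<zeta>\<close> near \<open>z\<close>.

  If \<open>T\<close> is uniformly positive, then so is \<open>T\<^sub>n\<close>, and \<open>T\<^sub>n\<inverse> J\<^sub>n\<close> is self-adjoint for the energy inner
  product. A gap of its spectrum therefore bounds \<open>S\<^sub>n(l)\<close> from below in the middle of the gap by a
  constant that depends only on the gap, and this bound passes to the limit.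

  The Dirichlet operators and the operator on the line are treated together as form operators: the
  test functions are dense in \<open>H\<^sup>1\<^sub>0(S)\<close> because a function orthogonal to them solves \<open>f'' = f\<close>.\<close>

section \<open>Complex inner product spaces\<close>

text \<open>The form of \<open>T - z J\<close> need not be definite and the operator is not
  self-adjoint for nonreal \<open>z\<close>. A combination \<open>Re + t Im\<close> is admissible
  because it is at most \<open>(1 + |t|)\<close> times the norm of \<open>S(z) x\<close> times that
  of \<open>x\<close>, so its coercivity bounds \<open>S(z)\<close> from below. Poincare's
  inequality on finitely many cells takes the place of a compact embedding. The constants are
  uniform in \<open>n\<close> because every approximating domain consists, after extension by zero,
  of H1 functions on the line with the same form. Invertibility is obtained from lower bounds at
  \<open>z\<close> and at its conjugate: one yields injectivity and closed range, the other dense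
  range.

  If \<open>T\<close> is uniformly positive, the limit spectrum is real and avoids 0, so
  \<open>1/l\<close> is available. \<open>T\<inverse> J\<close> is in general not symmetric for the
  original inner product, which is why the energy inner product enters. The domain need not be
  complete in the energy norm; instead of completing it and using the spectral theorem, one works
  with approximate eigenvectors, found by minimising a quotient and factoring a difference of
  squares.\<close>

lemma cinner_add_right: "cinner x (y + y') = cinner x y + cinner x (y'::'a::complex_inner)"
  by (subst (1 2 3) cinner_commute) (simp add: cinner_add_left)

lemma cinner_scaleC_right: "cinner x (z *\<^sub>C y) = cnj z * cinner x (y::'a::complex_inner)"
  by (subst (1 2) cinner_commute) (simp add: cinner_scaleC_left)

lemma scaleC_minus_one: "(-1) *\<^sub>C x = - (x::'a::complex_inner)"
  using scaleC_of_real[of "-1" x] by simp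

lemma scaleC_minus_right: "z *\<^sub>C (- x) = - (z *\<^sub>C (x::'a::complex_inner))"
  unfolding scaleC_minus_one[symmetric] scaleC_scaleC by simp

lemma scaleC_diff_right: "z *\<^sub>C (x - y) = z *\<^sub>C x - z *\<^sub>C (y::'a::complex_inner)"
  using scaleC_add_right[of z x "- y"] by (simp add: scaleC_minus_right)

lemma scaleC_zero_left [simp]: "0 *\<^sub>C x = (0::'a::complex_inner)"
  using scaleC_of_real[of 0 x] by simp

lemma scaleC_zero_right [simp]: "z *\<^sub>C (0::'a::complex_inner) = 0"
  using scaleC_add_right[of z 0 "0::'a"] by simp

lemma scaleC_one [simp]: "1 *\<^sub>C x = (x::'a::complex_inner)"
  using scaleC_of_real[of 1 x] by simp

lemma scaleR_conv_scaleC: "r *\<^sub>R x = complex_of_real r *\<^sub>C (x::'a::complex_inner)"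
  by (simp add: scaleC_of_real)

lemma cinner_minus_left: "cinner (- x) y = - cinner (x::'a::complex_inner) y"
  unfolding scaleC_minus_one[symmetric] cinner_scaleC_left by simp

lemma cinner_minus_right: "cinner x (- y) = - cinner (x::'a::complex_inner) y"
  unfolding scaleC_minus_one[symmetric] cinner_scaleC_right by simp

lemma cinner_diff_left: "cinner (x - x') y = cinner x y - cinner (x'::'a::complex_inner) y"
  using cinner_add_left[of x "- x'" y] by (simp add: cinner_minus_left)

lemma cinner_diff_right: "cinner x (y - y') = cinner x y - cinner (x::'a::complex_inner) y'"
  using cinner_add_right[of x y "- y'"] by (simp add: cinner_minus_right)

lemma cinner_zero_left [simp]: "cinner 0 (y::'a::complex_inner) = 0"
  using cinner_scaleC_left[of 0 0 y] by simp

lemma cinner_zero_right [simp]: "cinner (y::'a::complex_inner) 0 = 0"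
  by (subst cinner_commute) simp

lemma cinner_scaleR_left: "cinner (r *\<^sub>R x) y = complex_of_real r * cinner (x::'a::complex_inner) y"
  by (simp add: scaleR_conv_scaleC cinner_scaleC_left)

lemma cinner_scaleR_right: "cinner x (r *\<^sub>R y) = complex_of_real r * cinner (x::'a::complex_inner) y"
  by (simp add: scaleR_conv_scaleC cinner_scaleC_right)

lemmas cinner_algebra = cinner_add_left cinner_add_right cinner_diff_left cinner_diff_right
  cinner_scaleC_left cinner_scaleC_right cinner_minus_left cinner_minus_right

lemma Im_cinner: "Im (cinner x y) = Re (cinner x (\<i> *\<^sub>C (y::'a::complex_inner)))"
  by (simp add: cinner_scaleC_right)

lemma cinner_self: "cinner x x = complex_of_real ((norm (x::'a::complex_inner))\<^sup>2)"
proof (rule complex_eqI)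
  show "Re (cinner x x) = Re (complex_of_real ((norm x)\<^sup>2))"
    by (simp add: inner_eq_Re_cinner[symmetric] power2_norm_eq_inner)
  have "Im (cinner x x) = - Im (cinner x x)"
    by (subst cinner_commute) simp
  then show "Im (cinner x x) = Im (complex_of_real ((norm x)\<^sup>2))"
    by simp
qed

lemma norm_scaleC: "norm (z *\<^sub>C x) = cmod z * norm (x::'a::complex_inner)"
proof -
  have "complex_of_real ((norm (z *\<^sub>C x))\<^sup>2) = (z * cnj z) * cinner x x"
    unfolding cinner_self[symmetric] cinner_scaleC_left cinner_scaleC_right by simp
  also have "\<dots> = complex_of_real ((cmod z * norm x)\<^sup>2)"
    unfolding complex_norm_square[symmetric] cinner_self by (simp add: power_mult_distrib)
  finally have "complex_of_real ((norm (z *\<^sub>C x))\<^sup>2) = complex_of_real ((cmod z * norm x)\<^sup>2)" .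
  then have "(norm (z *\<^sub>C x))\<^sup>2 = (cmod z * norm x)\<^sup>2"
    using of_real_eq_iff by blast
  then show ?thesis by (simp add: power2_eq_iff_nonneg)
qed

lemma cinner_norm_bound: "cmod (cinner x y) \<le> norm x * norm (y::'a::complex_inner)"
proof (cases "cinner x y = 0")
  case False
  \<comment> \<open>The phase that rotates the inner product onto the positive real axis; this
    reduces the claim to the real Cauchy-Schwarz inequality.\<close>
  define u where "u = cnj (cinner x y) / cmod (cinner x y)"
  have u: "cmod u = 1" using False by (simp add: u_def norm_divide)
  have "cinner (u *\<^sub>C x) y = complex_of_real (cmod (cinner x y))"
    using False unfolding cinner_scaleC_left u_def
    by (simp add: mult.commute complex_norm_square[symmetric] power2_eq_square
        flip: of_real_power of_real_mult)
       (simp add: complex_norm_square[symmetric] power2_eq_square flip: of_real_power)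
  then have "cmod (cinner x y) = inner (u *\<^sub>C x) y"
    by (simp add: inner_eq_Re_cinner)
  also have "\<dots> \<le> norm (u *\<^sub>C x) * norm y"
    by (rule norm_cauchy_schwarz)
  finally show ?thesis by (simp add: norm_scaleC u)
qed simp

lemma bounded_bilinear_cinner:
  "bounded_bilinear (cinner :: 'a::complex_inner \<Rightarrow> 'a \<Rightarrow> complex)"
proof
  show "\<exists>K. \<forall>a b. norm (cinner (a::'a) b) \<le> norm a * norm b * K"
    using cinner_norm_bound by (intro exI[of _ 1]) auto
qed (simp_all add: cinner_algebra scaleR_conv_scaleC scaleR_conv_of_real)

lemma bounded_bilinear_scaleC:
  "bounded_bilinear (scaleC :: complex \<Rightarrow> 'a::complex_inner \<Rightarrow> 'a)"
proof
  show "\<exists>K. \<forall>a (b::'a). norm (a *\<^sub>C b) \<le> norm a * norm b * K"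
    by (intro exI[of _ 1]) (simp add: norm_scaleC)
qed (simp_all add: scaleC_add_left scaleC_add_right scaleR_conv_scaleC scaleC_scaleC
    scaleR_conv_of_real mult.commute)

lemmas tendsto_cinner [tendsto_intros] = bounded_bilinear.tendsto[OF bounded_bilinear_cinner]
lemmas tendsto_scaleC [tendsto_intros] = bounded_bilinear.tendsto[OF bounded_bilinear_scaleC]

definition csubspace :: "'a::complex_inner set \<Rightarrow> bool" where
  "csubspace U \<longleftrightarrow> 0 \<in> U \<and> (\<forall>x\<in>U. \<forall>y\<in>U. x + y \<in> U) \<and> (\<forall>z. \<forall>x\<in>U. z *\<^sub>C x \<in> U)"

lemma
  assumes "csubspace U"
  shows csubspace_zero: "0 \<in> U"
    and csubspace_add: "x \<in> U \<Longrightarrow> y \<in> U \<Longrightarrow> x + y \<in> U"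
    and csubspace_scaleC: "x \<in> U \<Longrightarrow> z *\<^sub>C x \<in> U"
    and csubspace_scaleR: "x \<in> U \<Longrightarrow> r *\<^sub>R x \<in> U"
    and csubspace_uminus: "x \<in> U \<Longrightarrow> - x \<in> U"
    and csubspace_diff: "x \<in> U \<Longrightarrow> y \<in> U \<Longrightarrow> x - y \<in> U"
proof -
  show a: "0 \<in> U" "\<And>x y. x \<in> U \<Longrightarrow> y \<in> U \<Longrightarrow> x + y \<in> U" "\<And>x z. x \<in> U \<Longrightarrow> z *\<^sub>C x \<in> U"
    using assms by (auto simp: csubspace_def)
  show "x \<in> U \<Longrightarrow> r *\<^sub>R x \<in> U" using a(3) by (simp add: scaleR_conv_scaleC)
  show m: "x \<in> U \<Longrightarrow> - x \<in> U" for x using a(3)[of x "-1"] by (simp add: scaleC_minus_one)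
  show "x \<in> U \<Longrightarrow> y \<in> U \<Longrightarrow> x - y \<in> U" using a(2)[of x "- y"] m[of y] by simp
qed

lemma csubspace_imp_subspace: "csubspace U \<Longrightarrow> subspace U"
  by (simp add: subspace_def csubspace_zero csubspace_add csubspace_scaleR)

section \<open>Orthogonal projections\<close>

text \<open>Kept real because it is also applied to graphs in the product of \<open>L2\<close> with
  itself, which here carries only a real inner product.\<close>

lemma projection_theorem:
  fixes G :: "'a::{real_inner, complete_space} set"
  assumes "subspace G" "closed G"
  obtains p where "p \<in> G" "\<And>q. q \<in> G \<Longrightarrow> inner (x - p) q = 0"
proof -
  define d where "d = infdist x G"
  have ne: "G \<noteq> {}" using subspace_0[OF assms(1)] by auto
  have dle: "d \<le> dist x q" if "q \<in> G" for q
    unfolding d_def using that by (rule infdist_le)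
  have d0: "0 \<le> d" unfolding d_def by (rule infdist_nonneg)
  have "\<exists>q\<in>G. dist x q < d + inverse (real (Suc n))" for n
  proof -
    have "(INF q\<in>G. dist x q) < d + inverse (real (Suc n))"
      using ne by (simp add: d_def infdist_notempty)
    then show ?thesis using ne by (subst (asm) cINF_less_iff) (auto intro!: bdd_belowI2[of _ 0])
  qed
  then obtain q where q: "\<And>n. q n \<in> G" "\<And>n. dist x (q n) < d + inverse (real (Suc n))"
    by metis
  have lim: "(\<lambda>n. (d + inverse (real (Suc n)))\<^sup>2) \<longlonglongrightarrow> d\<^sup>2"
  proof -
    have "(\<lambda>n. (d + inverse (real (Suc n)))\<^sup>2) \<longlonglongrightarrow> (d + 0)\<^sup>2"
      by (intro tendsto_intros LIMSEQ_inverse_real_of_nat)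
    then show ?thesis by simp
  qed
  \<comment> \<open>Parallelogram identity: the midpoint of two almost nearest points lies in
    \<open>G\<close>, so its distance from \<open>x\<close> is at least \<open>d\<close>, which
    makes the sequence Cauchy.\<close>
  have par: "(norm (q m - q n))\<^sup>2 \<le>
      2 * ((d + inverse (real (Suc m)))\<^sup>2 - d\<^sup>2) + 2 * ((d + inverse (real (Suc n)))\<^sup>2 - d\<^sup>2)" for m n
  proof -
    have "(1/2) *\<^sub>R (q m + q n) \<in> G"
      using q(1) assms(1) by (simp add: subspace_add subspace_mul)
    then have "d\<^sup>2 \<le> (norm (x - (1/2) *\<^sub>R (q m + q n)))\<^sup>2"
      using dle d0 unfolding dist_norm by (intro power_mono) auto
    moreover have "(norm (x - (1/2) *\<^sub>R (q m + q n)))\<^sup>2 * 4 =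
        2 * (norm (x - q m))\<^sup>2 + 2 * (norm (x - q n))\<^sup>2 - (norm (q m - q n))\<^sup>2"
      unfolding power2_norm_eq_inner
      by (simp add: inner_diff_left inner_diff_right inner_add_left inner_add_right inner_commute
          field_simps)
    moreover have "(norm (x - q k))\<^sup>2 \<le> (d + inverse (real (Suc k)))\<^sup>2" for k
      using q(2)[of k] unfolding dist_norm by (intro power_mono) auto
    from this[of m] this[of n] calculation show ?thesis by argo
  qed
  have "Cauchy q"
  proof (rule metric_CauchyI)
    fix e :: real assume "e > 0"
    then have "\<forall>\<^sub>F n in sequentially. (d + inverse (real (Suc n)))\<^sup>2 < d\<^sup>2 + e\<^sup>2 / 4"
      by (intro order_tendstoD(2)[OF lim]) auto
    then obtain N where N: "\<And>n. n \<ge> N \<Longrightarrow> (d + inverse (real (Suc n)))\<^sup>2 < d\<^sup>2 + e\<^sup>2 / 4"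
      unfolding eventually_sequentially by auto
    show "\<exists>M. \<forall>m\<ge>M. \<forall>n\<ge>M. dist (q m) (q n) < e"
    proof (intro exI[of _ N] allI impI)
      fix m n assume mn: "m \<ge> N" "n \<ge> N"
      have "(norm (q m - q n))\<^sup>2 < e\<^sup>2"
        using par[of m n] N[OF mn(1)] N[OF mn(2)] by argo
      then show "dist (q m) (q n) < e"
        unfolding dist_norm using \<open>e > 0\<close> by (simp add: power2_less_imp_less)
    qed
  qed
  then obtain p where p: "q \<longlonglongrightarrow> p"
    using Cauchy_convergent convergent_def by blast
  have pG: "p \<in> G"
    using closed_sequentially[OF assms(2) _ p] q(1) by blast
  have "(\<lambda>n. dist x (q n)) \<longlonglongrightarrow> dist x p"
    by (intro tendsto_intros p)
  moreover have "(\<lambda>n. d + inverse (real (Suc n))) \<longlonglongrightarrow> d + 0"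
    by (intro tendsto_intros LIMSEQ_inverse_real_of_nat)
  ultimately have pd: "norm (x - p) \<le> d"
    unfolding dist_norm using q(2) less_imp_le
    by (intro LIMSEQ_le[of _ _ "\<lambda>n. d + inverse (real (Suc n))"]) (auto simp: dist_norm)
  have "inner (x - p) g = 0" if g: "g \<in> G" for g
  proof (cases "g = 0")
    case False
    \<comment> \<open>The coefficient that minimises the distance from \<open>x - p\<close> to the
      line spanned by \<open>g\<close>; since \<open>p\<close> is nearest, the resulting gain must
      be 0.\<close>
    define t where "t = inner (x - p) g / inner g g"
    have "p + t *\<^sub>R g \<in> G"
      using pG g assms(1) by (simp add: subspace_add subspace_mul)
    from dle[OF this] have "norm (x - p) \<le> norm (x - p - t *\<^sub>R g)"
      using pd by (simp add: dist_norm algebra_simps)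
    then have "(norm (x - p))\<^sup>2 \<le> (norm (x - p - t *\<^sub>R g))\<^sup>2"
      by (intro power_mono) auto
    also have "\<dots> = (norm (x - p))\<^sup>2 - (inner (x - p) g)\<^sup>2 / inner g g"
    proof -
      have "(norm (y - t *\<^sub>R g))\<^sup>2 = (norm y)\<^sup>2 - 2 * t * inner y g + t\<^sup>2 * inner g g" for y t
        unfolding power2_norm_eq_inner
        by (simp add: inner_diff_left inner_diff_right inner_commute[of g y] power2_eq_square algebra_simps)
      then show ?thesis using False by (simp add: t_def power2_eq_square)
    qed
    finally have "(inner (x - p) g)\<^sup>2 / inner g g \<le> 0" by simp
    moreover have "inner g g > 0" using False by simp
    ultimately show ?thesis by (auto simp: divide_le_0_iff)
  qed simp
  with pG show thesis by (rule that)
qed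

lemma complex_projection_theorem:
  fixes U :: "'a::complex_hilbert set"
  assumes "csubspace U" "closed U"
  obtains p where "p \<in> U" "\<And>q. q \<in> U \<Longrightarrow> cinner (x - p) q = 0"
proof -
  obtain p where p: "p \<in> U" "\<And>q. q \<in> U \<Longrightarrow> inner (x - p) q = 0"
    using projection_theorem[OF csubspace_imp_subspace assms(2)] assms(1) by metis
  have "cinner (x - p) q = 0" if "q \<in> U" for q
    using p(2)[OF that] p(2)[OF csubspace_scaleC[OF assms(1) that, of \<i>]]
    by (simp add: inner_eq_Re_cinner Im_cinner[symmetric] complex_eq_iff)
  with p(1) show thesis by (rule that)
qed

lemma orth_proj_eqI:
  assumes "csubspace U" "g \<in> U" "\<And>u. u \<in> U \<Longrightarrow> cinner (f - g) u = 0"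
  shows "orth_proj U f = g"
  unfolding orth_proj_def
proof (rule the_equality)
  fix g' assume g': "g' \<in> U \<and> (\<forall>u\<in>U. cinner (f - g') u = 0)"
  then have "cinner (g' - g) (g' - g) = 0"
    using assms(3)[of "g' - g"] csubspace_diff[OF assms(1), of g' g] assms(2)
    by (simp add: cinner_algebra)
  then show "g' = g" by (simp add: cinner_self)
qed (use assms in auto)

lemma
  assumes "csubspace U" "closed U"
  shows orth_proj_in: "orth_proj U f \<in> U"
    and orth_proj_orth: "u \<in> U \<Longrightarrow> cinner (f - orth_proj U f) u = 0"
proof -
  obtain p where "p \<in> U" "\<And>q. q \<in> U \<Longrightarrow> cinner (f - p) q = 0"
    using complex_projection_theorem[OF assms] by metis
  moreover from this have "orth_proj U f = p" by (intro orth_proj_eqI assms)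
  ultimately show "orth_proj U f \<in> U" "u \<in> U \<Longrightarrow> cinner (f - orth_proj U f) u = 0" by simp_all
qed

lemma cinner_orth_proj:
  assumes "csubspace U" "closed U" "u \<in> U"
  shows "cinner (orth_proj U f) u = cinner f u"
  using orth_proj_orth[OF assms, of f] by (simp add: cinner_diff_left)

lemma norm_orth_proj_le:
  assumes "csubspace U" "closed U"
  shows "norm (orth_proj U f) \<le> norm f"
proof -
  let ?p = "orth_proj U f"
  have "(norm ?p)\<^sup>2 = cmod (cinner f ?p)"
    using cinner_orth_proj[OF assms orth_proj_in[OF assms, of f], of f]
    by (simp add: cinner_self[of ?p] norm_power flip: cinner_orth_proj[OF assms orth_proj_in[OF assms, of f], of f])
  also have "\<dots> \<le> norm f * norm ?p" by (rule cinner_norm_bound)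
  finally show ?thesis
    by (cases "norm ?p = 0") (simp_all add: power2_eq_square)
qed

lemma
  assumes U: "csubspace U" "closed U"
  shows orth_proj_add: "orth_proj U (f + g) = orth_proj U f + orth_proj U g"
    and orth_proj_scaleC: "orth_proj U (z *\<^sub>C f) = z *\<^sub>C orth_proj U f"
    and orth_proj_diff: "orth_proj U (f - g) = orth_proj U f - orth_proj U g"
  using cinner_orth_proj[OF U]
  by (auto intro!: orth_proj_eqI csubspace_add csubspace_scaleC csubspace_diff U orth_proj_in
      simp: cinner_algebra)

lemma csubspace_cspan: "csubspace (cspan B)"
  by (simp add: csubspace_def complex_vector.span_zero complex_vector.span_add
      complex_vector.span_scale)

text \<open>Gram-Schmidt by induction: the new vector is replaced by its component \<open>e\<close>
  orthogonal to the old span. The coefficient of \<open>e\<close> is then a continuous function of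
  \<open>x\<close>, and the larger span is the preimage of a closed set.\<close>

lemma closed_cspan_finite:
  fixes B :: "'a::complex_hilbert set"
  assumes "finite B"
  shows "closed (cspan B)"
  using assms
proof (induction B)
  case empty
  then show ?case by (simp add: complex_vector.span_empty)
next
  case (insert b B)
  let ?U = "cspan B"
  define e where "e = b - orth_proj ?U b"
  note U = csubspace_cspan[of B] insert.IH
  have orth: "cinner e u = 0" if "u \<in> ?U" for u
    using orth_proj_orth[OF U that] by (simp add: e_def)
  have span: "cspan (insert b B) = {x. \<exists>z. x - z *\<^sub>C e \<in> ?U}"
  proof -
    have "x - z *\<^sub>C b \<in> ?U \<longleftrightarrow> x - z *\<^sub>C e \<in> ?U" for x z
    proof -
      have *: "z *\<^sub>C orth_proj ?U b \<in> ?U"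
        by (intro csubspace_scaleC U orth_proj_in)
      have "x - z *\<^sub>C e = (x - z *\<^sub>C b) + z *\<^sub>C orth_proj ?U b"
        by (simp add: e_def scaleC_diff_right)
      with * show ?thesis
        by (metis U(1) add_diff_cancel_right' csubspace_add csubspace_diff)
    qed
    then show ?thesis by (simp add: complex_vector.span_insert)
  qed
  show ?case
  proof (cases "e = 0")
    case True
    then show ?thesis using insert.IH by (simp add: span)
  next
    case False
    define c where "c x = cinner x e / cinner e e" for x
    have "x - z *\<^sub>C e \<in> ?U \<Longrightarrow> x - c x *\<^sub>C e \<in> ?U" for x z
    proof -
      assume *: "x - z *\<^sub>C e \<in> ?U"
      have "cinner e (x - z *\<^sub>C e) = 0" by (rule orth[OF *])
      then have "cinner (x - z *\<^sub>C e) e = 0" by (subst cinner_commute) simp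
      then have "z = c x" using False by (simp add: c_def cinner_algebra cinner_self)
      then show ?thesis using * by simp
    qed
    then have "cspan (insert b B) = {x. x - c x *\<^sub>C e \<in> ?U}"
      unfolding span by blast
    also have "closed \<dots>"
    proof -
      have "continuous_on UNIV (\<lambda>x. x - c x *\<^sub>C e)"
        unfolding c_def
        by (intro continuous_on_diff bounded_bilinear.continuous_on[OF bounded_bilinear_scaleC]
            bounded_bilinear.continuous_on[OF bounded_bilinear_cinner] continuous_intros)
           (use False in \<open>simp add: cinner_self\<close>)
      from continuous_closed_vimage[OF insert.IH] this
      show ?thesis by (auto simp: vimage_def continuous_on_eq_continuous_within)
    qed
    finally show ?thesis .
  qed
qed

lemma finite_dimensional_subspaceD:
  fixes U :: "'a::complex_hilbert set"
  assumes "finite_dimensional_subspace U"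
  shows "csubspace U" "closed U"
  using assms by (auto simp: finite_dimensional_subspace_def csubspace_cspan closed_cspan_finite)

section \<open>Self-adjoint pencils\<close>

text \<open>The space \<open>U\<close> is a parameter because the approximating operators act in
  proper subspaces of the ambient space. \<open>T_sa\<close> says that the adjoint of
  \<open>T\<close> in \<open>U\<close> does not extend \<open>T\<close>; for \<open>u = 0\<close> it
  says that only 0 in \<open>U\<close> is orthogonal to \<open>D\<close>, so it includes density.
  The bound \<open>M\<close> is a parameter so that a whole family of pencils can share it.\<close>

locale selfadjoint_pencil =
  fixes U D :: "'a::complex_hilbert set" and T J :: "'a \<Rightarrow> 'a" and M :: real
  assumes U: "csubspace U" "closed U"
    and D: "csubspace D" "D \<subseteq> U"
    and T_in: "x \<in> D \<Longrightarrow> T x \<in> U"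
    and T_add: "x \<in> D \<Longrightarrow> y \<in> D \<Longrightarrow> T (x + y) = T x + T y"
    and T_scaleC: "x \<in> D \<Longrightarrow> T (z *\<^sub>C x) = z *\<^sub>C T x"
    and T_sym: "x \<in> D \<Longrightarrow> y \<in> D \<Longrightarrow> cinner (T x) y = cinner x (T y)"
    and T_sa: "u \<in> U \<Longrightarrow> w \<in> U \<Longrightarrow> (\<And>x. x \<in> D \<Longrightarrow> cinner (T x) u = cinner x w) \<Longrightarrow>
      u \<in> D \<and> T u = w"
    and J_in: "x \<in> U \<Longrightarrow> J x \<in> U"
    and J_add: "x \<in> U \<Longrightarrow> y \<in> U \<Longrightarrow> J (x + y) = J x + J y"
    and J_scaleC: "x \<in> U \<Longrightarrow> J (z *\<^sub>C x) = z *\<^sub>C J x"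
    and J_sym: "x \<in> U \<Longrightarrow> y \<in> U \<Longrightarrow> cinner (J x) y = cinner x (J y)"
    and J_bound: "x \<in> U \<Longrightarrow> norm (J x) \<le> M * norm x"
begin

abbreviation spec :: "complex set" where "spec \<equiv> pencil_spectrum U D T J"

definition S :: "complex \<Rightarrow> 'a \<Rightarrow> 'a" where "S z x = T x - z *\<^sub>C J x"

definition bounded_below :: "complex \<Rightarrow> bool" where
  "bounded_below z \<longleftrightarrow> (\<exists>C. \<forall>x\<in>D. norm x \<le> C * norm (S z x))"

lemma mem_D_U: "x \<in> D \<Longrightarrow> x \<in> U" using D by auto

lemma T_diff: "x \<in> D \<Longrightarrow> y \<in> D \<Longrightarrow> T (x - y) = T x - T y"
  using T_add[of x "- y"] T_scaleC[of y "-1"] csubspace_uminus[OF D(1)]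
  by (simp add: scaleC_minus_one)

lemma J_diff: "x \<in> U \<Longrightarrow> y \<in> U \<Longrightarrow> J (x - y) = J x - J y"
  using J_add[of x "- y"] J_scaleC[of y "-1"] csubspace_uminus[OF U(1)]
  by (simp add: scaleC_minus_one)

lemma S_in: "x \<in> D \<Longrightarrow> S z x \<in> U"
  unfolding S_def by (intro csubspace_diff csubspace_scaleC U T_in J_in mem_D_U)

lemma S_add: "x \<in> D \<Longrightarrow> y \<in> D \<Longrightarrow> S z (x + y) = S z x + S z y"
  by (simp add: S_def T_add J_add mem_D_U scaleC_add_right)

lemma S_diff: "x \<in> D \<Longrightarrow> y \<in> D \<Longrightarrow> S z (x - y) = S z x - S z y"
  by (simp add: S_def T_diff J_diff mem_D_U scaleC_diff_right)

lemma S_scaleC: "x \<in> D \<Longrightarrow> S z (w *\<^sub>C x) = w *\<^sub>C S z x"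
  by (simp add: S_def T_scaleC J_scaleC mem_D_U scaleC_diff_right scaleC_scaleC mult.commute)

lemma S_adj: "x \<in> D \<Longrightarrow> y \<in> D \<Longrightarrow> cinner (S z x) y = cinner x (S (cnj z) y)"
  by (simp add: S_def cinner_algebra T_sym J_sym mem_D_U)

lemma not_spec_iff:
  "z \<notin> spec \<longleftrightarrow> bij_betw (S z) D U \<and> bounded_below z"
  by (simp add: pencil_spectrum_def op_spectrum_def bounded_below_def S_def[abs_def])

text \<open>Subtracting a bounded operator does not change the domain of the adjoint; hence
  \<open>S z\<close> is the full adjoint of \<open>S (cnj z)\<close>.\<close>

lemma S_sa:
  assumes "u \<in> U" "w \<in> U" "\<And>x. x \<in> D \<Longrightarrow> cinner (S (cnj z) x) u = cinner x w"
  shows "u \<in> D \<and> S z u = w"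
proof -
  have "u \<in> D \<and> T u = w + z *\<^sub>C J u"
  proof (rule T_sa)
    fix x assume "x \<in> D"
    then show "cinner (T x) u = cinner x (w + z *\<^sub>C J u)"
      using assms(3)[of x] assms(1) by (simp add: S_def cinner_algebra J_sym mem_D_U diff_eq_eq)
  qed (intro assms csubspace_add csubspace_scaleC U J_in)+
  then show ?thesis by (simp add: S_def)
qed

lemma bounded_belowE:
  assumes "bounded_below z"
  obtains C where "C > 0" "\<And>x. x \<in> D \<Longrightarrow> norm x \<le> C * norm (S z x)"
proof -
  obtain C where C: "\<forall>x\<in>D. norm x \<le> C * norm (S z x)"
    using assms by (auto simp: bounded_below_def)
  have "norm x \<le> (\<bar>C\<bar> + 1) * norm (S z x)" if "x \<in> D" for x
  proof -
    have "norm x \<le> C * norm (S z x)" using C that by blast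
    also have "\<dots> \<le> (\<bar>C\<bar> + 1) * norm (S z x)" by (rule mult_right_mono) auto
    finally show ?thesis .
  qed
  with that[of "\<bar>C\<bar> + 1"] show thesis by auto
qed

lemma bounded_belowI:
  assumes "c > 0" "\<And>x. x \<in> D \<Longrightarrow> c * norm x \<le> norm (S z x)"
  shows "bounded_below z"
  unfolding bounded_below_def
  using assms by (intro exI[of _ "1 / c"]) (simp add: field_simps)

text \<open>The range of \<open>S z\<close> is closed because \<open>S z\<close> is closed (being an adjoint) and bounded below,
  and its orthogonal complement is the kernel of \<open>S (cnj z)\<close>.\<close>

lemma not_spec_if_bounded_below:
  assumes b: "bounded_below z" and b': "bounded_below (cnj z)"
  shows "z \<notin> spec"
proof -
  obtain C where C: "C > 0" "\<And>x. x \<in> D \<Longrightarrow> norm x \<le> C * norm (S z x)"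
    using bounded_belowE[OF b] by metis
  have inj: "inj_on (S z) D"
  proof (rule inj_onI)
    fix x y assume xy: "x \<in> D" "y \<in> D" "S z x = S z y"
    then have "norm (x - y) \<le> C * norm (S z (x - y))"
      by (intro C csubspace_diff D)
    then show "x = y" using xy by (simp add: S_diff)
  qed
  let ?R = "S z ` D"
  have R: "csubspace ?R"
    unfolding csubspace_def
  proof (intro conjI ballI allI)
    show "0 \<in> ?R" using S_diff[of 0 0 z] csubspace_zero[OF D(1)] by (intro image_eqI[of _ _ 0]) auto
  next
    fix x y assume "x \<in> ?R" "y \<in> ?R"
    then show "x + y \<in> ?R" using S_add csubspace_add[OF D(1)] by (smt (verit) imageE image_eqI)
  next
    fix w x assume "x \<in> ?R"
    then show "w *\<^sub>C x \<in> ?R" using S_scaleC csubspace_scaleC[OF D(1)] by (smt (verit) imageE image_eqI)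
  qed
  have "closed ?R"
    unfolding closed_sequential_limits
  proof (intro allI impI, elim conjE)
    fix y l assume y: "\<forall>n. y n \<in> ?R" and l: "y \<longlonglongrightarrow> l"
    have "\<forall>n. \<exists>x. x \<in> D \<and> y n = S z x" using y by blast
    then obtain x where x: "\<And>n. x n \<in> D" "\<And>n. y n = S z (x n)"
      by metis
    have "Cauchy x"
    proof (rule metric_CauchyI)
      fix e :: real assume "e > 0"
      then obtain N where N: "\<And>m n. m \<ge> N \<Longrightarrow> n \<ge> N \<Longrightarrow> norm (y m - y n) < e / C"
        using CauchyD[OF LIMSEQ_imp_Cauchy[OF l], of "e / C"] C(1) by auto
      have dist_x: "dist (x m) (x n) < e" if "m \<ge> N" "n \<ge> N" for m n
      proof -
        have "dist (x m) (x n) \<le> C * norm (y m - y n)"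
          unfolding dist_norm x(2) using C(2)[of "x m - x n"] csubspace_diff[OF D(1)] x(1)
          by (simp add: S_diff)
        also have "\<dots> < e" using N[OF that] C(1) by (simp add: field_simps)
        finally show ?thesis .
      qed
      then show "\<exists>M. \<forall>m\<ge>M. \<forall>n\<ge>M. dist (x m) (x n) < e"
        by (intro exI[of _ N] allI impI dist_x)
    qed
    then obtain u where u: "x \<longlonglongrightarrow> u" using Cauchy_convergent convergent_def by blast
    have uU: "u \<in> U" using closed_sequentially[OF U(2) _ u] x(1) mem_D_U by blast
    have lU: "l \<in> U" using closed_sequentially[OF U(2) _ l] x S_in by metis
    have "u \<in> D \<and> S z u = l"
    proof (rule S_sa[OF uU lU])
      fix v assume v: "v \<in> D"
      have "(\<lambda>n. cinner (S (cnj z) v) (x n)) \<longlonglongrightarrow> cinner (S (cnj z) v) u"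
        by (intro tendsto_intros u)
      moreover have "(\<lambda>n. cinner v (y n)) \<longlonglongrightarrow> cinner v l"
        by (intro tendsto_intros l)
      moreover have "cinner (S (cnj z) v) (x n) = cinner v (y n)" for n
        using S_adj[OF v x(1), of "cnj z"] x(2) by simp
      ultimately show "cinner (S (cnj z) v) u = cinner v l"
        using LIMSEQ_unique by simp
    qed
    then show "l \<in> ?R" by blast
  qed
  have "U \<subseteq> ?R"
  proof
    fix y assume y: "y \<in> U"
    obtain p where p: "p \<in> ?R" "\<And>q. q \<in> ?R \<Longrightarrow> cinner (y - p) q = 0"
      using complex_projection_theorem[OF R \<open>closed ?R\<close>] by metis
    define u where "u = y - p"
    have pU: "p \<in> U" using p(1) S_in by auto
    have uU: "u \<in> U" unfolding u_def by (intro csubspace_diff U y pU)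
    have "u \<in> D \<and> S (cnj z) u = 0"
    proof (rule S_sa[OF uU csubspace_zero[OF U(1)]])
      fix x assume "x \<in> D"
      then have "cinner u (S z x) = 0" unfolding u_def by (intro p) auto
      then show "cinner (S (cnj (cnj z)) x) u = cinner x 0" by (subst cinner_commute) simp
    qed
    moreover obtain C' where "\<And>x. x \<in> D \<Longrightarrow> norm x \<le> C' * norm (S (cnj z) x)"
      using bounded_belowE[OF b'] by metis
    ultimately have "norm u \<le> C' * norm (0::'a)" by metis
    then show "y \<in> ?R" using p(1) by (simp add: u_def)
  qed
  with inj S_in have "bij_betw (S z) D U" by (auto simp: bij_betw_def)
  with b show ?thesis by (simp add: not_spec_iff)
qed

text \<open>Surjectivity with a bounded inverse dualises: solve \<open>S z y = x\<close> and test
  \<open>S (cnj z) x\<close> against \<open>y\<close>. The same constant \<open>C\<close> serves for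
  the conjugate.\<close>

lemma not_spec_cnj:
  assumes "z \<notin> spec"
  shows "cnj z \<notin> spec"
proof -
  have b: "bounded_below z" and bij: "bij_betw (S z) D U"
    using assms by (auto simp: not_spec_iff)
  obtain C where C: "C > 0" "\<And>x. x \<in> D \<Longrightarrow> norm x \<le> C * norm (S z x)"
    using bounded_belowE[OF b] by metis
  have "norm x \<le> C * norm (S (cnj z) x)" if x: "x \<in> D" for x
  proof (cases "x = 0")
    case False
    obtain y where y: "y \<in> D" "S z y = x"
      using bij mem_D_U[OF x] by (auto simp: bij_betw_def)
    have "(norm x)\<^sup>2 = cmod (cinner (S (cnj z) x) y)"
      using S_adj[OF x y(1), of "cnj z"] y(2) by (simp add: cinner_self norm_power)
    also have "\<dots> \<le> norm (S (cnj z) x) * norm y" by (rule cinner_norm_bound)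
    also have "\<dots> \<le> norm (S (cnj z) x) * (C * norm x)"
      using C(2)[OF y(1)] y(2) by (intro mult_left_mono) auto
    finally show ?thesis using False by (simp add: power2_eq_square mult.commute mult.left_commute)
  qed (use C in auto)
  then have "bounded_below (cnj z)" unfolding bounded_below_def by blast
  with b show ?thesis by (intro not_spec_if_bounded_below) auto
qed

section \<open>The quadratic form of a pencil\<close>

lemma Im_cinner_T: "x \<in> D \<Longrightarrow> Im (cinner (T x) x) = 0"
  using T_sym[of x x] cinner_commute[of "T x" x] by (metis Reals_cnj_iff complex_is_Real_iff)

lemma Im_cinner_J: "x \<in> U \<Longrightarrow> Im (cinner (J x) x) = 0"
  using J_sym[of x x] cinner_commute[of "J x" x] by (metis Reals_cnj_iff complex_is_Real_iff)

lemma Re_cinner_J: "x \<in> U \<Longrightarrow> \<bar>Re (cinner (J x) x)\<bar> \<le> M * (norm x)\<^sup>2"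
proof -
  assume x: "x \<in> U"
  have "\<bar>Re (cinner (J x) x)\<bar> \<le> cmod (cinner (J x) x)" by (rule abs_Re_le_cmod)
  also have "\<dots> \<le> norm (J x) * norm x" by (rule cinner_norm_bound)
  also have "\<dots> \<le> M * norm x * norm x" using J_bound[OF x] by (intro mult_right_mono) auto
  finally show ?thesis by (simp add: power2_eq_square mult.assoc)
qed

text \<open>Both forms are real, so the imaginary part sees only \<open>J\<close>. Adding
  \<open>t\<close> times it moves the real parameter from \<open>Re z\<close> to
  \<open>Re z + t * Im z\<close>, which for nonreal \<open>z\<close> can be made any real
  number.\<close>

lemma S_form:
  assumes "x \<in> D"
  shows "Re (cinner (S z x) x) + t * Im (cinner (S z x) x) =
    Re (cinner (T x) x) - (Re z + t * Im z) * Re (cinner (J x) x)"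
  using Im_cinner_T[OF assms] Im_cinner_J[OF mem_D_U[OF assms]]
  by (simp add: S_def cinner_algebra algebra_simps)

lemma S_form_le:
  assumes "x \<in> D"
  shows "Re (cinner (T x) x) - (Re z + t * Im z) * Re (cinner (J x) x) \<le>
    (1 + \<bar>t\<bar>) * (norm (S z x) * norm x)"
proof -
  have 1: "Re (cinner (S z x) x) \<le> norm (S z x) * norm x"
    using complex_Re_le_cmod cinner_norm_bound order_trans by blast
  have "t * Im (cinner (S z x) x) \<le> \<bar>t\<bar> * \<bar>Im (cinner (S z x) x)\<bar>"
    by (simp add: abs_mult[symmetric])
  also have "\<dots> \<le> \<bar>t\<bar> * (norm (S z x) * norm x)"
    by (intro mult_left_mono order_trans[OF abs_Im_le_cmod cinner_norm_bound]) auto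
  finally show ?thesis using 1 unfolding S_form[OF assms, symmetric] by (simp add: algebra_simps)
qed

end

text \<open>In a Hilbert space this is the fact that a symmetric bounded \<open>A\<close> with
  \<open>|A g| < \<rho> |g|\<close> for some \<open>g\<close> has spectrum in
  \<open>(-\<rho>, \<rho>)\<close>. The bottom \<open>I\<close> of the quotients
  \<open>e (A x) (A x) / e x x\<close> plays the role of the bottom of the spectrum of the square of
  \<open>A\<close>. Almost minimisers are approximate eigenvectors of that square, and with
  \<open>r * r = I\<close> the factorisation \<open>(A - r) (A + r)\<close> yields one for
  \<open>r\<close> or for \<open>-r\<close>. All vectors stay in \<open>D\<close>, whether or not
  \<open>D\<close> is complete for \<open>e\<close>.\<close>

lemma approximate_eigenvalue:
  fixes D :: "'a::real_vector set" and e :: "'a \<Rightarrow> 'a \<Rightarrow> real" and A :: "'a \<Rightarrow> 'a"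
  assumes D: "subspace D"
    and e_sym: "\<And>x y. x \<in> D \<Longrightarrow> y \<in> D \<Longrightarrow> e x y = e y x"
    and e_add: "\<And>x y z. x \<in> D \<Longrightarrow> y \<in> D \<Longrightarrow> z \<in> D \<Longrightarrow> e (x + y) z = e x z + e y z"
    and e_scale: "\<And>r x y. x \<in> D \<Longrightarrow> y \<in> D \<Longrightarrow> e (r *\<^sub>R x) y = r * e x y"
    and e_nonneg: "\<And>x. x \<in> D \<Longrightarrow> 0 \<le> e x x"
    and A_in: "\<And>x. x \<in> D \<Longrightarrow> A x \<in> D"
    and A_add: "\<And>x y. x \<in> D \<Longrightarrow> y \<in> D \<Longrightarrow> A (x + y) = A x + A y"
    and A_scale: "\<And>r x. x \<in> D \<Longrightarrow> A (r *\<^sub>R x) = r *\<^sub>R A x"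
    and A_sym: "\<And>x y. x \<in> D \<Longrightarrow> y \<in> D \<Longrightarrow> e (A x) y = e x (A y)"
    and A_bound: "\<And>x. x \<in> D \<Longrightarrow> e (A x) (A x) \<le> K * e x x" and K: "K > 0"
    and g: "g \<in> D" "e (A g) (A g) < \<rho>\<^sup>2 * e g g" and \<rho>: "\<rho> > 0"
  obtains s where "\<bar>s\<bar> < \<rho>"
    "\<And>\<delta>. \<delta> > 0 \<Longrightarrow> \<exists>h\<in>D. e (A h - s *\<^sub>R h) (A h - s *\<^sub>R h) < \<delta> * e h h"
proof -
  note sub = subspace_add[OF D] subspace_mul[OF D] subspace_diff[OF D]
  have e_addr: "e z (x + y) = e z x + e z y" if "x \<in> D" "y \<in> D" "z \<in> D" for x y z
    using that by (simp add: e_sym[of z] e_add sub)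
  have e_scaler: "e y (r *\<^sub>R x) = r * e y x" if "x \<in> D" "y \<in> D" for r x y
    using that by (simp add: e_sym[of y] e_scale sub)
  have minus: "x - r *\<^sub>R y = x + (- r) *\<^sub>R y" for x y :: 'a and r by simp
  note e_simps = e_add e_addr e_scale e_scaler sub A_in
  define Q where "Q = {e (A g) (A g) / e g g | g. g \<in> D \<and> e g g > 0}"
  define I where "I = Inf Q"
  have pos: "e g g > 0"
    using g e_nonneg[OF A_in[OF g(1)]] \<rho> by (metis (no_types) less_le_trans order.strict_trans1 zero_less_mult_pos zero_less_power)
  have Q0: "0 \<le> q" if "q \<in> Q" for q
    using that e_nonneg A_in by (auto simp: Q_def)
  have Qne: "Q \<noteq> {}" "bdd_below Q"
    using g(1) pos Q0 by (auto simp: Q_def intro!: bdd_belowI[of _ 0])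
  have I0: "0 \<le> I" unfolding I_def by (intro cInf_greatest Qne Q0)
  have "I \<le> e (A g) (A g) / e g g"
    unfolding I_def using g(1) pos by (intro cInf_lower Qne) (auto simp: Q_def)
  also have "\<dots> < \<rho>\<^sup>2" using g(2) pos by (simp add: field_simps)
  finally have "I < \<rho>\<^sup>2" .
  define r where "r = sqrt I"
  have r: "r * r = I" "0 \<le> r" "r < \<rho>"
    using I0 \<open>I < \<rho>\<^sup>2\<close> \<rho> by (auto simp: r_def real_less_lsqrt)
  \<comment> \<open>The form of the square of \<open>A\<close> minus \<open>I\<close>; it is
    nonnegative because \<open>I\<close> is the infimum of the quotients.\<close>
  define b where "b x y = e (A x) (A y) - I * e x y" for x y
  have b_nonneg: "0 \<le> b x x" if x: "x \<in> D" for x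
  proof (cases "e x x > 0")
    case True
    then have "I \<le> e (A x) (A x) / e x x"
      unfolding I_def using x by (intro cInf_lower Qne) (auto simp: Q_def)
    then show ?thesis using True by (simp add: b_def field_simps)
  next
    case False
    then show ?thesis using e_nonneg[OF x] e_nonneg[OF A_in[OF x]] by (simp add: b_def)
  qed
  define B where "B x = A (A x) - I *\<^sub>R x" for x
  have B_in: "B x \<in> D" if "x \<in> D" for x using that by (simp add: B_def sub A_in)
  \<comment> \<open>Positivity of \<open>b\<close> at \<open>x - (1/K) B x\<close>, together with
    \<open>b x (B x) = e (B x) (B x)\<close> and the upper bound \<open>K\<close> for
    \<open>b\<close>. This turns smallness of \<open>b x x\<close> into smallness of
    \<open>B x\<close>.\<close>
  have B_le: "e (B x) (B x) \<le> K * b x x" if x: "x \<in> D" for x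
  proof -
    let ?t = "1 / K"
    have bB: "b x (B x) = e (B x) (B x)"
    proof -
      have "e (A x) (A (B x)) = e (A (A x)) (B x)"
        using x by (simp add: A_sym A_in B_in)
      then show ?thesis
        using x B_in[OF x] unfolding b_def
        by (subst (3) B_def) (simp add: minus e_simps del: scaleR_minus_left add_uminus_conv_diff)
    qed
    have "0 \<le> b (x + (- ?t) *\<^sub>R B x) (x + (- ?t) *\<^sub>R B x)"
      using x by (intro b_nonneg sub B_in)
    also have "\<dots> = b x x - 2 * ?t * b x (B x) + ?t\<^sup>2 * b (B x) (B x)"
      using x B_in[OF x] unfolding b_def
      by (simp add: A_add A_scale e_simps e_sym[of "B x" x] e_sym[of "A (B x)" "A x"]
          power2_eq_square algebra_simps del: scaleR_minus_left)
    also have "\<dots> \<le> b x x - 2 * ?t * e (B x) (B x) + ?t\<^sup>2 * (K * e (B x) (B x))"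
    proof -
      have "b (B x) (B x) \<le> K * e (B x) (B x)"
        using A_bound[OF B_in[OF x]] I0 e_nonneg[OF B_in[OF x]]
        by (simp add: b_def) (smt (verit) mult_nonneg_nonneg)
      then show ?thesis unfolding bB by (simp add: mult_left_mono divide_right_mono)
    qed
    also have "\<dots> = b x x - e (B x) (B x) / K"
      using K by (simp add: power2_eq_square field_simps)
    finally show ?thesis using K by (simp add: field_simps)
  qed
  define P where "P s \<delta> \<longleftrightarrow> (\<exists>h\<in>D. e (A h - s *\<^sub>R h) (A h - s *\<^sub>R h) < \<delta> * e h h)" for s \<delta>
  have P_mono: "P s \<delta>'" if P: "P s \<delta>" and le: "\<delta> \<le> \<delta>'" for s \<delta> \<delta>'
  proof -
    obtain h where h: "h \<in> D" "e (A h - s *\<^sub>R h) (A h - s *\<^sub>R h) < \<delta> * e h h"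
      using P unfolding P_def by blast
    note h(2)
    also have "\<delta> * e h h \<le> \<delta>' * e h h"
      using le e_nonneg[OF h(1)] by (rule mult_right_mono)
    finally show ?thesis using h(1) by (auto simp: P_def)
  qed
  have P_cases: "P r \<delta> \<or> P (- r) \<delta>" if \<delta>: "\<delta> > 0" for \<delta>
  proof -
    have "Inf Q < I + \<delta>\<^sup>2 / K" using \<delta> K by (simp add: I_def)
    then obtain q where "q \<in> Q" "q < I + \<delta>\<^sup>2 / K" using cInf_less_iff[OF Qne] by auto
    then obtain x where x: "x \<in> D" "e x x > 0" "e (A x) (A x) / e x x < I + \<delta>\<^sup>2 / K"
      by (auto simp: Q_def)
    have "e (A x) (A x) < (I + \<delta>\<^sup>2 / K) * e x x"
      using x(2,3) by (simp add: pos_divide_less_eq)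
    then have "b x x < \<delta>\<^sup>2 / K * e x x" by (simp add: b_def algebra_simps)
    then have Bx: "e (B x) (B x) < \<delta>\<^sup>2 * e x x"
      using B_le[OF x(1)] K by (simp add: field_simps)
    \<comment> \<open>\<open>B x\<close> equals \<open>(A - r) h\<close>. If \<open>h\<close> is
      small, then \<open>x\<close> is almost an eigenvector for \<open>-r\<close>; otherwise
      \<open>h\<close> is almost one for \<open>r\<close>. The tolerance
      \<open>\<delta>\<^sup>2 / K\<close> was chosen so that both cases end with
      \<open>\<delta>\<close>.\<close>
    define h where "h = A x + r *\<^sub>R x"
    have hD: "h \<in> D" using x(1) by (simp add: h_def sub A_in)
    show ?thesis
    proof (cases "e h h < \<delta> * e x x")
      case True
      then have "P (- r) \<delta>" using x(1) by (auto simp: P_def h_def intro!: bexI[of _ x])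
      then show ?thesis ..
    next
      case False
      have "A h - r *\<^sub>R h = B x"
        using x(1) by (simp add: h_def B_def A_add A_scale A_in sub scaleR_add_right r(1))
      moreover have "\<delta>\<^sup>2 * e x x \<le> \<delta> * e h h"
        using False \<delta> by (simp add: power2_eq_square mult.assoc)
      ultimately have "P r \<delta>" using Bx hD unfolding P_def by (intro bexI[of _ h]) auto
      then show ?thesis ..
    qed
  qed
  \<comment> \<open>So far the sign may depend on \<open>\<delta>\<close>; as the property is
    monotone in \<open>\<delta>\<close>, one sign works for all.\<close>
  have "(\<forall>\<delta>>0. P r \<delta>) \<or> (\<forall>\<delta>>0. P (- r) \<delta>)"
  proof (rule ccontr)
    assume "\<not> ?thesis"
    then obtain \<delta> \<delta>' where "\<delta> > 0" "\<not> P r \<delta>" "\<delta>' > 0" "\<not> P (- r) \<delta>'" by auto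
    then show False
      using P_cases[of "min \<delta> \<delta>'"] P_mono[of r "min \<delta> \<delta>'" \<delta>] P_mono[of "-r" "min \<delta> \<delta>'" \<delta>'] by auto
  qed
  then show thesis using that[of r] that[of "- r"] r by (auto simp: P_def)
qed

section \<open>Lower bounds from spectral gaps\<close>

context selfadjoint_pencil
begin

text \<open>In the energy inner product \<open>\<langle>T x, y\<rangle>\<close> the operator \<open>T\<inverse> J - 1/l\<close> is symmetric. If it were not
  bounded below by \<open>\<rho>\<close>, then \<open>T\<inverse> J\<close> would have an approximate eigenvalue in \<open>(1/l - \<rho>, 1/l + \<rho>)\<close>.\<close>

lemma bounded_below_if_spectral_gap:
  assumes c: "c > 0" "\<And>x. x \<in> D \<Longrightarrow> c * (norm x)\<^sup>2 \<le> Re (cinner (T x) x)"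
    and l: "l \<noteq> 0"
    and gap: "\<And>z. z \<in> spec \<Longrightarrow> \<epsilon> \<le> cmod (z - complex_of_real l)"
    and \<rho>: "\<rho> > 0" "\<And>s. \<bar>s\<bar> < \<rho> \<Longrightarrow> 1 / l + s \<noteq> 0 \<and> \<bar>1 / (1 / l + s) - l\<bar> < \<epsilon>"
    and x: "x \<in> D"
  shows "\<rho> * c * \<bar>l\<bar> * norm x \<le> norm (S (complex_of_real l) x)"
proof (rule ccontr)
  assume "\<not> ?thesis"
  then have x_less: "norm (S (complex_of_real l) x) < \<rho> * c * \<bar>l\<bar> * norm x" by simp
  define e where "e x y = Re (cinner (T x) y)" for x y
  define \<mu> where "\<mu> = 1 / l"
  have T_below: "c * norm x \<le> norm (T x)" if "x \<in> D" for x
  proof (cases "x = 0")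
    case False
    have "c * (norm x)\<^sup>2 \<le> norm (T x) * norm x"
      using c(2)[OF that] complex_Re_le_cmod cinner_norm_bound order_trans by meson
    then show ?thesis using False by (simp add: power2_eq_square mult.assoc[symmetric])
  qed simp
  have S0: "S 0 = T" by (simp add: S_def fun_eq_iff)
  have "bounded_below 0"
    using c(1) T_below by (intro bounded_belowI[of c]) (auto simp: S0)
  then have bij: "bij_betw T D U"
    using not_spec_if_bounded_below[of 0] by (simp add: not_spec_iff S0)
  \<comment> \<open>The inverse of \<open>T\<close>; it exists because a lower bound for
    \<open>T\<close> puts 0 outside the spectrum.\<close>
  define R where "R = inv_into D T"
  have R_in: "R y \<in> D" and TR: "T (R y) = y" if "y \<in> U" for y
    using that bij by (auto simp: R_def bij_betw_def inv_into_into f_inv_into_f)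
  have RT: "R (T x) = x" if "x \<in> D" for x
    using that bij by (simp add: R_def bij_betw_def)
  have T_inj: "x = y" if "x \<in> D" "y \<in> D" "T x = T y" for x y
    using that RT by metis
  have eR: "e (R y) (R y) \<le> (norm y)\<^sup>2 / c" if y: "y \<in> U" for y
  proof -
    have "e (R y) (R y) \<le> norm y * norm (R y)"
      unfolding e_def TR[OF y] using complex_Re_le_cmod cinner_norm_bound order_trans by meson
    also have "\<dots> \<le> norm y * (norm y / c)"
      using T_below[OF R_in[OF y]] c(1)
      by (intro mult_left_mono) (auto simp: TR[OF y] field_simps)
    finally show ?thesis by (simp add: power2_eq_square)
  qed
  note sub = csubspace_add[OF D(1)] csubspace_diff[OF D(1)] csubspace_scaleR[OF D(1)]
    csubspace_scaleC[OF D(1)]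
  have T_scaleR: "T (r *\<^sub>R x) = r *\<^sub>R T x" if "x \<in> D" for x r
    using T_scaleC[OF that] by (simp add: scaleR_conv_scaleC)
  have J_scaleR: "J (r *\<^sub>R x) = r *\<^sub>R J x" if "x \<in> U" for x r
    using J_scaleC[OF that] by (simp add: scaleR_conv_scaleC)
  have e_sym: "e x y = e y x" if "x \<in> D" "y \<in> D" for x y
  proof -
    have "e x y = Re (cinner x (T y))" using that by (simp add: e_def T_sym)
    also have "\<dots> = e y x" by (subst cinner_commute) (simp add: e_def)
    finally show ?thesis .
  qed
  have e_add: "e (x + y) z = e x z + e y z" if "x \<in> D" "y \<in> D" for x y z
    using that by (simp add: e_def T_add cinner_algebra)
  have e_scale: "e (r *\<^sub>R x) y = r * e x y" if "x \<in> D" for r x y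
    using that by (simp add: e_def T_scaleR cinner_scaleR_left)
  have e_pos: "c * (norm x)\<^sup>2 \<le> e x x" if "x \<in> D" for x using c(2)[OF that] by (simp add: e_def)
  have e_nonneg: "0 \<le> e x x" if "x \<in> D" for x
    using e_pos[OF that] c(1) by (smt (verit) mult_nonneg_nonneg zero_le_power2)
  have e_addr: "e z (x + y) = e z x + e z y" for x y z
    by (simp add: e_def cinner_algebra)
  have e_scaler: "e y (r *\<^sub>R x) = r * e y x" for r x y
    by (simp add: e_def cinner_scaleR_right)
  have e_square: "e (x + r *\<^sub>R y) (x + r *\<^sub>R y) = e x x + 2 * r * e y x + r\<^sup>2 * e y y"
    if "x \<in> D" "y \<in> D" for x y r
    using that by (simp add: e_add e_scale e_addr e_scaler sub e_sym[of x y] power2_eq_square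
        algebra_simps)
  define A where "A x = R (J x) - \<mu> *\<^sub>R x" for x
  have A_in: "A x \<in> D" if "x \<in> D" for x
    unfolding A_def using that by (intro sub R_in J_in mem_D_U)
  have TA: "T (A x) = J x - \<mu> *\<^sub>R T x" if "x \<in> D" for x
    unfolding A_def using that
    by (simp add: T_diff sub R_in J_in mem_D_U TR T_scaleR)
  have A_sym: "e (A x) y = e x (A y)" if "x \<in> D" "y \<in> D" for x y
  proof -
    have "e (A x) y = Re (cinner (J x) y) - \<mu> * e x y"
      using that by (simp add: e_def TA cinner_diff_left cinner_scaleR_left)
    also have "\<dots> = Re (cinner (J y) x) - \<mu> * e y x"
    proof -
      have "Re (cinner (J x) y) = Re (cinner x (J y))" using that by (simp add: J_sym mem_D_U)
      also have "\<dots> = Re (cinner (J y) x)" by (subst cinner_commute) simp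
      finally show ?thesis using e_sym[OF that] by simp
    qed
    also have "\<dots> = e (A y) x"
      using that by (simp add: e_def TA cinner_diff_left cinner_scaleR_left)
    also have "\<dots> = e x (A y)" using that A_in by (simp add: e_sym)
    finally show ?thesis .
  qed
  \<comment> \<open>The energy of \<open>R (J x) - \<mu> x\<close> is at most twice the sum of the
    energies of its two parts, and \<open>R J\<close> contributes
    \<open>M\<^sup>2 / c\<^sup>2\<close>. The summand 1 makes \<open>K\<close> positive.\<close>
  define K where "K = 2 * M\<^sup>2 / c\<^sup>2 + 2 * \<mu>\<^sup>2 + 1"
  have A_bound: "e (A x) (A x) \<le> K * e x x" if x: "x \<in> D" for x
  proof -
    let ?y = "R (J x)"
    have yD: "?y \<in> D" using x by (intro R_in J_in mem_D_U)
    have "0 \<le> e ?y ?y + 2 * \<mu> * e x ?y + \<mu>\<^sup>2 * e x x"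
      using e_nonneg[of "?y + \<mu> *\<^sub>R x"] e_square[OF yD x, of \<mu>] sub x yD by simp
    moreover have "e (A x) (A x) = e ?y ?y - 2 * \<mu> * e x ?y + \<mu>\<^sup>2 * e x x"
      using e_square[OF yD x, of "- \<mu>"] by (simp add: A_def)
    moreover have "e ?y ?y \<le> M\<^sup>2 / c\<^sup>2 * e x x"
    proof -
      have "e ?y ?y \<le> (norm (J x))\<^sup>2 / c" using x by (intro eR J_in mem_D_U)
      also have "\<dots> \<le> (M * norm x)\<^sup>2 / c"
        using J_bound[OF mem_D_U[OF x]] c(1) by (intro divide_right_mono power_mono) auto
      also have "\<dots> = M\<^sup>2 / c\<^sup>2 * (c * (norm x)\<^sup>2)"
        using c(1) by (simp add: power2_eq_square field_simps)
      also have "\<dots> \<le> M\<^sup>2 / c\<^sup>2 * e x x" using e_pos[OF x] by (intro mult_left_mono) auto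
      finally show ?thesis .
    qed
    moreover have "K * e x x = 2 * (M\<^sup>2 / c\<^sup>2 * e x x) + 2 * (\<mu>\<^sup>2 * e x x) + e x x"
      by (simp add: K_def algebra_simps)
    ultimately show ?thesis using e_nonneg[OF x] by linarith
  qed
  have less: "e (A x) (A x) < \<rho>\<^sup>2 * e x x"
  proof -
    let ?y = "S (complex_of_real l) x"
    have yU: "?y \<in> U" using x by (rule S_in)
    \<comment> \<open>Since \<open>l * \<mu> = 1\<close>, one has
      \<open>J - \<mu> T = - \<mu> (T - l J)\<close>. Thus a small residual \<open>S l x\<close>
      means that \<open>A x\<close> is small in energy, and the constant in the claim is the one
      that gives exactly \<open>\<rho>\<close>.\<close>
    have "A x = (- \<mu>) *\<^sub>R R ?y"
    proof (rule T_inj)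
      have "l * \<mu> = 1" using l by (simp add: \<mu>_def)
      then have "J x - \<mu> *\<^sub>R T x = (- \<mu>) *\<^sub>R ?y"
        by (simp add: S_def scaleC_of_real scaleR_diff_right mult.commute)
      then show "T (A x) = T ((- \<mu>) *\<^sub>R R ?y)"
        by (simp only: TA[OF x] T_scaleR[OF R_in[OF yU]] TR[OF yU])
    qed (intro A_in sub R_in x yU)+
    then have "e (A x) (A x) = \<mu>\<^sup>2 * e (R ?y) (R ?y)"
      using R_in[OF yU] by (simp add: e_scale e_scaler power2_eq_square sub del: scaleR_minus_left)
    also have "\<dots> \<le> \<mu>\<^sup>2 * ((norm ?y)\<^sup>2 / c)" by (intro mult_left_mono eR yU) auto
    also have "\<dots> < \<mu>\<^sup>2 * ((\<rho> * c * \<bar>l\<bar> * norm x)\<^sup>2 / c)"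
      using x_less c(1) l
      by (intro mult_strict_left_mono divide_strict_right_mono power_strict_mono) (auto simp: \<mu>_def)
    also have "\<dots> = \<rho>\<^sup>2 * (c * (norm x)\<^sup>2)"
      using l c(1) by (simp add: \<mu>_def power2_eq_square field_simps)
    also have "\<dots> \<le> \<rho>\<^sup>2 * e x x" by (intro mult_left_mono e_pos x) auto
    finally show ?thesis .
  qed
  have K: "K > 0" by (auto simp: K_def intro!: add_nonneg_pos add_nonneg_nonneg)
  have A_add: "A (x + y) = A x + A y" if "x \<in> D" "y \<in> D" for x y
  proof (rule T_inj)
    show "T (A (x + y)) = T (A x + A y)"
      using that by (simp add: T_add A_in TA sub J_add mem_D_U scaleR_add_right)
  qed (intro sub A_in that)+
  have A_scale: "A (r *\<^sub>R x) = r *\<^sub>R A x" if "x \<in> D" for r x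
  proof (rule T_inj)
    show "T (A (r *\<^sub>R x)) = T (r *\<^sub>R A x)"
      using that by (simp add: T_scaleR A_in TA sub J_scaleR mem_D_U scaleR_diff_right mult.commute)
  qed (intro sub A_in that)+
  have "\<exists>s. \<bar>s\<bar> < \<rho> \<and> (\<forall>\<delta>>0. \<exists>h\<in>D. e (A h - s *\<^sub>R h) (A h - s *\<^sub>R h) < \<delta> * e h h)"
    by (rule approximate_eigenvalue[of D e A K x \<rho>])
      ((rule e_sym e_add e_scale e_nonneg A_in A_add A_scale A_sym A_bound K less x \<rho>(1)
        csubspace_imp_subspace[OF D(1)]; assumption) | blast)+
  then obtain s where s: "\<bar>s\<bar> < \<rho>"
    "\<And>\<delta>. \<delta> > 0 \<Longrightarrow> \<exists>h\<in>D. e (A h - s *\<^sub>R h) (A h - s *\<^sub>R h) < \<delta> * e h h"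
    by blast
  \<comment> \<open>\<open>\<nu>\<close> is the approximate eigenvalue of \<open>R J\<close>. Its
    reciprocal \<open>l'\<close> lies in the gap, so \<open>S l'\<close> is bounded below, and the
    rest shows that this excludes approximate eigenvectors.\<close>
  define \<nu> where "\<nu> = \<mu> + s"
  define l' where "l' = 1 / \<nu>"
  have \<nu>: "\<nu> \<noteq> 0" "l' * \<nu> = 1" and "\<bar>l' - l\<bar> < \<epsilon>"
    using \<rho>(2)[OF s(1)] by (auto simp: \<nu>_def l'_def \<mu>_def)
  then have "cmod (complex_of_real l' - complex_of_real l) < \<epsilon>"
    by (simp flip: of_real_diff)
  then have "bounded_below (complex_of_real l')"
    using gap not_spec_iff by (meson not_le)
  then obtain C where C: "C > 0" "\<And>x. x \<in> D \<Longrightarrow> norm x \<le> C * norm (S (complex_of_real l') x)"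
    using bounded_belowE by metis
  \<comment> \<open>With \<open>w = A h - s h\<close> the equation
    \<open>S l' (h + l' w) = - l'\<^sup>2 J w\<close> holds, so \<open>S l'\<close> being bounded
    below by \<open>1/C\<close> gives \<open>norm h \<le> C1 * norm w\<close>.\<close>
  define C1 where "C1 = \<bar>l'\<bar> + C * (l'\<^sup>2 * \<bar>M\<bar>)"
  define K' where "K' = 2 * \<bar>l'\<bar> * \<bar>M\<bar> * (C1\<^sup>2 / c) + l'\<^sup>2 + 1"
  have C1: "C1 \<ge> 0" using C(1) by (auto simp: C1_def)
  have K': "K' > 0" using c(1) by (auto simp: K'_def intro!: add_nonneg_pos add_nonneg_nonneg)
  have bound: "e h h \<le> K' * e (A h - s *\<^sub>R h) (A h - s *\<^sub>R h)" if h: "h \<in> D" for h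
  proof -
    define w where "w = A h - s *\<^sub>R h"
    have wD: "w \<in> D" unfolding w_def using h by (intro sub A_in)
    have Tw: "T w = J h - \<nu> *\<^sub>R T h"
      using h by (simp add: w_def T_diff A_in sub TA T_scaleR \<nu>_def scaleR_add_left)
    have Th: "T h = l' *\<^sub>R (J h - T w)"
      using \<nu>(2) by (simp add: Tw)
    have "S (complex_of_real l') (h + l' *\<^sub>R w) = - (l'\<^sup>2 *\<^sub>R J w)"
    proof -
      have "S (complex_of_real l') (h + l' *\<^sub>R w) =
          T h + l' *\<^sub>R T w - l' *\<^sub>R J h - (l' * l') *\<^sub>R J w"
        using h wD by (simp add: S_def T_add T_scaleR J_add J_scaleR mem_D_U sub scaleC_of_real
            scaleR_add_right)
      then show ?thesis by (simp add: Th scaleR_diff_right power2_eq_square)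
    qed
    then have "norm (h + l' *\<^sub>R w) \<le> C * (l'\<^sup>2 * norm (J w))"
      using C(2)[of "h + l' *\<^sub>R w"] h wD sub by simp
    also have "\<dots> \<le> C * (l'\<^sup>2 * (\<bar>M\<bar> * norm w))"
      using order_trans[OF J_bound[OF mem_D_U[OF wD]] mult_right_mono[of M "\<bar>M\<bar>" "norm w"]] C(1)
      by (intro mult_left_mono) auto
    finally have "norm h \<le> C1 * norm w"
      using norm_triangle_ineq4[of "h + l' *\<^sub>R w" "l' *\<^sub>R w"]
      by (simp add: C1_def algebra_simps)
    then have "(norm h)\<^sup>2 \<le> (C1 * norm w)\<^sup>2" by (intro power_mono) auto
    also have "\<dots> = C1\<^sup>2 / c * (c * (norm w)\<^sup>2)" using c(1) by (simp add: power2_eq_square)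
    also have "\<dots> \<le> C1\<^sup>2 / c * e w w"
      using e_pos[OF wD] c(1) by (intro mult_left_mono) auto
    finally have h_le: "(norm h)\<^sup>2 \<le> C1\<^sup>2 / c * e w w" .
    \<comment> \<open>The norm estimate is upgraded to the energy: the mixed term
      \<open>e w h\<close> is absorbed by the nonnegative energy of \<open>h + l' w\<close>, which
      leaves the \<open>J\<close> form and hence the norm of \<open>h\<close>.\<close>
    have "e h h = l' * (Re (cinner (J h) h) - e w h)"
      unfolding e_def by (subst Th) (simp add: cinner_diff_left cinner_scaleR_left)
    moreover have "0 \<le> e h h + 2 * l' * e w h + l'\<^sup>2 * e w w"
      using e_nonneg[of "h + l' *\<^sub>R w"] e_square[OF h wD, of l'] sub h wD by simp
    ultimately have "e h h \<le> 2 * (l' * Re (cinner (J h) h)) + l'\<^sup>2 * e w w"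
      by (simp add: algebra_simps)
    moreover have "l' * Re (cinner (J h) h) \<le> \<bar>l'\<bar> * (\<bar>M\<bar> * (C1\<^sup>2 / c * e w w))"
    proof -
      have "\<bar>Re (cinner (J h) h)\<bar> \<le> \<bar>M\<bar> * (norm h)\<^sup>2"
        using Re_cinner_J[OF mem_D_U[OF h]] by (rule order_trans) (simp add: mult_right_mono)
      also have "\<dots> \<le> \<bar>M\<bar> * (C1\<^sup>2 / c * e w w)" by (intro mult_left_mono h_le) auto
      finally have "\<bar>l' * Re (cinner (J h) h)\<bar> \<le> \<bar>l'\<bar> * (\<bar>M\<bar> * (C1\<^sup>2 / c * e w w))"
        unfolding abs_mult by (intro mult_left_mono) auto
      then show ?thesis by simp
    qed
    moreover have "K' * e w w = 2 * (\<bar>l'\<bar> * (\<bar>M\<bar> * (C1\<^sup>2 / c * e w w))) + l'\<^sup>2 * e w w + e w w"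
      by (simp add: K'_def algebra_simps)
    ultimately show ?thesis
      using e_nonneg[OF wD] unfolding w_def[symmetric] by linarith
  qed
  obtain h where h: "h \<in> D" "e (A h - s *\<^sub>R h) (A h - s *\<^sub>R h) < 1 / K' * e h h"
    using s(2)[of "1 / K'"] K' by auto
  then show False using bound[OF h(1)] K' by (simp add: field_simps)
qed

end

section \<open>Approximation of pencils\<close>

text \<open>An almost nearest point of each approximating spectrum serves all
  \<open>\<epsilon>\<close> at once. The slack \<open>1 / (n + 1)\<close> covers the case that the
  distance is not attained.\<close>

lemma spectrally_exactI:
  assumes free: "free_of_spectral_pollution \<Sigma> \<Sigma>n"
    and near: "\<And>z \<epsilon>. z \<in> \<Sigma> \<Longrightarrow> \<epsilon> > 0 \<Longrightarrow> \<forall>\<^sub>F n in sequentially. \<exists>w\<in>\<Sigma>n n. cmod (w - z) < \<epsilon>"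
  shows "spectrally_exact \<Sigma> \<Sigma>n"
  unfolding spectrally_exact_def
proof (intro conjI free ballI)
  fix z assume z: "z \<in> \<Sigma>"
  define d where "d n = infdist z (\<Sigma>n n)" for n
  have "\<exists>w. \<Sigma>n n \<noteq> {} \<longrightarrow> w \<in> \<Sigma>n n \<and> dist z w < d n + inverse (real (Suc n))" for n
  proof (cases "\<Sigma>n n = {}")
    case False
    have "(INF w\<in>\<Sigma>n n. dist z w) < d n + inverse (real (Suc n))"
      using False by (simp add: d_def infdist_notempty)
    then show ?thesis using False by (subst (asm) cINF_less_iff) (auto intro!: bdd_belowI2[of _ 0])
  qed simp
  then obtain l where l: "\<And>n. \<Sigma>n n \<noteq> {} \<Longrightarrow> l n \<in> \<Sigma>n n \<and> dist z (l n) < d n + inverse (real (Suc n))"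
    by metis
  have "\<forall>\<^sub>F n in sequentially. l n \<in> \<Sigma>n n"
    using near[OF z zero_less_one] by eventually_elim (use l in auto)
  moreover have "l \<longlonglongrightarrow> z"
  proof (rule tendstoI)
    fix e :: real assume "e > 0"
    then have "\<forall>\<^sub>F n in sequentially. \<exists>w\<in>\<Sigma>n n. cmod (w - z) < e / 2"
      by (intro near z) auto
    moreover have "\<forall>\<^sub>F n in sequentially. inverse (real (Suc n)) < e / 2"
      using \<open>e > 0\<close> by (intro order_tendstoD(2)[OF LIMSEQ_inverse_real_of_nat]) auto
    ultimately show "\<forall>\<^sub>F n in sequentially. dist (l n) z < e"
    proof eventually_elim
      case (elim n)
      then obtain w where w: "w \<in> \<Sigma>n n" "cmod (w - z) < e / 2" by auto
      have "d n \<le> dist z w" unfolding d_def by (rule infdist_le[OF w(1)])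
      then show ?case
        using w(2) l[of n] w(1) elim(2) unfolding dist_norm norm_minus_commute[of z]
        by (metis (no_types, opaque_lifting) add_strict_mono empty_iff field_sum_of_halves
            le_less_trans less_trans add_le_less_mono)
    qed
  qed
  ultimately show "\<exists>l. (\<forall>\<^sub>F n in sequentially. l n \<in> \<Sigma>n n) \<and> l \<longlonglongrightarrow> z" by blast
qed

text \<open>What the Galerkin and the Dirichlet approximation have in common. Index 0 is left out
  because the interval \<open>(-n, n)\<close> is empty there. In \<open>coercive\<close> the data
  \<open>t\<close>, \<open>c\<close>, \<open>C\<close>, \<open>\<Phi>\<close> depend on
  \<open>z\<close> but not on \<open>n\<close>, and the bound \<open>c\<close> in
  \<open>positive\<close> is likewise uniform.\<close>

locale pencil_approximation =
  lim: selfadjoint_pencil UNIV D T J M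
  for D :: "'a::complex_hilbert set" and T J M +
  fixes Hn Dn :: "nat \<Rightarrow> 'a set" and Tn Jn :: "nat \<Rightarrow> 'a \<Rightarrow> 'a"
  assumes app: "\<And>n. n > 0 \<Longrightarrow> selfadjoint_pencil (Hn n) (Dn n) (Tn n) (Jn n) M"
    and consistent: "\<And>f. f \<in> D \<Longrightarrow> \<exists>F. (\<forall>n>0. F n \<in> Dn n) \<and> F \<longlonglongrightarrow> f \<and>
      (\<lambda>n. Tn n (F n)) \<longlonglongrightarrow> T f \<and> (\<lambda>n. Jn n (F n)) \<longlonglongrightarrow> J f"
    and coercive: "\<And>z. z \<notin> lim.spec \<Longrightarrow> \<exists>t c C \<Phi>. c > 0 \<and> finite \<Phi> \<and>
      (\<forall>n>0. \<forall>x\<in>Dn n. c * (norm x)\<^sup>2 \<le> Re (cinner (Tn n x) x) -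
         (Re z + t * Im z) * Re (cinner (Jn n x) x) + C * (\<Sum>\<phi>\<in>\<Phi>. (cmod (cinner x \<phi>))\<^sup>2))"
    and positive: "uniformly_positive D T \<Longrightarrow>
      \<exists>c>0. \<forall>n>0. \<forall>x\<in>Dn n. c * (norm x)\<^sup>2 \<le> Re (cinner (Tn n x) x)"
begin

abbreviation "Sn n z x \<equiv> Tn n x - z *\<^sub>C Jn n x"

text \<open>Along a sequence of normalized almost-kernel elements \<open>x k\<close>, surjectivity of \<open>T - cnj z J\<close>
  forces \<open>\<langle>x k, \<phi>\<rangle> \<rightarrow> 0\<close> for all \<open>\<phi>\<close>, which contradicts coercivity up to finite rank.\<close>

lemma stability:
  assumes z: "z \<notin> lim.spec"
  shows "\<exists>c>0. \<exists>N>0. \<forall>n\<ge>N. \<forall>\<zeta>. cmod (\<zeta> - z) < c \<longrightarrow>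
    (\<forall>x\<in>Dn n. c * norm x \<le> norm (Sn n \<zeta> x))"
proof (rule ccontr)
  assume neg: "\<not> ?thesis"
  have "\<exists>n \<zeta> x. n \<ge> Suc k \<and> cmod (\<zeta> - z) < 1 / real (Suc k) \<and> x \<in> Dn n \<and> norm x = 1 \<and>
      norm (Sn n \<zeta> x) < 1 / real (Suc k)" for k
  proof -
    have "\<not> (\<forall>n\<ge>Suc k. \<forall>\<zeta>. cmod (\<zeta> - z) < 1 / real (Suc k) \<longrightarrow>
        (\<forall>x\<in>Dn n. 1 / real (Suc k) * norm x \<le> norm (Sn n \<zeta> x)))"
    proof
      assume *: "\<forall>n\<ge>Suc k. \<forall>\<zeta>. cmod (\<zeta> - z) < 1 / real (Suc k) \<longrightarrow>
        (\<forall>x\<in>Dn n. 1 / real (Suc k) * norm x \<le> norm (Sn n \<zeta> x))"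
      have "1 / real (Suc k) > 0" "Suc k > 0" by simp_all
      with * neg show False by blast
    qed
    then obtain n \<zeta> x where x: "n \<ge> Suc k" "cmod (\<zeta> - z) < 1 / real (Suc k)" "x \<in> Dn n"
        "norm (Sn n \<zeta> x) < 1 / real (Suc k) * norm x"
      by (auto simp: not_le)
    then interpret P: selfadjoint_pencil "Hn n" "Dn n" "Tn n" "Jn n" M by (intro app) auto
    have nx: "norm x > 0" using x(4) by (auto intro: ccontr)
    define w where "w = complex_of_real (1 / norm x)"
    have w: "cmod w * norm x = 1" "cmod w = 1 / norm x"
      using nx by (simp_all add: w_def del: of_real_divide)
    have "Sn n \<zeta> (w *\<^sub>C x) = w *\<^sub>C Sn n \<zeta> x" using P.S_scaleC[OF x(3)] by (simp add: P.S_def)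
    then have "norm (Sn n \<zeta> (w *\<^sub>C x)) < 1 / real (Suc k)"
      using x(4) nx by (simp only: norm_scaleC w) (simp add: divide_simps mult.commute)
    moreover have "w *\<^sub>C x \<in> Dn n" using x(3) by (intro csubspace_scaleC P.D)
    moreover have "norm (w *\<^sub>C x) = 1" by (simp only: norm_scaleC w(1))
    ultimately show ?thesis using x(1,2) by blast
  qed
  then obtain m where "\<forall>k. \<exists>\<zeta> x. m k \<ge> Suc k \<and> cmod (\<zeta> - z) < 1 / real (Suc k) \<and> x \<in> Dn (m k) \<and>
      norm x = 1 \<and> norm (Sn (m k) \<zeta> x) < 1 / real (Suc k)"
    unfolding choice_iff by metis
  then obtain \<zeta> x where m: "\<And>k. m k \<ge> Suc k" and \<zeta>: "\<And>k. cmod (\<zeta> k - z) < 1 / real (Suc k)"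
    and x: "\<And>k. x k \<in> Dn (m k)" "\<And>k. norm (x k) = 1"
    and S: "\<And>k. norm (Sn (m k) (\<zeta> k) (x k)) < 1 / real (Suc k)"
    by (simp only: choice_iff) blast
  have P: "selfadjoint_pencil (Hn (m k)) (Dn (m k)) (Tn (m k)) (Jn (m k)) M" for k
    using m[of k] by (intro app) auto
  have mlim: "filterlim m at_top sequentially"
    by (rule filterlim_at_top_mono[OF filterlim_Suc]) (use m in auto)
  have inv: "(\<lambda>k. 1 / real (Suc k)) \<longlonglongrightarrow> 0"
    using LIMSEQ_inverse_real_of_nat by (simp add: inverse_eq_divide)
  have \<zeta>lim: "\<zeta> \<longlonglongrightarrow> z"
    by (rule LIM_zero_cancel, rule Lim_null_comparison[OF _ inv])
      (intro always_eventually allI less_imp_le[OF \<zeta>])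
  define y where "y k = Sn (m k) (\<zeta> k) (x k)" for k
  have ylim: "y \<longlonglongrightarrow> 0"
    unfolding y_def
    by (rule Lim_null_comparison[OF _ inv]) (intro always_eventually allI less_imp_le[OF S])
  obtain t c C \<Phi> where c: "c > 0" and \<Phi>: "finite \<Phi>" and coer:
    "\<And>n x. n > 0 \<Longrightarrow> x \<in> Dn n \<Longrightarrow> c * (norm x)\<^sup>2 \<le> Re (cinner (Tn n x) x) -
         (Re z + t * Im z) * Re (cinner (Jn n x) x) + C * (\<Sum>\<phi>\<in>\<Phi>. (cmod (cinner x \<phi>))\<^sup>2)"
    using coercive[OF z] by metis
  have weak: "(\<lambda>k. cinner (x k) \<phi>) \<longlonglongrightarrow> 0" for \<phi>
  proof -
    have "bij_betw (lim.S (cnj z)) D UNIV"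
      using lim.not_spec_cnj[OF z] by (simp add: lim.not_spec_iff)
    then obtain f where f: "f \<in> D" "lim.S (cnj z) f = \<phi>"
      unfolding bij_betw_def by (metis UNIV_I imageE)
    obtain F where F: "\<And>n. n > 0 \<Longrightarrow> F n \<in> Dn n" "F \<longlonglongrightarrow> f" "(\<lambda>n. Tn n (F n)) \<longlonglongrightarrow> T f"
        "(\<lambda>n. Jn n (F n)) \<longlonglongrightarrow> J f"
      using consistent[OF f(1)] by metis
    note lims = F(2-4)[THEN filterlim_compose, OF mlim]
    \<comment> \<open>The consistency error of the approximate solutions \<open>F\<close> of
      \<open>S (cnj z) f = \<phi>\<close>. By symmetry the pencil moves from \<open>F\<close> onto
      \<open>x k\<close>, where it leaves the residual \<open>y k\<close>.\<close>
    define e where "e k = \<phi> - (Tn (m k) (F (m k)) - cnj (\<zeta> k) *\<^sub>C Jn (m k) (F (m k)))" for k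
    have "e \<longlonglongrightarrow> \<phi> - (T f - cnj z *\<^sub>C J f)"
      unfolding e_def by (intro tendsto_intros lims \<zeta>lim)
    then have e: "e \<longlonglongrightarrow> 0" using f(2) by (simp add: lim.S_def)
    have eq: "cinner (x k) \<phi> = cinner (x k) (e k) + cinner (y k) (F (m k))" for k
    proof -
      interpret P: selfadjoint_pencil "Hn (m k)" "Dn (m k)" "Tn (m k)" "Jn (m k)" M by (rule P)
      have "F (m k) \<in> Dn (m k)" using m[of k] by (intro F) auto
      from P.S_adj[OF x(1) this] show ?thesis
        by (simp add: y_def e_def P.S_def cinner_algebra)
    qed
    show ?thesis
    proof (rule Lim_null_comparison)
      show "\<forall>\<^sub>F k in sequentially. norm (cinner (x k) \<phi>) \<le> norm (e k) + norm (y k) * norm (F (m k))"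
      proof (intro always_eventually allI)
        fix k
        show "norm (cinner (x k) \<phi>) \<le> norm (e k) + norm (y k) * norm (F (m k))"
          unfolding eq using cinner_norm_bound[of "x k" "e k"] cinner_norm_bound[of "y k" "F (m k)"]
          by (intro order_trans[OF norm_triangle_ineq] add_mono) (auto simp: x(2))
      qed
      have "(\<lambda>k. norm (e k) + norm (y k) * norm (F (m k))) \<longlonglongrightarrow> norm (0::'a) + norm (0::'a) * norm f"
        by (intro tendsto_intros e ylim lims)
      then show "(\<lambda>k. norm (e k) + norm (y k) * norm (F (m k))) \<longlonglongrightarrow> 0" by simp
    qed
  qed
  \<comment> \<open>What coercivity leaves for the normalised \<open>x k\<close>: the residual, the
    cost of replacing \<open>\<zeta> k\<close> by \<open>z\<close>, and the finite-rank term. All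
    three tend to 0.\<close>
  define B where "B k = (1 + \<bar>t\<bar>) * norm (y k) +
      \<bar>(Re (\<zeta> k) + t * Im (\<zeta> k)) - (Re z + t * Im z)\<bar> * M + C * (\<Sum>\<phi>\<in>\<Phi>. (cmod (cinner (x k) \<phi>))\<^sup>2)" for k
  have "c \<le> B k" for k
  proof -
    interpret P: selfadjoint_pencil "Hn (m k)" "Dn (m k)" "Tn (m k)" "Jn (m k)" M by (rule P)
    let ?j = "Re (cinner (Jn (m k) (x k)) (x k))"
    let ?d = "(Re (\<zeta> k) + t * Im (\<zeta> k)) - (Re z + t * Im z)"
    have "\<bar>?d * ?j\<bar> \<le> \<bar>?d\<bar> * M"
      using P.Re_cinner_J[OF P.mem_D_U[OF x(1)]] unfolding abs_mult
      by (intro mult_left_mono) (auto simp: x(2))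
    moreover have "Re (cinner (Tn (m k) (x k)) (x k)) - (Re (\<zeta> k) + t * Im (\<zeta> k)) * ?j \<le>
        (1 + \<bar>t\<bar>) * norm (y k)"
      using P.S_form_le[OF x(1), of "\<zeta> k" t] by (simp add: P.S_def y_def x(2))
    moreover have "c \<le> Re (cinner (Tn (m k) (x k)) (x k)) -
         (Re z + t * Im z) * ?j + C * (\<Sum>\<phi>\<in>\<Phi>. (cmod (cinner (x k) \<phi>))\<^sup>2)"
      using coer[of "m k" "x k"] m[of k] x[of k] by auto
    ultimately show ?thesis unfolding B_def
      by (simp add: left_diff_distrib abs_le_iff)
  qed
  moreover have "B \<longlonglongrightarrow> (1 + \<bar>t\<bar>) * norm (0::'a) +
      \<bar>(Re z + t * Im z) - (Re z + t * Im z)\<bar> * M + C * (\<Sum>\<phi>\<in>\<Phi>. (cmod 0)\<^sup>2)"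
    unfolding B_def by (intro tendsto_intros ylim \<zeta>lim weak)
  ultimately have "c \<le> 0"
    by (intro LIMSEQ_le_const[of B 0 c]) auto
  with c show False by simp
qed

abbreviation "\<Sigma>n n \<equiv> pencil_spectrum (Hn n) (Dn n) (Tn n) (Jn n)"

text \<open>Stability is applied at \<open>z\<close> and at its conjugate, because surjectivity of
  an approximating pencil is read off from the lower bound of its adjoint.\<close>

lemma resolvent_stability:
  assumes z: "z \<notin> lim.spec"
  shows "\<exists>c>0. \<exists>N. \<forall>n\<ge>N. \<forall>\<zeta>. cmod (\<zeta> - z) < c \<longrightarrow> \<zeta> \<notin> \<Sigma>n n"
proof -
  obtain c N where c: "c > 0" "N > 0"
    "\<And>n \<zeta> x. n \<ge> N \<Longrightarrow> cmod (\<zeta> - z) < c \<Longrightarrow> x \<in> Dn n \<Longrightarrow> c * norm x \<le> norm (Sn n \<zeta> x)"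
    using stability[OF z] by metis
  obtain c' N' where c': "c' > 0" "N' > 0"
    "\<And>n \<zeta> x. n \<ge> N' \<Longrightarrow> cmod (\<zeta> - cnj z) < c' \<Longrightarrow> x \<in> Dn n \<Longrightarrow> c' * norm x \<le> norm (Sn n \<zeta> x)"
    using stability[OF lim.not_spec_cnj[OF z]] by metis
  have "\<zeta> \<notin> \<Sigma>n n" if n: "n \<ge> max N N'" and \<zeta>: "cmod (\<zeta> - z) < min c c'" for n \<zeta>
  proof -
    interpret P: selfadjoint_pencil "Hn n" "Dn n" "Tn n" "Jn n" M using n c(2) by (intro app) auto
    have "cmod (cnj \<zeta> - cnj z) < c'" using \<zeta> by (metis complex_cnj_diff complex_mod_cnj min_less_iff_conj)
    then show ?thesis
      using n \<zeta> by (intro P.not_spec_if_bounded_below P.bounded_belowI[OF c(1)] P.bounded_belowI[OF c'(1)])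
        (auto simp: P.S_def c(3) c'(3))
  qed
  then show ?thesis using c(1) c'(1)
    by (intro exI[of _ "min c c'"] conjI exI[of _ "max N N'"]) auto
qed

lemma free_of_pollution: "free_of_spectral_pollution lim.spec \<Sigma>n"
  unfolding free_of_spectral_pollution_def
proof (intro notI, elim exE conjE)
  fix z I l
  assume z: "z \<notin> lim.spec" and I: "infinite I" and l: "\<forall>n\<in>I. l n \<in> \<Sigma>n n"
    and lim: "(l \<longlongrightarrow> z) (inf sequentially (principal I))"
  obtain c N where c: "c > 0" "\<And>n \<zeta>. n \<ge> N \<Longrightarrow> cmod (\<zeta> - z) < c \<Longrightarrow> \<zeta> \<notin> \<Sigma>n n"
    using resolvent_stability[OF z] by metis
  have "\<forall>\<^sub>F n in inf sequentially (principal I). dist (l n) z < c"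
    using lim c(1) by (rule tendstoD)
  then obtain N' where N': "\<And>n. n \<ge> N' \<Longrightarrow> n \<in> I \<Longrightarrow> dist (l n) z < c"
    by (auto simp: eventually_inf_principal eventually_sequentially)
  obtain n where "n \<ge> max N N'" "n \<in> I"
    using I unfolding infinite_nat_iff_unbounded_le by blast
  then show False using N'[of n] c(2)[of n "l n"] l by (auto simp: dist_norm)
qed

lemma exact:
  assumes up: "uniformly_positive D T"
  shows "spectrally_exact lim.spec \<Sigma>n"
proof (rule spectrally_exactI[OF free_of_pollution])
  fix z and \<epsilon> :: real
  assume z: "z \<in> lim.spec" and \<epsilon>: "\<epsilon> > 0"
  obtain c0 where c0: "c0 > 0" "\<And>x. x \<in> D \<Longrightarrow> c0 * (norm x)\<^sup>2 \<le> Re (cinner (T x) x)"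
    using up by (auto simp: uniformly_positive_def)
  obtain c where c: "c > 0" "\<And>n x. n > 0 \<Longrightarrow> x \<in> Dn n \<Longrightarrow> c * (norm x)\<^sup>2 \<le> Re (cinner (Tn n x) x)"
    using positive[OF up] by metis
  \<comment> \<open>With such a \<open>t\<close> the \<open>J\<close> term cancels from the combined
    form and positivity of \<open>T\<close> alone bounds \<open>S w\<close>. A suitable
    \<open>t\<close> exists for every nonreal \<open>w\<close> and for \<open>w = 0\<close>, so the
    spectrum is real and avoids 0.\<close>
  have nonreal: "lim.bounded_below w" if t: "Re w + t * Im w = 0" for w t
  proof (rule lim.bounded_belowI)
    show "c0 / (1 + \<bar>t\<bar>) > 0" using c0(1) by (simp add: add_pos_nonneg)
    fix x assume x: "x \<in> D"
    have "c0 * (norm x)\<^sup>2 \<le> (1 + \<bar>t\<bar>) * (norm (lim.S w x) * norm x)"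
      using lim.S_form_le[OF x, of w t] c0(2)[OF x] t by simp
    then show "c0 / (1 + \<bar>t\<bar>) * norm x \<le> norm (lim.S w x)"
      by (cases "norm x = 0") (simp_all add: power2_eq_square divide_simps ac_simps flip: distrib_left)
  qed
  have "Im z = 0 \<and> Re z \<noteq> 0"
  proof (rule ccontr)
    assume *: "\<not> ?thesis"
    have "\<exists>t. Re z + t * Im z = 0"
      using * by (cases "Im z = 0") (auto intro: exI[of _ "- Re z / Im z"])
    then obtain t where "Re z + t * Im z = 0" by auto
    then have "lim.bounded_below z" "lim.bounded_below (cnj z)"
      using nonreal[of z t] nonreal[of "cnj z" "- t"] by auto
    then show False using lim.not_spec_if_bounded_below z by blast
  qed
  then obtain l where l: "z = complex_of_real l" "l \<noteq> 0"
    by (metis complex_eq_iff complex_of_real_def Re_complex_of_real Im_complex_of_real)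
  \<comment> \<open>Continuity of the reciprocal translates the gap of radius
    \<open>\<epsilon>\<close> around \<open>l\<close> into one of some radius \<open>\<rho>\<close>
    around \<open>1 / l\<close>, the same for all approximations.\<close>
  have "((\<lambda>s. 1 / (1 / l + s)) \<longlongrightarrow> 1 / (1 / l + 0)) (at 0)" "((\<lambda>s. 1 / l + s) \<longlongrightarrow> 1 / l + 0) (at 0)"
    using l(2) by (intro tendsto_intros; simp)+
  then have "\<forall>\<^sub>F s in at 0. dist (1 / (1 / l + s)) l < \<epsilon> \<and> 1 / l + s \<noteq> 0"
    using l(2) \<epsilon> by (intro eventually_conj tendsto_imp_eventually_ne[where c = "1 / l"])
      (auto dest: tendstoD)
  then obtain \<rho> where \<rho>: "\<rho> > 0" "\<And>s. s \<noteq> 0 \<Longrightarrow> \<bar>s\<bar> < \<rho> \<Longrightarrow>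
      1 / l + s \<noteq> 0 \<and> \<bar>1 / (1 / l + s) - l\<bar> < \<epsilon>"
    unfolding eventually_at by (auto simp: dist_real_def)
  have \<rho>': "1 / l + s \<noteq> 0 \<and> \<bar>1 / (1 / l + s) - l\<bar> < \<epsilon>" if "\<bar>s\<bar> < \<rho>" for s
    using \<rho>(2)[OF _ that] l(2) \<epsilon> by (cases "s = 0") auto
  show "\<forall>\<^sub>F n in sequentially. \<exists>w\<in>\<Sigma>n n. cmod (w - z) < \<epsilon>"
  proof (rule ccontr)
    assume *: "\<not> ?thesis"
    define I where "I = {n. n > 0 \<and> \<not> (\<exists>w\<in>\<Sigma>n n. cmod (w - z) < \<epsilon>)}"
    have "\<exists>n\<ge>N. n \<in> I" for N
    proof -
      obtain n where "n \<ge> Suc N" "\<not> (\<exists>w\<in>\<Sigma>n n. cmod (w - z) < \<epsilon>)"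
        using * unfolding eventually_sequentially by blast
      then show ?thesis by (intro exI[of _ n]) (auto simp: I_def)
    qed
    then obtain m where m: "\<And>k. m k \<ge> k" "\<And>k. m k \<in> I" by metis
    have mlim: "filterlim m at_top sequentially"
      by (rule filterlim_at_top_mono[OF filterlim_ident]) (use m in auto)
    \<comment> \<open>Independent of \<open>k\<close>; hence the lower bounds along the subsequence
      without spectrum near \<open>z\<close> carry over to \<open>S z f\<close> through the
      approximations of \<open>f\<close>.\<close>
    define \<kappa> where "\<kappa> = \<rho> * c * \<bar>l\<bar>"
    have \<kappa>: "\<kappa> > 0" using \<rho>(1) c(1) l(2) by (simp add: \<kappa>_def)
    have "\<kappa> * norm f \<le> norm (lim.S z f)" if f: "f \<in> D" for f
    proof -
      obtain F where F: "\<And>n. n > 0 \<Longrightarrow> F n \<in> Dn n" "F \<longlonglongrightarrow> f" "(\<lambda>n. Tn n (F n)) \<longlonglongrightarrow> T f"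
          "(\<lambda>n. Jn n (F n)) \<longlonglongrightarrow> J f"
        using consistent[OF f] by metis
      note lims = F(2-4)[THEN filterlim_compose, OF mlim]
      have "(\<lambda>k. norm (Sn (m k) z (F (m k)))) \<longlonglongrightarrow> norm (T f - z *\<^sub>C J f)"
        by (intro tendsto_intros lims)
      moreover have "(\<lambda>k. \<kappa> * norm (F (m k))) \<longlonglongrightarrow> \<kappa> * norm f"
        by (intro tendsto_intros lims)
      moreover have "\<kappa> * norm (F (m k)) \<le> norm (Sn (m k) z (F (m k)))" for k
      proof -
        have mk: "m k > 0" "\<And>w. w \<in> \<Sigma>n (m k) \<Longrightarrow> \<epsilon> \<le> cmod (w - z)"
          using m(2)[of k] by (force simp: I_def)+
        interpret P: selfadjoint_pencil "Hn (m k)" "Dn (m k)" "Tn (m k)" "Jn (m k)" M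
          using mk(1) by (rule app)
        have "\<rho> * c * \<bar>l\<bar> * norm (F (m k)) \<le> norm (P.S (complex_of_real l) (F (m k)))"
        proof (rule P.bounded_below_if_spectral_gap[OF c(1) _ l(2) _ \<rho>(1)])
          fix x assume "x \<in> Dn (m k)"
          then show "c * (norm x)\<^sup>2 \<le> Re (cinner (Tn (m k) x) x)" by (intro c mk)
        next
          fix w assume "w \<in> \<Sigma>n (m k)"
          then show "\<epsilon> \<le> cmod (w - complex_of_real l)" unfolding l(1)[symmetric] by (rule mk(2))
        next
          fix s assume "\<bar>s\<bar> < \<rho>"
          then show "1 / l + s \<noteq> 0 \<and> \<bar>1 / (1 / l + s) - l\<bar> < \<epsilon>" by (rule \<rho>')
        next
          show "F (m k) \<in> Dn (m k)" using mk(1) by (rule F(1))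
        qed
        then show ?thesis by (simp add: P.S_def l(1) \<kappa>_def)
      qed
      ultimately show ?thesis unfolding lim.S_def by (intro LIMSEQ_le) auto
    qed
    then have "lim.bounded_below z" by (rule lim.bounded_belowI[OF \<kappa>])
    then have "z \<notin> lim.spec" by (intro lim.not_spec_if_bounded_below) (auto simp: l(1))
    with z show False by simp
  qed
qed

end

section \<open>Test functions\<close>

definition smooth :: "(real \<Rightarrow> real) \<Rightarrow> bool" where
  "smooth f \<longleftrightarrow> (\<forall>k x. (deriv ^^ k) f differentiable (at x))"

text \<open>Coinduction: a class of differentiable functions that is closed under
  \<open>deriv\<close> contains all iterated derivatives of its members. Every smoothness proof
  below consists in naming such a class.\<close>

lemma smooth_coinduct:
  assumes "P f" and step: "\<And>f. P f \<Longrightarrow> (\<forall>x. f differentiable (at x)) \<and> P (deriv f)"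
  shows "smooth f"
proof -
  have "P ((deriv ^^ k) f)" for k
    by (induction k) (use assms in auto)
  then show ?thesis using step by (auto simp: smooth_def)
qed

lemma smooth_deriv: "smooth f \<Longrightarrow> smooth (deriv f)"
  unfolding smooth_def by (metis funpow_Suc_right comp_apply)

lemma smooth_DERIV: "smooth f \<Longrightarrow> (f has_real_derivative deriv f x) (at x)"
  unfolding DERIV_deriv_iff_real_differentiable smooth_def by (metis funpow_0)

lemma smooth_differentiable: "smooth f \<Longrightarrow> f differentiable (at x)"
  using smooth_DERIV real_differentiable_def by blast

lemma smooth_continuous: "smooth f \<Longrightarrow> continuous_on A f"
  using smooth_differentiable differentiable_imp_continuous_within
  by (metis continuous_at_imp_continuous_on)

lemma smooth_DERIV_coinduct:
  assumes "P f" and step: "\<And>f. P f \<Longrightarrow> \<exists>g. P g \<and> (\<forall>x. (f has_real_derivative g x) (at x))"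
  shows "smooth f"
proof (rule smooth_coinduct[where P = P, OF assms(1)])
  fix f assume "P f"
  then obtain g where g: "P g" "\<And>x. (f has_real_derivative g x) (at x)" using step by blast
  then have "deriv f = g" using DERIV_imp_deriv by blast
  then show "(\<forall>x. f differentiable (at x)) \<and> P (deriv f)"
    using g real_differentiable_def by auto
qed

lemma smooth_const: "smooth (\<lambda>_. c)"
  by (rule smooth_DERIV_coinduct[where P = "\<lambda>f. \<exists>c. f = (\<lambda>_. c)"]) (auto intro!: exI[of _ "\<lambda>_. 0"])

lemma smooth_add:
  assumes "smooth f" "smooth g"
  shows "smooth (\<lambda>x. f x + g x)"
proof (rule smooth_DERIV_coinduct[where P = "\<lambda>h. \<exists>f g. smooth f \<and> smooth g \<and> h = (\<lambda>x. f x + g x)"])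
  fix h assume "\<exists>f g. smooth f \<and> smooth g \<and> h = (\<lambda>x. f x + g x)"
  then obtain f g where "smooth f" "smooth g" "h = (\<lambda>x. f x + g x)" by auto
  then show "\<exists>k. (\<exists>f g. smooth f \<and> smooth g \<and> k = (\<lambda>x. f x + g x)) \<and>
      (\<forall>x. (h has_real_derivative k x) (at x))"
    by (intro exI[of _ "\<lambda>x. deriv f x + deriv g x"] conjI exI[of _ "deriv f"] exI[of _ "deriv g"])
      (auto intro!: smooth_deriv DERIV_add smooth_DERIV)
qed (use assms in auto)

text \<open>Products are not closed under differentiation, but finite sums of products are, by
  Leibniz' rule.\<close>

inductive product_sum :: "(real \<Rightarrow> real) \<Rightarrow> bool" where
  "smooth f \<Longrightarrow> smooth g \<Longrightarrow> product_sum (\<lambda>x. f x * g x)"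
| "product_sum f \<Longrightarrow> product_sum g \<Longrightarrow> product_sum (\<lambda>x. f x + g x)"

lemma smooth_mult:
  assumes "smooth f" "smooth g"
  shows "smooth (\<lambda>x. f x * g x)"
proof (rule smooth_DERIV_coinduct[where P = product_sum])
  fix h assume "product_sum h"
  then show "\<exists>k. product_sum k \<and> (\<forall>x. (h has_real_derivative k x) (at x))"
  proof induction
    case (1 f g)
    then have "product_sum (\<lambda>x. f x * deriv g x + deriv f x * g x)"
      by (intro product_sum.intros smooth_deriv)
    with 1 show ?case by (blast intro: DERIV_mult' smooth_DERIV)
  next
    case (2 f g)
    then show ?case by (blast intro: DERIV_add product_sum.intros)
  qed
qed (use assms in \<open>auto intro: product_sum.intros\<close>)

text \<open>The chain rule produces a factor \<open>\<alpha>\<close> at every differentiation; the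
  constant \<open>c\<close> in the class collects these factors.\<close>

lemma smooth_affine:
  assumes "smooth f"
  shows "smooth (\<lambda>x. f (\<alpha> * x + \<beta>))"
proof (rule smooth_DERIV_coinduct[where P = "\<lambda>h. \<exists>f c. smooth f \<and> h = (\<lambda>x. c * f (\<alpha> * x + \<beta>))"])
  fix h assume "\<exists>f c. smooth f \<and> h = (\<lambda>x. c * f (\<alpha> * x + \<beta>))"
  then obtain f c where f: "smooth f" "h = (\<lambda>x. c * f (\<alpha> * x + \<beta>))" by auto
  have "(h has_real_derivative (c * \<alpha>) * deriv f (\<alpha> * x + \<beta>)) (at x)" for x
    unfolding f(2)
    by (rule derivative_eq_intros DERIV_chain2[OF smooth_DERIV[OF f(1)]] refl | simp)+
  then show "\<exists>k. (\<exists>f c. smooth f \<and> k = (\<lambda>x. c * f (\<alpha> * x + \<beta>))) \<and>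
      (\<forall>x. (h has_real_derivative k x) (at x))"
    using smooth_deriv[OF f(1)] by blast
qed (use assms in \<open>auto intro!: exI[of _ f] exI[of _ 1]\<close>)

lemma smooth_sin_cos: "smooth (\<lambda>x. a * sin (\<kappa> * x) + b * cos (\<kappa> * x))"
proof (rule smooth_DERIV_coinduct[where P = "\<lambda>h. \<exists>a b. h = (\<lambda>x. a * sin (\<kappa> * x) + b * cos (\<kappa> * x))"])
  fix h assume "\<exists>a b. h = (\<lambda>x. a * sin (\<kappa> * x) + b * cos (\<kappa> * x))"
  then obtain a b where h: "h = (\<lambda>x. a * sin (\<kappa> * x) + b * cos (\<kappa> * x))" by auto
  have "(h has_real_derivative (- b * \<kappa>) * sin (\<kappa> * x) + (a * \<kappa>) * cos (\<kappa> * x)) (at x)" for x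
    unfolding h by (auto intro!: derivative_eq_intros)
  then show "\<exists>k. (\<exists>a b. k = (\<lambda>x. a * sin (\<kappa> * x) + b * cos (\<kappa> * x))) \<and>
      (\<forall>x. (h has_real_derivative k x) (at x))" by blast
qed auto

section \<open>Functions flat at the origin and bump functions\<close>

definition flat :: "real poly \<Rightarrow> real \<Rightarrow> real" where
  "flat p x = (if x > 0 then poly p (1 / x) * exp (- (1 / x)) else 0)"

lemma poly_over_exp_tendsto_0: "((\<lambda>x. poly p x / exp x) \<longlongrightarrow> (0::real)) at_top"
proof (induction p)
  case (pCons a p)
  have "((\<lambda>x. x * poly p x / exp x) \<longlongrightarrow> 0) at_top"
  proof -
    have "((\<lambda>x. \<Sum>i\<le>degree p. coeff p i * (x ^ Suc i / exp x)) \<longlongrightarrow> (\<Sum>i\<le>degree p. coeff p i * 0)) at_top"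
      by (intro tendsto_intros tendsto_power_div_exp_0)
    moreover have "(\<Sum>i\<le>degree p. coeff p i * (x ^ Suc i / exp x)) = x * poly p x / exp x" for x :: real
      by (simp add: poly_altdef sum_distrib_left sum_divide_distrib mult_ac)
    ultimately show ?thesis by simp
  qed
  moreover have "((\<lambda>x. a * (x ^ 0 / exp x)) \<longlongrightarrow> a * 0) at_top"
    by (intro tendsto_intros tendsto_power_div_exp_0)
  ultimately have "((\<lambda>x. a * (x ^ 0 / exp x) + x * poly p x / exp x) \<longlongrightarrow> a * 0 + 0) at_top"
    by (intro tendsto_add)
  then show ?case by (simp add: add_divide_distrib)
qed simp

text \<open>Differentiating a polynomial in \<open>1/x\<close> times \<open>exp (-1/x)\<close> gives
  another such product. Carrying the polynomial along is what closes the family under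
  \<open>deriv\<close>.\<close>

lemma flat_DERIV: "(flat p has_real_derivative flat ([:0, 0, 1:] * (p - pderiv p)) x) (at x)"
proof -
  consider "x > 0" | "x < 0" | "x = 0" by linarith
  then show ?thesis
  proof cases
    case 1
    have "((\<lambda>x. poly p (1 / x) * exp (- (1 / x))) has_real_derivative
        flat ([:0, 0, 1:] * (p - pderiv p)) x) (at x)"
      using 1 by (auto intro!: derivative_eq_intros poly_DERIV DERIV_chain2[OF poly_DERIV]
          simp: flat_def power2_eq_square field_simps)
    then show ?thesis
      by (rule has_field_derivative_transform_within_open[of _ _ _ "{0<..}"])
        (use 1 in \<open>auto simp: flat_def\<close>)
  next
    case 2
    have "((\<lambda>_. 0) has_real_derivative flat ([:0, 0, 1:] * (p - pderiv p)) x) (at x)"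
      using 2 by (simp add: flat_def)
    then show ?thesis
      by (rule has_field_derivative_transform_within_open[of _ _ _ "{..<0}"])
        (use 2 in \<open>auto simp: flat_def\<close>)
  next
    case 3
    \<comment> \<open>For \<open>h > 0\<close> the difference quotient at 0 is
      \<open>y * poly p y / exp y\<close> with \<open>y = 1/h\<close>, where the exponential
      wins.\<close>
    have "((\<lambda>h. flat p h / h) \<longlongrightarrow> 0) (at 0)"
    proof (rule filterlim_split_at)
      show "((\<lambda>h. flat p h / h) \<longlongrightarrow> 0) (at_left 0)"
        by (rule tendsto_eventually) (auto simp: flat_def eventually_at_filter)
      have "((\<lambda>h. poly (pCons 0 p) (inverse h) / exp (inverse h)) \<longlongrightarrow> 0) (at_right (0::real))"
        by (rule filterlim_compose[OF poly_over_exp_tendsto_0 filterlim_inverse_at_top_right])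
      then show "((\<lambda>h. flat p h / h) \<longlongrightarrow> 0) (at_right 0)"
        by (rule Lim_transform_eventually)
          (auto simp: flat_def eventually_at_filter exp_minus divide_inverse mult_ac)
    qed
    then show ?thesis
      using 3 by (simp add: DERIV_def flat_def)
  qed
qed

lemma smooth_flat: "smooth (flat p)"
  by (rule smooth_DERIV_coinduct[where P = "\<lambda>h. \<exists>p. h = flat p"]) (use flat_DERIV in blast)+

lemma deriv_eq_0_outside:
  assumes "closed K" "\<And>x. x \<notin> K \<Longrightarrow> \<phi> x = 0" "x \<notin> K"
  shows "deriv \<phi> x = (0::real)"
proof (rule DERIV_imp_deriv, rule has_field_derivative_transform_within_open)
  show "((\<lambda>_. 0) has_real_derivative 0) (at x)" by simp
  show "open (- K)" using assms(1) by (simp add: open_Compl)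
qed (use assms in auto)

lemma test_functions_iff:
  "\<phi> \<in> test_functions S \<longleftrightarrow> smooth \<phi> \<and> (\<exists>K. compact K \<and> K \<subseteq> S \<and> (\<forall>x. x \<notin> K \<longrightarrow> \<phi> x = 0))"
  by (simp add: test_functions_def smooth_def)

lemma test_smooth: "\<phi> \<in> test_functions S \<Longrightarrow> smooth \<phi>"
  by (simp add: test_functions_iff)

lemma test_mono: "\<phi> \<in> test_functions S \<Longrightarrow> S \<subseteq> S' \<Longrightarrow> \<phi> \<in> test_functions S'"
  by (auto simp: test_functions_iff)

lemma test_deriv:
  assumes "\<phi> \<in> test_functions S"
  shows "deriv \<phi> \<in> test_functions S"
proof -
  obtain K where K: "compact K" "K \<subseteq> S" "\<And>x. x \<notin> K \<Longrightarrow> \<phi> x = 0"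
    using assms by (auto simp: test_functions_iff)
  have "deriv \<phi> x = 0" if "x \<notin> K" for x
    by (rule deriv_eq_0_outside[OF compact_imp_closed[OF K(1)] K(3) that])
  then show ?thesis
    using K assms by (auto simp: test_functions_iff intro: smooth_deriv)
qed

lemma test_mult:
  assumes "smooth f" "\<phi> \<in> test_functions S"
  shows "(\<lambda>x. f x * \<phi> x) \<in> test_functions S"
  using assms by (force simp: test_functions_iff intro: smooth_mult)

lemma test_cmult: "\<phi> \<in> test_functions S \<Longrightarrow> (\<lambda>x. c * \<phi> x) \<in> test_functions S"
  by (rule test_mult[OF smooth_const])

lemma test_add:
  assumes "\<phi> \<in> test_functions S" "\<psi> \<in> test_functions S"
  shows "(\<lambda>x. \<phi> x + \<psi> x) \<in> test_functions S"
proof -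
  obtain K where K: "compact K" "K \<subseteq> S" "\<And>x. x \<notin> K \<Longrightarrow> \<phi> x = 0"
    using assms(1) by (auto simp: test_functions_iff)
  obtain L where L: "compact L" "L \<subseteq> S" "\<And>x. x \<notin> L \<Longrightarrow> \<psi> x = 0"
    using assms(2) by (auto simp: test_functions_iff)
  have "compact (K \<union> L)" "K \<union> L \<subseteq> S" "\<And>x. x \<notin> K \<union> L \<Longrightarrow> \<phi> x + \<psi> x = 0"
    using K L by auto
  then show ?thesis using assms unfolding test_functions_iff by (blast intro: smooth_add)
qed

text \<open>The parameter \<open>k\<close> steepens the flanks while the support stays in
  \<open>[a, b]\<close>; for growing \<open>k\<close> these functions tend to the indicator of
  \<open>(a, b)\<close>.\<close>

definition bump :: "real \<Rightarrow> real \<Rightarrow> real \<Rightarrow> real \<Rightarrow> real" where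
  "bump k a b x = flat 1 (k * (x - a)) * flat 1 (k * (b - x))"

lemma flat_1: "flat 1 x = (if x > 0 then exp (- (1 / x)) else 0)"
  by (simp add: flat_def)

lemma bump_nonneg: "0 \<le> bump k a b x" and bump_le_1: "bump k a b x \<le> 1"
  by (auto simp: bump_def flat_1 intro!: mult_le_one)

lemma bump_pos: "k > 0 \<Longrightarrow> a < x \<Longrightarrow> x < b \<Longrightarrow> 0 < bump k a b x"
  by (simp add: bump_def flat_1)

lemma bump_outside: "k \<ge> 0 \<Longrightarrow> x \<notin> {a<..<b} \<Longrightarrow> bump k a b x = 0"
  by (auto simp: bump_def flat_1 zero_less_mult_iff)

lemma bump_test:
  assumes "k \<ge> 0" "{a..b} \<subseteq> S"
  shows "bump k a b \<in> test_functions S"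
proof -
  have "smooth (\<lambda>x. flat 1 (k * x + (- k * a)) * flat 1 ((- k) * x + k * b))"
    by (intro smooth_mult smooth_affine smooth_flat)
  also have "(\<lambda>x. flat 1 (k * x + (- k * a)) * flat 1 ((- k) * x + k * b)) = bump k a b"
    by (simp add: bump_def fun_eq_iff algebra_simps)
  finally show ?thesis
    unfolding test_functions_iff using assms
    by (intro conjI exI[of _ "{a..b}"]) (auto simp: bump_outside)
qed

lemma bump_tendsto: "(\<lambda>k. bump (real k) a b x) \<longlonglongrightarrow> indicat_real {a<..<b} x"
proof (cases "x \<in> {a<..<b}")
  case True
  have lim: "(\<lambda>k. flat 1 (real k * y)) \<longlonglongrightarrow> 1" if "y > 0" for y
  proof -
    have "filterlim (\<lambda>k. real k * y) at_top sequentially"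
      using filterlim_at_top_mult_tendsto_pos[OF tendsto_const[of y] that filterlim_real_sequentially] .
    then have "(\<lambda>k. 1 / (real k * y)) \<longlonglongrightarrow> 0"
      by (intro tendsto_divide_0[OF tendsto_const] filterlim_at_top_imp_at_infinity)
    then have "(\<lambda>k. exp (- (1 / (real k * y)))) \<longlonglongrightarrow> exp (- 0)"
      by (intro tendsto_intros)
    then have "(\<lambda>k. exp (- (1 / (real k * y)))) \<longlonglongrightarrow> 1" by simp
    then show ?thesis
      by (rule Lim_transform_eventually)
        (use that in \<open>auto simp: flat_1 eventually_sequentially intro!: exI[of _ 1]\<close>)
  qed
  have "(\<lambda>k. bump (real k) a b x) \<longlonglongrightarrow> 1 * 1"
    unfolding bump_def using True by (intro tendsto_mult lim) auto
  with True show ?thesis by simp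
next
  case False
  then show ?thesis by (simp add: bump_outside)
qed

section \<open>Square-integrable functions\<close>

lemma AE_rep_abs_L2:
  assumes "square_integrable F"
  shows "AE x in lebesgue. rep_L2 (abs_L2 F) x = F x"
  using Quotient3_rep_abs[OF Quotient3_L2, of F] assms by (simp add: L2_rel_def)

lemma L2_eqI:
  assumes "AE x in lebesgue. rep_L2 f x = rep_L2 g x"
  shows "f = g"
  using assms Quotient3_rel_rep[OF Quotient3_L2, of f g]
  by (auto simp: L2_rel_def square_integrable_rep_L2)

lemma measurable_rep_L2 [measurable]: "rep_L2 f \<in> borel_measurable lebesgue"
  using square_integrable_rep_L2 square_integrable_def by blast

lemma AE_rep_add: "AE x in lebesgue. rep_L2 (f + g) x = rep_L2 f x + rep_L2 g x"
  by (simp add: plus_L2_def AE_rep_abs_L2 square_integrable_add square_integrable_rep_L2)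

lemma AE_rep_diff: "AE x in lebesgue. rep_L2 (f - g) x = rep_L2 f x - rep_L2 g x"
  by (simp add: minus_L2_def AE_rep_abs_L2 square_integrable_diff square_integrable_rep_L2)

lemma AE_rep_scaleC: "AE x in lebesgue. rep_L2 (z *\<^sub>C f) x = z * rep_L2 f x"
  by (simp add: scaleC_L2_def AE_rep_abs_L2 square_integrable_mult square_integrable_rep_L2)

lemma AE_rep_zero: "AE x in lebesgue. rep_L2 0 x = 0"
  by (simp add: zero_L2_def AE_rep_abs_L2 square_integrable_zero)

lemma AE_rep_mult_op:
  assumes "V \<in> L_infinity"
  shows "AE x in lebesgue. rep_L2 (mult_op V f) x = complex_of_real (V x) * rep_L2 f x"
proof -
  obtain C where "AE x in lebesgue. \<bar>V x\<bar> \<le> C" using assms by (auto simp: L_infinity_def)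
  then have "AE x in lebesgue. cmod (complex_of_real (V x) * rep_L2 f x) \<le> C * cmod (rep_L2 f x)"
    by eventually_elim (simp add: norm_mult mult_right_mono)
  moreover have "(\<lambda>x. complex_of_real (V x) * rep_L2 f x) \<in> borel_measurable lebesgue"
    using assms by (auto simp: L_infinity_def)
  ultimately have "square_integrable (\<lambda>x. complex_of_real (V x) * rep_L2 f x)"
    by (intro square_integrable_bound[OF _ square_integrable_rep_L2])
  then show ?thesis using assms by (simp add: mult_op_def AE_rep_abs_L2)
qed

lemma norm_L2_square: "(norm f)\<^sup>2 = (\<integral>x. (cmod (rep_L2 f x))\<^sup>2 \<partial>lebesgue)"
proof -
  have "complex_of_real ((norm f)\<^sup>2) = (\<integral>x. complex_of_real ((cmod (rep_L2 f x))\<^sup>2) \<partial>lebesgue)"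
    unfolding cinner_self[symmetric] cinner_L2.rep_eq by (simp only: complex_norm_square)
  also have "\<dots> = complex_of_real (\<integral>x. (cmod (rep_L2 f x))\<^sup>2 \<partial>lebesgue)"
    by (rule integral_complex_of_real)
  finally show ?thesis by (simp only: of_real_eq_iff)
qed

lemma integrable_rep_square: "integrable lebesgue (\<lambda>x. (cmod (rep_L2 f x))\<^sup>2)"
  using square_integrable_rep_L2 square_integrable_def by blast

lemma norm_L2_mono:
  assumes "AE x in lebesgue. cmod (rep_L2 f x) \<le> C * cmod (rep_L2 g x)" "C \<ge> 0"
  shows "norm f \<le> C * norm g"
proof (rule power2_le_imp_le)
  have "(norm f)\<^sup>2 \<le> (\<integral>x. C\<^sup>2 * (cmod (rep_L2 g x))\<^sup>2 \<partial>lebesgue)"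
    unfolding norm_L2_square
  proof (rule integral_mono_AE)
    show "AE x in lebesgue. (cmod (rep_L2 f x))\<^sup>2 \<le> C\<^sup>2 * (cmod (rep_L2 g x))\<^sup>2"
      using assms(1)
    proof eventually_elim
      case (elim x)
      then have "(cmod (rep_L2 f x))\<^sup>2 \<le> (C * cmod (rep_L2 g x))\<^sup>2" by (intro power_mono) auto
      then show ?case by (simp add: power_mult_distrib)
    qed
  qed (auto intro: integrable_rep_square)
  then show "(norm f)\<^sup>2 \<le> (C * norm g)\<^sup>2"
    by (simp add: norm_L2_square power_mult_distrib)
qed (use assms in auto)

lemma mult_op_add:
  assumes "V \<in> L_infinity"
  shows "mult_op V (f + g) = mult_op V f + mult_op V g"
proof (rule L2_eqI)
  show "AE x in lebesgue. rep_L2 (mult_op V (f + g)) x = rep_L2 (mult_op V f + mult_op V g) x"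
    using AE_rep_mult_op[OF assms, of f] AE_rep_mult_op[OF assms, of g]
      AE_rep_mult_op[OF assms, of "f + g"] AE_rep_add[of f g] AE_rep_add[of "mult_op V f" "mult_op V g"]
    by eventually_elim (simp add: algebra_simps)
qed

lemma mult_op_scaleC:
  assumes "V \<in> L_infinity"
  shows "mult_op V (z *\<^sub>C f) = z *\<^sub>C mult_op V f"
proof (rule L2_eqI)
  show "AE x in lebesgue. rep_L2 (mult_op V (z *\<^sub>C f)) x = rep_L2 (z *\<^sub>C mult_op V f) x"
    using AE_rep_mult_op[OF assms, of f] AE_rep_mult_op[OF assms, of "z *\<^sub>C f"]
      AE_rep_scaleC[of z f] AE_rep_scaleC[of z "mult_op V f"]
    by eventually_elim (simp add: algebra_simps)
qed

lemma mult_op_diff: "V \<in> L_infinity \<Longrightarrow> mult_op V (f - g) = mult_op V f - mult_op V g"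
  using mult_op_add[of V "f - g" g] by simp

lemma mult_op_sym:
  assumes "V \<in> L_infinity"
  shows "cinner (mult_op V f) g = cinner f (mult_op V g)"
  unfolding cinner_L2.rep_eq
proof (rule integral_cong_AE)
  show "AE x in lebesgue. rep_L2 (mult_op V f) x * cnj (rep_L2 g x) =
      rep_L2 f x * cnj (rep_L2 (mult_op V g) x)"
    using AE_rep_mult_op[OF assms, of f] AE_rep_mult_op[OF assms, of g]
    by eventually_elim simp
qed (auto intro!: borel_measurable_integrable integrable_cinner square_integrable_rep_L2)

lemma norm_mult_op_le:
  assumes "V \<in> L_infinity" "AE x in lebesgue. \<bar>V x\<bar> \<le> C" "C \<ge> 0"
  shows "norm (mult_op V f) \<le> C * norm f"
  using assms(2) AE_rep_mult_op[OF assms(1), of f]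
  by (intro norm_L2_mono assms(3)) (auto elim!: eventually_elim2 simp: norm_mult mult_right_mono)

lemma tendsto_mult_op:
  assumes "V \<in> L_infinity" "(F \<longlongrightarrow> f) A"
  shows "((\<lambda>n. mult_op V (F n)) \<longlongrightarrow> mult_op V f) A"
proof -
  obtain C where C: "AE x in lebesgue. \<bar>V x\<bar> \<le> C" using assms by (auto simp: L_infinity_def)
  have "AE x in lebesgue. \<bar>V x\<bar> \<le> \<bar>C\<bar>" using C by eventually_elim simp
  then have "norm (mult_op V (F n) - mult_op V f) \<le> \<bar>C\<bar> * norm (F n - f)" for n
    unfolding mult_op_diff[OF assms(1), symmetric] by (intro norm_mult_op_le assms) auto
  moreover have "((\<lambda>n. \<bar>C\<bar> * norm (F n - f)) \<longlongrightarrow> \<bar>C\<bar> * norm (f - f)) A"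
    by (intro tendsto_intros assms)
  ultimately have "((\<lambda>n. mult_op V (F n) - mult_op V f) \<longlongrightarrow> 0) A"
    by (intro Lim_null_comparison[of "\<lambda>n. mult_op V (F n) - mult_op V f" "\<lambda>n. \<bar>C\<bar> * norm (F n - f)" A])
      simp_all
  then show ?thesis by (rule LIM_zero_cancel)
qed

lemma indicator_L_infinity: "S \<in> sets lebesgue \<Longrightarrow> indicat_real S \<in> L_infinity"
  by (auto simp: L_infinity_def intro!: exI[of _ 1] always_eventually split: split_indicator)

lemma mem_L2_on: "f \<in> L2_on S \<longleftrightarrow> (AE x in lebesgue. x \<notin> S \<longrightarrow> rep_L2 f x = 0)"
  by (simp add: L2_on_def agree_on.rep_eq)

lemma L2_on_UNIV: "L2_on UNIV = UNIV"
  by (auto simp: mem_L2_on)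

lemma L2_on_mono: "S \<subseteq> S' \<Longrightarrow> L2_on S \<subseteq> L2_on S'"
  by (auto simp: mem_L2_on elim!: eventually_mono)

lemma restrict_L2_on:
  assumes "S \<in> sets lebesgue"
  shows "mult_op (indicator S) f \<in> L2_on S"
  using AE_rep_mult_op[OF indicator_L_infinity[OF assms], of f]
  by (auto simp: mem_L2_on elim!: eventually_mono)

lemma restrict_L2_on_eq:
  assumes "S \<in> sets lebesgue" "f \<in> L2_on S"
  shows "mult_op (indicator S) f = f"
  using AE_rep_mult_op[OF indicator_L_infinity[OF assms(1)], of f] assms(2)
  by (intro L2_eqI) (auto simp: mem_L2_on elim!: eventually_elim2 split: split_indicator)

lemma mult_op_L2_on:
  assumes "V \<in> L_infinity" "f \<in> L2_on S"
  shows "mult_op V f \<in> L2_on S"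
  using AE_rep_mult_op[OF assms(1), of f] assms(2)
  by (auto simp: mem_L2_on elim!: eventually_elim2)

lemma csubspace_L2_on: "csubspace (L2_on S)"
  unfolding csubspace_def mem_L2_on
proof (intro conjI ballI allI)
  show "AE x in lebesgue. x \<notin> S \<longrightarrow> rep_L2 0 x = 0"
    using AE_rep_zero by eventually_elim simp
  fix f g z
  assume f: "f \<in> L2_on S"
  show "AE x in lebesgue. x \<notin> S \<longrightarrow> rep_L2 (z *\<^sub>C f) x = 0"
    using AE_rep_scaleC[of z f] f unfolding mem_L2_on by eventually_elim simp
  assume g: "g \<in> L2_on S"
  show "AE x in lebesgue. x \<notin> S \<longrightarrow> rep_L2 (f + g) x = 0"
    using AE_rep_add[of f g] f g unfolding mem_L2_on by eventually_elim simp
qed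

lemma closed_L2_on:
  assumes "S \<in> sets lebesgue"
  shows "closed (L2_on S)"
  unfolding closed_sequential_limits
proof (intro allI impI, elim conjE)
  fix F f assume F: "\<forall>n. F n \<in> L2_on S" "F \<longlonglongrightarrow> f"
  have "(\<lambda>n. mult_op (indicator S) (F n)) \<longlonglongrightarrow> mult_op (indicator S) f"
    by (intro tendsto_mult_op indicator_L_infinity assms F)
  then have "F \<longlonglongrightarrow> mult_op (indicator S) f"
    using F(1) by (simp add: restrict_L2_on_eq[OF assms])
  then have "f = mult_op (indicator S) f" using F(2) LIMSEQ_unique by blast
  then show "f \<in> L2_on S" using restrict_L2_on[OF assms] by metis
qed

section \<open>Weak derivatives\<close>

definition emb :: "(real \<Rightarrow> real) \<Rightarrow> L2" where
  "emb \<phi> = abs_L2 (\<lambda>x. complex_of_real (\<phi> x))"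

lemma integrable_compact_support:
  fixes f :: "real \<Rightarrow> 'a::{banach, second_countable_topology}"
  assumes "continuous_on UNIV f" "compact K" "\<And>x. x \<notin> K \<Longrightarrow> f x = 0"
  shows "integrable lebesgue f"
proof -
  have "integrable lborel (\<lambda>x. indicat_real K x *\<^sub>R f x)"
    by (intro borel_integrable_compact assms continuous_on_subset[OF assms(1)]) auto
  also have "(\<lambda>x. indicat_real K x *\<^sub>R f x) = f"
    using assms(3) by (auto simp: fun_eq_iff indicator_def)
  finally show ?thesis
    using assms(1) by (simp add: integrable_completion borel_measurable_continuous_onI)
qed

lemma integrable_test:
  assumes "\<phi> \<in> test_functions S"
  shows "integrable lebesgue \<phi>"
  using assms smooth_continuous by (auto simp: test_functions_iff intro: integrable_compact_support)

lemma square_integrable_test: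
  assumes "\<phi> \<in> test_functions S"
  shows "square_integrable (\<lambda>x. complex_of_real (\<phi> x))"
proof -
  obtain K where K: "compact K" "\<And>x. x \<notin> K \<Longrightarrow> \<phi> x = 0" and c: "continuous_on UNIV \<phi>"
    using assms smooth_continuous by (auto simp: test_functions_iff)
  have "integrable lebesgue (\<lambda>x. complex_of_real (\<phi> x))" "integrable lebesgue (\<lambda>x. (\<phi> x)\<^sup>2)"
    by (rule integrable_compact_support[OF _ K(1)]; use K(2) c in \<open>auto intro!: continuous_intros\<close>)+
  then show ?thesis by (auto simp: square_integrable_def)
qed

lemma AE_rep_emb:
  assumes "\<phi> \<in> test_functions S"
  shows "AE x in lebesgue. rep_L2 (emb \<phi>) x = complex_of_real (\<phi> x)"
  unfolding emb_def by (rule AE_rep_abs_L2[OF square_integrable_test[OF assms]])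

lemma emb_L2_on:
  assumes "\<phi> \<in> test_functions S"
  shows "emb \<phi> \<in> L2_on S"
  unfolding mem_L2_on using AE_rep_emb[OF assms]
  by eventually_elim (use assms in \<open>auto simp: test_functions_iff\<close>)

lemma cinner_emb:
  assumes "\<phi> \<in> test_functions S"
  shows "cinner f (emb \<phi>) = (\<integral>x. \<phi> x *\<^sub>R rep_L2 f x \<partial>lebesgue)"
  unfolding cinner_L2.rep_eq
proof (rule integral_cong_AE)
  show "AE x in lebesgue. rep_L2 f x * cnj (rep_L2 (emb \<phi>) x) = \<phi> x *\<^sub>R rep_L2 f x"
    using AE_rep_emb[OF assms] by eventually_elim (simp add: scaleR_conv_of_real mult.commute)
  have "\<phi> \<in> borel_measurable lebesgue"
    using integrable_test[OF assms] by (rule borel_measurable_integrable)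
  then show "(\<lambda>x. \<phi> x *\<^sub>R rep_L2 f x) \<in> borel_measurable lebesgue" by simp
qed (auto intro!: borel_measurable_integrable integrable_cinner square_integrable_rep_L2)

text \<open>Test functions are real, so the test integrals are inner products with
  \<open>emb \<phi>\<close>. Linearity and closedness of weak differentiation are then properties of
  \<open>cinner\<close>.\<close>

lemma has_weak_deriv_on_iff:
  "has_weak_deriv_on S f g \<longleftrightarrow>
    (\<forall>\<phi>\<in>test_functions S. cinner f (emb (deriv \<phi>)) = - cinner g (emb \<phi>))"
  unfolding has_weak_deriv_on.rep_eq
  by (intro ball_cong refl) (simp add: cinner_emb cinner_emb[OF test_deriv])

lemma has_weak_deriv_on_subset:
  "has_weak_deriv_on S f g \<Longrightarrow> S' \<subseteq> S \<Longrightarrow> has_weak_deriv_on S' f g"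
  unfolding has_weak_deriv_on_iff using test_mono by blast

lemma has_weak_deriv_on_add:
  "has_weak_deriv_on S f g \<Longrightarrow> has_weak_deriv_on S f' g' \<Longrightarrow> has_weak_deriv_on S (f + f') (g + g')"
  by (simp add: has_weak_deriv_on_iff cinner_algebra)

lemma has_weak_deriv_on_diff:
  "has_weak_deriv_on S f g \<Longrightarrow> has_weak_deriv_on S f' g' \<Longrightarrow> has_weak_deriv_on S (f - f') (g - g')"
  by (simp add: has_weak_deriv_on_iff cinner_algebra)

lemma has_weak_deriv_on_scaleC:
  "has_weak_deriv_on S f g \<Longrightarrow> has_weak_deriv_on S (z *\<^sub>C f) (z *\<^sub>C g)"
  by (simp add: has_weak_deriv_on_iff cinner_algebra)

lemma has_weak_deriv_on_zero: "has_weak_deriv_on S 0 0"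
  by (simp add: has_weak_deriv_on_iff)

lemma has_weak_deriv_on_limit:
  assumes "\<And>n. has_weak_deriv_on S (F n) (G n)" "F \<longlonglongrightarrow> f" "G \<longlonglongrightarrow> g"
  shows "has_weak_deriv_on S f g"
  unfolding has_weak_deriv_on_iff
proof
  fix \<phi> assume \<phi>: "\<phi> \<in> test_functions S"
  have "(\<lambda>n. cinner (F n) (emb (deriv \<phi>))) \<longlonglongrightarrow> cinner f (emb (deriv \<phi>))"
    by (intro tendsto_intros assms)
  moreover have "(\<lambda>n. cinner (F n) (emb (deriv \<phi>))) \<longlonglongrightarrow> - cinner g (emb \<phi>)"
    using assms(1) \<phi> by (auto simp: has_weak_deriv_on_iff intro!: tendsto_intros assms(3))
  ultimately show "cinner f (emb (deriv \<phi>)) = - cinner g (emb \<phi>)" by (rule LIMSEQ_unique)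
qed

section \<open>The fundamental lemma of the calculus of variations\<close>

lemma AE_zero_if_interval_integrals_zero:
  fixes h :: "real \<Rightarrow> real"
  assumes h: "integrable lebesgue h" and z: "\<And>a b. (\<integral>x. indicator {a<..<b} x * h x \<partial>lebesgue) = 0"
  shows "AE x in lebesgue. h x = 0"
proof -
  \<comment> \<open>A Borel representative is used because the intervals generate the Borel sets
    only.\<close>
  obtain k where k [measurable]: "k \<in> borel_measurable lborel" and hk: "AE x in lborel. h x = k x"
    using completion_ex_borel_measurable_real[of h lborel] h by auto
  have hk': "AE x in lebesgue. h x = k x" using hk by (rule AE_completion)
  have "integrable lebesgue k"
    using integrable_cong_AE_imp[OF h measurable_completion[OF k]] hk' by (simp add: eq_commute)
  then have ki: "integrable lborel k" by (simp add: integrable_completion)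
  define I where "I A = (\<integral>x. indicat_real A x * k x \<partial>lborel)" for A
  have iA: "integrable lborel (\<lambda>x. indicat_real A x * k x)" if "A \<in> sets borel" for A
    using integrable_mult_indicator[OF _ ki, of A] that by simp
  have box: "I {a<..<b} = 0" for a b
  proof -
    have "I {a<..<b} = (\<integral>x. indicator {a<..<b} x * k x \<partial>lebesgue)"
      unfolding I_def by (intro integral_completion[symmetric]) measurable
    also have "\<dots> = (\<integral>x. indicator {a<..<b} x * h x \<partial>lebesgue)"
    proof (rule integral_cong_AE)
      have "h \<in> borel_measurable lebesgue" "k \<in> borel_measurable lebesgue"
        using h measurable_completion[OF k] by auto
      then show "(\<lambda>x. indicat_real {a<..<b} x * h x) \<in> borel_measurable lebesgue"
          "(\<lambda>x. indicat_real {a<..<b} x * k x) \<in> borel_measurable lebesgue"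
        by (auto intro!: borel_measurable_times borel_measurable_indicator)
    qed (use hk' in \<open>auto elim!: eventually_mono\<close>)
    finally show ?thesis using z by simp
  qed
  \<comment> \<open>The whole line is not one of the bounded intervals, but the complement step of
    the induction below needs it.\<close>
  have UN: "I UNIV = 0"
  proof -
    have "(\<lambda>n. I {- real n<..<real n}) \<longlonglongrightarrow> I UNIV"
      unfolding I_def
    proof (rule integral_dominated_convergence[where w = "\<lambda>x. norm (k x)"])
      show "AE x in lborel. (\<lambda>n. indicator {- real n<..<real n} x * k x) \<longlonglongrightarrow> indicator UNIV x * k x"
      proof (intro always_eventually allI tendsto_intros)
        fix x :: real
        obtain N where "\<bar>x\<bar> < real N" using reals_Archimedean2 by blast
        then have "\<forall>\<^sub>F n in sequentially. indicator UNIV x = (indicator {- real n<..<real n} x :: real)"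
          unfolding eventually_sequentially by (intro exI[of _ N]) (auto simp: indicator_def)
        then show "(\<lambda>n. indicator {- real n<..<real n} x) \<longlonglongrightarrow> (indicator UNIV x :: real)"
          by (rule Lim_transform_eventually[OF tendsto_const])
      qed
    qed (use ki in \<open>auto simp: indicator_def\<close>)
    then show ?thesis using box by (simp add: LIMSEQ_const_iff)
  qed
  \<comment> \<open>Open intervals are stable under intersection and generate the Borel sets, and
    the sets over which \<open>k\<close> integrates to 0 form a Dynkin system.\<close>
  let ?G = "range (\<lambda>(a, b). {a<..<b::real})"
  have "I A = 0" if A: "A \<in> sigma_sets UNIV ?G" for A
  proof -
    have G: "sigma_sets UNIV ?G = sets borel"
      using borel_eq_box[where 'a = real, unfolded box_real]
      by (metis sets_measure_of_conv Pow_UNIV subset_UNIV)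
    have "Int_stable ?G"
    proof (rule Int_stableI)
      fix A B assume "A \<in> ?G" "B \<in> ?G"
      then obtain a b c d where "A = {a<..<b}" "B = {c<..<d}" by auto
      then have "A \<inter> B = {max a c<..<min b d}" by auto
      then show "A \<inter> B \<in> ?G" by auto
    qed
    moreover have "?G \<subseteq> Pow UNIV" by simp
    ultimately show ?thesis using A
    proof (induction rule: sigma_sets_induct_disjoint)
      case (basic A)
      then show ?case using box by auto
    next
      case empty
      then show ?case by (simp add: I_def)
    next
      case (compl A)
      have "I (UNIV - A) = (\<integral>x. indicat_real UNIV x * k x - indicat_real A x * k x \<partial>lborel)"
        unfolding I_def by (intro Bochner_Integration.integral_cong) (auto simp: indicator_def)
      also have "\<dots> = I UNIV - I A"
        unfolding I_def using compl G by (intro Bochner_Integration.integral_diff iA) auto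
      finally show ?case using UN compl by simp
    next
      case (union A)
      have sets: "A i \<in> sets borel" for i using union(2) G by auto
      have "I (\<Union>i. A i) = (\<Sum>i. I (A i))"
        using lebesgue_integral_countable_add[of A lborel k] sets union(1) iA[of "\<Union>i. A i"]
        by (auto simp: I_def set_lebesgue_integral_def set_integrable_def disjoint_family_on_def)
      then show ?case using union(3) by simp
    qed
  qed
  then have "AE x in lborel. k x = 0"
    by (intro sigma_finite_measure.density_zero[OF lborel.sigma_finite_measure_axioms ki])
      (simp add: set_lebesgue_integral_def I_def borel_eq_box[where 'a = real, unfolded box_real])
  with hk have "AE x in lborel. h x = 0" by eventually_elim simp
  then show ?thesis by (rule AE_completion)
qed

lemma sets_lebesgue_open: "open S \<Longrightarrow> S \<in> sets lebesgue"
  by (simp add: sets_completionI_sets)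

lemma integrable_indicator_interval: "integrable lebesgue (indicat_real {a<..<b::real})"
proof -
  have "emeasure lborel {a<..<b} < \<infinity>"
    by (rule emeasure_bounded_finite) (rule bounded_subset[OF compact_imp_bounded[OF compact_Icc[of a b]]], auto)
  then have "integrable lborel (indicat_real {a<..<b})"
    by (intro integrable_real_indicator) auto
  then show ?thesis by (simp add: integrable_completion)
qed

text \<open>Bumps tend to the indicator. Because \<open>|g|\<close> is at most the square of
  \<open>|g|\<close> plus 1, the restriction of \<open>g\<close> to the interval provides an
  integrable majorant.\<close>

lemma integral_interval_eq_0:
  assumes g: "\<And>\<phi>. \<phi> \<in> test_functions S \<Longrightarrow> cinner g (emb \<phi>) = 0" and ab: "{a..b} \<subseteq> S"
  shows "(\<integral>x. indicat_real {a<..<b} x *\<^sub>R rep_L2 g x \<partial>lebesgue) = 0"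
proof -
  have "(\<lambda>k. \<integral>x. bump (real k) a b x *\<^sub>R rep_L2 g x \<partial>lebesgue) \<longlonglongrightarrow>
      (\<integral>x. indicat_real {a<..<b} x *\<^sub>R rep_L2 g x \<partial>lebesgue)"
  proof (rule integral_dominated_convergence[where
        w = "\<lambda>x. norm (rep_L2 (mult_op (indicator {a<..<b}) g) x * cnj (rep_L2 (mult_op (indicator {a<..<b}) g) x)) + indicator {a<..<b} x"])
    have m: "bump (real k) a b \<in> borel_measurable lebesgue" for k
      by (intro borel_measurable_integrable integrable_test[OF bump_test[OF _ order_refl]]) auto
    show "(\<lambda>x. bump (real k) a b x *\<^sub>R rep_L2 g x) \<in> borel_measurable lebesgue" for k
      by (intro borel_measurable_scaleR m measurable_rep_L2)
    show "(\<lambda>x. indicat_real {a<..<b} x *\<^sub>R rep_L2 g x) \<in> borel_measurable lebesgue"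
      by (intro borel_measurable_scaleR borel_measurable_indicator measurable_rep_L2) auto
    have "integrable lebesgue (indicat_real {a<..<b})"
      by (rule integrable_indicator_interval)
    then show "integrable lebesgue (\<lambda>x. norm (rep_L2 (mult_op (indicator {a<..<b}) g) x *
        cnj (rep_L2 (mult_op (indicator {a<..<b}) g) x)) + indicator {a<..<b} x)"
      by (intro Bochner_Integration.integrable_add integrable_norm integrable_cinner square_integrable_rep_L2)
    show "AE x in lebesgue. (\<lambda>k. bump (real k) a b x *\<^sub>R rep_L2 g x)
        \<longlonglongrightarrow> indicat_real {a<..<b} x *\<^sub>R rep_L2 g x"
      by (intro always_eventually allI tendsto_intros bump_tendsto)
    have "AE x in lebesgue. rep_L2 (mult_op (indicator {a<..<b}) g) x =
        complex_of_real (indicator {a<..<b} x) * rep_L2 g x"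
      by (intro AE_rep_mult_op indicator_L_infinity) auto
    then show "AE x in lebesgue. norm (bump (real k) a b x *\<^sub>R rep_L2 g x) \<le>
        norm (rep_L2 (mult_op (indicator {a<..<b}) g) x *
        cnj (rep_L2 (mult_op (indicator {a<..<b}) g) x)) + indicator {a<..<b} x" for k
    proof eventually_elim
      case (elim x)
      show ?case
      proof (cases "x \<in> {a<..<b}")
        case True
        have "norm (bump (real k) a b x *\<^sub>R rep_L2 g x) \<le> 1 * norm (rep_L2 g x)"
          unfolding norm_scaleR by (intro mult_right_mono) (auto simp: bump_nonneg bump_le_1)
        also have "\<dots> \<le> norm (rep_L2 g x) * norm (rep_L2 g x) + 1"
          using sum_squares_bound[of "norm (rep_L2 g x)" 1]
          by (simp add: power2_eq_square) (smt (verit) norm_ge_zero)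
        finally show ?thesis using True elim by (simp add: norm_mult)
      qed (simp add: bump_outside)
    qed
  qed
  moreover have "(\<integral>x. bump (real k) a b x *\<^sub>R rep_L2 g x \<partial>lebesgue) = 0" for k
    using bump_test[of "real k" a b S] ab g by (simp add: cinner_emb[symmetric])
  ultimately show ?thesis by (simp add: LIMSEQ_const_iff)
qed

text \<open>Vanishing interval integrals settle the claim on an interval whose closure lies in
  \<open>S\<close>; countably many of these, with rational endpoints, cover
  \<open>S\<close>.\<close>

lemma fundamental_lemma:
  assumes S: "open S" and g: "\<And>\<phi>. \<phi> \<in> test_functions S \<Longrightarrow> cinner g (emb \<phi>) = 0"
  shows "AE x in lebesgue. x \<in> S \<longrightarrow> rep_L2 g x = 0"
proof -
  have local: "AE x in lebesgue. x \<in> {p<..<q} \<longrightarrow> rep_L2 g x = 0" if pq: "{p..q} \<subseteq> S" for p q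
  proof -
    let ?h = "\<lambda>x. indicat_real {p<..<q} x *\<^sub>R rep_L2 g x"
    have i: "integrable lebesgue ?h"
    proof -
      have *: "square_integrable (\<lambda>x. complex_of_real (indicator {p<..<q} x))"
      proof -
        have "(cmod (complex_of_real (indicator {p<..<q} x)))\<^sup>2 = indicat_real {p<..<q} x" for x
          by (simp split: split_indicator)
        then show ?thesis
          using borel_measurable_integrable[OF integrable_indicator_interval[of p q]]
          unfolding square_integrable_def by (simp only: integrable_indicator_interval) simp
      qed
      show ?thesis
        using integrable_cinner[OF square_integrable_rep_L2[of g] *]
        by (simp add: scaleR_conv_of_real mult.commute)
    qed
    have z: "(\<integral>x. indicat_real {a<..<b} x *\<^sub>R ?h x \<partial>lebesgue) = 0" for a b
    proof -
      have "(\<integral>x. indicat_real {a<..<b} x *\<^sub>R ?h x \<partial>lebesgue) =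
          (\<integral>x. indicat_real {max a p<..<min b q} x *\<^sub>R rep_L2 g x \<partial>lebesgue)"
        by (intro Bochner_Integration.integral_cong) (auto simp: indicator_def)
      also have "\<dots> = 0" by (rule integral_interval_eq_0[OF g]) (use pq in auto)
      finally show ?thesis .
    qed
    have zi: "integrable lebesgue (\<lambda>x. indicat_real {a<..<b} x *\<^sub>R ?h x)" for a b
      by (intro integrable_mult_indicator i) auto
    have "AE x in lebesgue. Re (?h x) = 0"
    proof (rule AE_zero_if_interval_integrals_zero)
      show "integrable lebesgue (\<lambda>x. Re (?h x))" by (rule integrable_Re[OF i])
      show "(\<integral>x. indicat_real {a<..<b} x * Re (?h x) \<partial>lebesgue) = 0" for a b
        using integral_Re[OF zi[of a b]] z[of a b] by (simp add: mult.assoc)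
    qed
    moreover have "AE x in lebesgue. Im (?h x) = 0"
    proof (rule AE_zero_if_interval_integrals_zero)
      show "integrable lebesgue (\<lambda>x. Im (?h x))" by (rule integrable_Im[OF i])
      show "(\<integral>x. indicat_real {a<..<b} x * Im (?h x) \<partial>lebesgue) = 0" for a b
        using integral_Im[OF zi[of a b]] z[of a b] by (simp add: mult.assoc)
    qed
    ultimately show ?thesis by eventually_elim (auto simp: complex_eq_iff)
  qed
  have "AE x in lebesgue. \<forall>pq\<in>\<rat> \<times> \<rat>. {fst pq..snd pq} \<subseteq> S \<longrightarrow> x \<in> {fst pq<..<snd pq} \<longrightarrow> rep_L2 g x = 0"
    by (intro AE_ball_countable' local AE_impI) (auto simp: countable_rat)
  then show ?thesis
  proof eventually_elim
    case (elim x)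
    show ?case
    proof
      assume "x \<in> S"
      then obtain e where e: "e > 0" "ball x e \<subseteq> S" using S openE by blast
      obtain p where p: "p \<in> \<rat>" "x - e < p" "p < x" using Rats_dense_in_real[of "x - e" x] e by auto
      obtain q where q: "q \<in> \<rat>" "x < q" "q < x + e" using Rats_dense_in_real[of x "x + e"] e by auto
      have "{p..q} \<subseteq> ball x e" using p q by (auto simp: dist_real_def)
      then show "rep_L2 g x = 0" using elim p q e by force
    qed
  qed
qed

lemma has_weak_deriv_on_AE_unique:
  assumes "open S" "has_weak_deriv_on S f g" "has_weak_deriv_on S f g'"
  shows "AE x in lebesgue. x \<in> S \<longrightarrow> rep_L2 g x = rep_L2 g' x"
proof -
  have "AE x in lebesgue. x \<in> S \<longrightarrow> rep_L2 (g - g') x = 0"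
    using assms(2,3) by (intro fundamental_lemma assms(1)) (simp add: has_weak_deriv_on_iff cinner_algebra)
  then show ?thesis using AE_rep_diff[of g g'] by eventually_elim auto
qed

lemma weak_deriv_eq:
  assumes "open S" "g \<in> L2_on S" "has_weak_deriv_on S f g"
  shows "weak_deriv S f = g"
  unfolding weak_deriv_def
proof (rule the_equality)
  fix g' assume g': "g' \<in> L2_on S \<and> has_weak_deriv_on S f g'"
  then have "AE x in lebesgue. x \<in> S \<longrightarrow> rep_L2 g' x = rep_L2 g x"
    using assms by (intro has_weak_deriv_on_AE_unique[of S f]) auto
  moreover have "AE x in lebesgue. x \<notin> S \<longrightarrow> rep_L2 g' x = 0" "AE x in lebesgue. x \<notin> S \<longrightarrow> rep_L2 g x = 0"
    using g' assms(2) by (simp_all add: mem_L2_on)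
  ultimately have "AE x in lebesgue. rep_L2 g' x = rep_L2 g x"
    by eventually_elim auto
  then show "g' = g" by (rule L2_eqI)
qed (use assms in auto)

section \<open>Primitives of square-integrable functions\<close>

definition step_fun :: "real \<Rightarrow> real \<Rightarrow> real" where
  "step_fun x t = indicator {0<..x} t - indicator {x<..0} t"

text \<open>The oriented integral of \<open>g\<close> from 0 to \<open>x\<close>. Written with the
  kernel \<open>step_fun\<close>, both signs of \<open>x\<close> are covered by one formula, to
  which Fubini's theorem applies.\<close>

definition prim :: "L2 \<Rightarrow> real \<Rightarrow> complex" where
  "prim g x = (\<integral>t. step_fun x t *\<^sub>R rep_L2 g t \<partial>lebesgue)"

lemma step_fun_diff: "x \<le> y \<Longrightarrow> step_fun y t - step_fun x t = indicator {x<..y} t"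
  by (auto simp: step_fun_def indicator_def)

lemma integrable_indicator_Ioc: "integrable lebesgue (indicat_real {a<..b::real})"
proof -
  have "integrable lborel (indicat_real {a<..b})"
    using emeasure_lborel_Ioc[of a b] by (cases "a \<le> b") (auto intro!: integrable_real_indicator)
  then show ?thesis by (simp add: integrable_completion)
qed

lemma square_integrable_indicator_Ioc: "square_integrable (\<lambda>x. complex_of_real (indicator {a<..b} x))"
proof -
  have "(cmod (complex_of_real (indicator {a<..b} x)))\<^sup>2 = indicat_real {a<..b} x" for x
    by (simp split: split_indicator)
  then show ?thesis
    using borel_measurable_integrable[OF integrable_indicator_Ioc[of a b]]
    unfolding square_integrable_def by (simp only: integrable_indicator_Ioc) simp
qed

definition box_L2 :: "real \<Rightarrow> real \<Rightarrow> L2" where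
  "box_L2 a b = abs_L2 (\<lambda>x. complex_of_real (indicator {a<..b} x))"

lemma AE_rep_box: "AE x in lebesgue. rep_L2 (box_L2 a b) x = complex_of_real (indicator {a<..b} x)"
  unfolding box_L2_def by (rule AE_rep_abs_L2[OF square_integrable_indicator_Ioc])

lemma integrable_rep_Ioc: "integrable lebesgue (\<lambda>x. indicat_real {a<..b} x *\<^sub>R rep_L2 g x)"
  using integrable_cinner[OF square_integrable_rep_L2[of g] square_integrable_indicator_Ioc[of a b]]
  by (simp add: scaleR_conv_of_real mult.commute)

lemma cinner_box: "cinner g (box_L2 a b) = (\<integral>x. indicat_real {a<..b} x *\<^sub>R rep_L2 g x \<partial>lebesgue)"
  unfolding cinner_L2.rep_eq
proof (rule integral_cong_AE)
  show "AE x in lebesgue. rep_L2 g x * cnj (rep_L2 (box_L2 a b) x) = indicat_real {a<..b} x *\<^sub>R rep_L2 g x"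
    using AE_rep_box[of a b] by eventually_elim (simp add: scaleR_conv_of_real mult.commute)
qed (auto intro!: borel_measurable_integrable integrable_cinner square_integrable_rep_L2 integrable_rep_Ioc)

lemma norm_box: "a \<le> b \<Longrightarrow> (norm (box_L2 a b))\<^sup>2 = b - a"
proof -
  assume ab: "a \<le> b"
  have "(norm (box_L2 a b))\<^sup>2 = (\<integral>x. indicat_real {a<..b} x \<partial>lebesgue)"
    unfolding norm_L2_square
    by (rule integral_cong_AE)
      (use AE_rep_box[of a b] borel_measurable_integrable[OF integrable_indicator_Ioc[of a b]] in
        \<open>auto elim!: eventually_mono split: split_indicator\<close>)
  also have "\<dots> = b - a"
    using ab by (simp add: measure_completion)
  finally show ?thesis .
qed

lemma integrable_step: "integrable lebesgue (\<lambda>t. step_fun x t *\<^sub>R rep_L2 g t)"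
  unfolding step_fun_def scaleR_diff_left
  by (intro Bochner_Integration.integrable_diff integrable_rep_Ioc)

lemma prim_diff: "x \<le> y \<Longrightarrow> prim g y - prim g x = (\<integral>t. indicat_real {x<..y} t *\<^sub>R rep_L2 g t \<partial>lebesgue)"
  unfolding prim_def
  by (simp add: Bochner_Integration.integral_diff[symmetric] integrable_step step_fun_diff
      flip: scaleR_diff_left)

text \<open>Cauchy-Schwarz against the indicator of the interval between \<open>x\<close> and
  \<open>y\<close>, whose norm is the square root of the length.\<close>

lemma prim_bound: "cmod (prim g y - prim g x) \<le> norm g * sqrt \<bar>y - x\<bar>"
proof -
  have *: "cmod (prim g y - prim g x) \<le> norm g * sqrt \<bar>y - x\<bar>" if "x \<le> y" for x y
    using cinner_norm_bound[of g "box_L2 x y"] that norm_box[OF that]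
    by (simp add: prim_diff cinner_box real_sqrt_unique)
  show ?thesis
    using *[of x y] *[of y x] by (cases "x \<le> y") (auto simp: norm_minus_commute abs_minus_commute)
qed

lemma prim_continuous: "continuous_on A (prim g)"
proof (rule continuous_at_imp_continuous_on, intro ballI)
  fix x
  have "((\<lambda>y. norm g * sqrt \<bar>y - x\<bar>) \<longlongrightarrow> norm g * sqrt \<bar>x - x\<bar>) (at x)"
    by (intro tendsto_intros)
  then have "((\<lambda>y. prim g y - prim g x) \<longlongrightarrow> 0) (at x)"
    by (intro Lim_null_comparison[of "\<lambda>y. prim g y - prim g x" "\<lambda>y. norm g * sqrt \<bar>y - x\<bar>"])
      (simp_all add: prim_bound)
  then show "isCont (prim g) x" unfolding isCont_def by (rule LIM_zero_cancel)
qed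

lemma prim_has_derivative:
  assumes S: "open S" "is_interval S" and v: "continuous_on S v"
    and gv: "AE x in lebesgue. x \<in> S \<longrightarrow> rep_L2 g x = v x" and x: "x \<in> S"
  shows "(prim g has_vector_derivative v x) (at x)"
proof -
  obtain e where e: "e > 0" "cball x e \<subseteq> S" using S(1) x open_contains_cball by blast
  define a b where "a = x - e" and "b = x + e"
  have ab: "{a..b} \<subseteq> S" using e by (auto simp: a_def b_def dist_real_def subset_iff abs_le_iff)
  have vab: "continuous_on {a..b} v" using v ab by (rule continuous_on_subset)
  have eq: "prim g y = prim g a + integral {a..y} v" if y: "y \<in> {a..b}" for y
  proof -
    have vy: "continuous_on {a..y} v" by (rule continuous_on_subset[OF vab]) (use y in auto)
    have "prim g y - prim g a = (\<integral>t. indicat_real {a<..y} t *\<^sub>R rep_L2 g t \<partial>lebesgue)"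
      using y by (intro prim_diff) auto
    also have "\<dots> = (\<integral>t. indicat_real {a..y} t *\<^sub>R v t \<partial>lebesgue)"
    proof (rule integral_cong_AE)
      have "integrable lborel (\<lambda>t. indicat_real {a..y} t *\<^sub>R v t)"
        by (intro borel_integrable_compact vy compact_Icc)
      then show "(\<lambda>t. indicat_real {a..y} t *\<^sub>R v t) \<in> borel_measurable lebesgue"
        by (intro measurable_completion) auto
      have "AE t in lebesgue. t \<noteq> a" by (intro AE_completion AE_lborel_singleton)
      with gv show "AE t in lebesgue. indicat_real {a<..y} t *\<^sub>R rep_L2 g t = indicat_real {a..y} t *\<^sub>R v t"
      proof eventually_elim
        case (elim t)
        then show ?case using ab y subsetD[OF ab, of t] by (auto simp: indicator_def)
      qed
    qed (rule borel_measurable_integrable[OF integrable_rep_Ioc])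
    also have "\<dots> = (\<integral>t. indicat_real {a..y} t *\<^sub>R v t \<partial>lborel)"
    proof (rule integral_completion)
      have "integrable lborel (\<lambda>t. indicat_real {a..y} t *\<^sub>R v t)"
        by (intro borel_integrable_compact vy compact_Icc)
      then show "(\<lambda>t. indicat_real {a..y} t *\<^sub>R v t) \<in> borel_measurable lborel" by auto
    qed
    also have "\<dots> = integral {a..y} v"
      using set_borel_integral_eq_integral(2)[of "{a..y}" v]
        borel_integrable_compact[OF compact_Icc vy]
      by (simp add: set_lebesgue_integral_def set_integrable_def)
    finally show ?thesis by (simp add: algebra_simps)
  qed
  have "((\<lambda>y. integral {a..y} v) has_vector_derivative v x) (at x within {a..b})"
    using e by (intro integral_has_vector_derivative vab) (auto simp: a_def b_def)
  then have "((\<lambda>y. prim g a + integral {a..y} v) has_vector_derivative v x) (at x within {a..b})"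
    by (auto intro!: derivative_eq_intros)
  then have "(prim g has_vector_derivative v x) (at x within {a..b})"
  proof (rule has_vector_derivative_transform[rotated 2])
    show "x \<in> {a..b}" using e by (simp add: a_def b_def)
  qed (rule eq)
  moreover have "at x within {a..b} = at x"
    using e by (intro at_within_interior) (auto simp: a_def b_def)
  ultimately show ?thesis by simp
qed

lemma test_support_interval:
  assumes "\<phi> \<in> test_functions S" "is_interval S" "S \<noteq> {}"
  obtains p q where "p \<le> q" "{p..q} \<subseteq> S" "\<And>x. x \<notin> {p..q} \<Longrightarrow> \<phi> x = 0"
proof -
  obtain K where K: "compact K" "K \<subseteq> S" "\<And>x. x \<notin> K \<Longrightarrow> \<phi> x = 0"
    using assms(1) by (auto simp: test_functions_iff)
  show thesis
  proof (cases "K = {}")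
    case True
    then show thesis using that[of "SOME x. x \<in> S" "SOME x. x \<in> S"] K assms(3) some_in_eq by force
  next
    case False
    obtain p where p: "p \<in> K" "\<And>x. x \<in> K \<Longrightarrow> p \<le> x" using compact_attains_inf[OF K(1) False] by blast
    obtain q where q: "q \<in> K" "\<And>x. x \<in> K \<Longrightarrow> x \<le> q" using compact_attains_sup[OF K(1) False] by blast
    show thesis
    proof (rule that[of p q])
      show "{p..q} \<subseteq> S" using p(1) q(1) K(2) mem_is_interval_1_I[OF assms(2), of p q] by force
    qed (use p q K(3) in force)+
  qed
qed

lemma test_FTC:
  assumes "smooth F" "a \<le> b"
  shows "(\<integral>x. deriv F x * indicator {a..b} x \<partial>lborel) = F b - F a"
  using assms smooth_continuous[OF smooth_deriv[OF assms(1)], of UNIV]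
  by (intro integral_FTC_Icc_real smooth_DERIV) (auto simp: continuous_on_eq_continuous_at)

text \<open>The antiderivative that vanishes to the left of the support of \<open>\<theta>\<close>
  is constant to the right of it, with value the total integral, which is 0. So it is again a test
  function.\<close>

lemma test_antiderivative:
  assumes \<theta>: "\<theta> \<in> test_functions S" "(\<integral>x. \<theta> x \<partial>lborel) = 0" and S: "is_interval S" "S \<noteq> {}"
  obtains \<phi> where "\<phi> \<in> test_functions S" "deriv \<phi> = \<theta>"
proof -
  obtain p q where pq: "p \<le> q" "{p..q} \<subseteq> S" "\<And>x. x \<notin> {p..q} \<Longrightarrow> \<theta> x = 0"
    using test_support_interval[OF \<theta>(1) S] by metis
  have sm: "smooth \<theta>" using \<theta>(1) by (rule test_smooth)
  have "\<exists>F. \<forall>x. -\<infinity> < ereal x \<longrightarrow> ereal x < \<infinity> \<longrightarrow> (F has_vector_derivative \<theta> x) (at x)"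
    using smooth_continuous[OF sm, of UNIV]
    by (intro einterval_antiderivative) (auto simp: continuous_on_eq_continuous_at)
  then obtain F where F: "\<And>x. (F has_real_derivative \<theta> x) (at x)"
    by (auto simp: has_real_derivative_iff_has_vector_derivative)
  define \<phi> where "\<phi> x = F x - F p" for x
  have D: "(\<phi> has_real_derivative \<theta> x) (at x)" for x
    unfolding \<phi>_def using F[of x] by (auto intro!: derivative_eq_intros)
  then have d: "deriv \<phi> = \<theta>" using DERIV_imp_deriv by blast
  have sm\<phi>: "smooth \<phi>"
    by (rule smooth_DERIV_coinduct[where P = "\<lambda>h. h = \<phi> \<or> smooth h"])
      (use D sm in \<open>auto intro: smooth_deriv smooth_DERIV\<close>)
  have eq: "\<phi> b = \<phi> a" if "a \<le> p" "q \<le> b" for a b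
  proof -
    have "\<phi> b - \<phi> a = (\<integral>x. \<theta> x * indicator {a..b} x \<partial>lborel)"
      using test_FTC[OF sm\<phi>, of a b] that pq(1) by (simp add: d)
    also have "\<dots> = (\<integral>x. \<theta> x \<partial>lborel)"
      by (intro Bochner_Integration.integral_cong) (use that pq(3) in \<open>force simp: indicator_def\<close>)+
    finally show ?thesis using \<theta>(2) by simp
  qed
  have "\<phi> x = 0" if "x \<notin> {p..q}" for x
    using eq[of x q] eq[of p q] eq[of p x] that by (cases "x < p") (auto simp: \<phi>_def)
  then have "\<phi> \<in> test_functions S"
    using sm\<phi> pq by (auto simp: test_functions_iff intro!: exI[of _ "{p..q}"])
  with d show thesis by (rule that[rotated])
qed

text \<open>The inner integral that Fubini's theorem leaves in \<open>prim_weak_deriv\<close>. As a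
  function of \<open>x\<close> the kernel is the indicator of \<open>x \<ge> t\<close> for positive
  \<open>t\<close> and minus that of \<open>x < t\<close> otherwise; in both cases the far endpoint
  contributes 0.\<close>

lemma test_tail:
  assumes "\<phi> \<in> test_functions UNIV"
  shows "(\<integral>x. deriv \<phi> x * step_fun x t \<partial>lborel) = - \<phi> t"
proof -
  obtain p q where pq: "p \<le> q" "\<And>x. x \<notin> {p..q} \<Longrightarrow> \<phi> x = 0"
    using test_support_interval[OF assms] by auto
  have d0: "deriv \<phi> x = 0" if "x \<notin> {p..q}" for x
    by (rule deriv_eq_0_outside[OF closed_atLeastAtMost pq(2) that])
  have sm: "smooth \<phi>" using assms by (rule test_smooth)
  define R where "R = \<bar>p\<bar> + \<bar>q\<bar> + \<bar>t\<bar> + 1"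
  have R: "\<phi> R = 0" "\<phi> (- R) = 0" "- R < t" "t < R" "- R < p" "q < R"
    using pq(1) by (auto simp: R_def intro!: pq(2))
  show ?thesis
  proof (cases "0 < t")
    case True
    have "(\<integral>x. deriv \<phi> x * step_fun x t \<partial>lborel) = (\<integral>x. deriv \<phi> x * indicator {t..R} x \<partial>lborel)"
      by (intro Bochner_Integration.integral_cong)
        (use True R d0 in \<open>force simp: step_fun_def indicator_def\<close>)+
    also have "\<dots> = - \<phi> t" using test_FTC[OF sm, of t R] R by simp
    finally show ?thesis .
  next
    case False
    have "(\<integral>x. deriv \<phi> x * step_fun x t \<partial>lborel) = (\<integral>x. - (deriv \<phi> x * indicator {-R..t} x) \<partial>lborel)"
    proof (rule integral_cong_AE)
      have m: "deriv \<phi> \<in> borel_measurable lborel"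
        using borel_measurable_continuous_onI[OF smooth_continuous[OF smooth_deriv[OF sm]]] by simp
      have "(\<lambda>x. step_fun x t) \<in> borel_measurable lborel"
        using False by (simp add: step_fun_def indicator_def)
      with m show "(\<lambda>x. deriv \<phi> x * step_fun x t) \<in> borel_measurable lborel" by simp
      from m show "(\<lambda>x. - (deriv \<phi> x * indicator {-R..t} x)) \<in> borel_measurable lborel" by simp
      show "AE x in lborel. deriv \<phi> x * step_fun x t = - (deriv \<phi> x * indicator {-R..t} x)"
        \<comment> \<open>At \<open>x = t\<close> the kernel is 0 while the closed interval of the
          fundamental theorem contains the point.\<close>
        using AE_lborel_singleton[of t]
      proof eventually_elim
        case (elim x)
        then show ?case
          using False R d0[of x] by (auto simp: step_fun_def indicator_def)
      qed
    qed
    also have "\<dots> = - \<phi> t" using test_FTC[OF sm, of "-R" t] R by simp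
    finally show ?thesis .
  qed
qed

lemma prim_weak_deriv:
  assumes "\<phi> \<in> test_functions UNIV"
  shows "(\<integral>x. deriv \<phi> x *\<^sub>R prim g x \<partial>lebesgue) = - (\<integral>x. \<phi> x *\<^sub>R rep_L2 g x \<partial>lebesgue)"
proof -
  obtain p q where pq: "p \<le> q" "\<And>x. x \<notin> {p..q} \<Longrightarrow> \<phi> x = 0"
    using test_support_interval[OF assms] by auto
  have d0: "deriv \<phi> x = 0" if "x \<notin> {p..q}" for x
    by (rule deriv_eq_0_outside[OF closed_atLeastAtMost pq(2) that])
  have sm: "smooth \<phi>" using assms by (rule test_smooth)
  \<comment> \<open>The interval \<open>[-R, R]\<close> contains the support of
    \<open>\<phi>\<close> and also 0, the base point of \<open>prim\<close>.\<close>
  define R where "R = \<bar>p\<bar> + \<bar>q\<bar>"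
  have R: "{p..q} \<subseteq> {-R..R}" by (auto simp: R_def)
  have cd: "continuous_on UNIV (deriv \<phi>)" by (intro smooth_continuous smooth_deriv sm)
  have md [measurable]: "deriv \<phi> \<in> borel_measurable borel" by (rule borel_measurable_continuous_onI[OF cd])
  have m\<phi> [measurable]: "\<phi> \<in> borel_measurable borel"
    by (rule borel_measurable_continuous_onI[OF smooth_continuous[OF sm]])
  have "bounded (deriv \<phi> ` {-R..R})"
    by (intro compact_imp_bounded compact_continuous_image continuous_on_subset[OF cd]) auto
  then obtain B where B0: "\<forall>x\<in>{-R..R}. \<bar>deriv \<phi> x\<bar> \<le> B" by (auto simp: bounded_iff)
  have B: "\<bar>deriv \<phi> x\<bar> \<le> \<bar>B\<bar> * indicator {-R..R} x" for x
  proof (cases "x \<in> {-R..R}")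
    case True
    then show ?thesis using bspec[OF B0 True] by simp
  next
    case False
    then have "x \<notin> {p..q}" using R by blast
    then show ?thesis using d0 by simp
  qed
  have gm: "(\<lambda>x. Re (rep_L2 g x)) \<in> borel_measurable (completion lborel)"
      "(\<lambda>x. Im (rep_L2 g x)) \<in> borel_measurable (completion lborel)"
    using measurable_rep_L2[of g] by simp_all
  \<comment> \<open>A Borel representative of \<open>g\<close>, since Fubini's theorem is applied to
    two copies of \<open>lborel\<close>.\<close>
  obtain vr where vr [measurable]: "vr \<in> borel_measurable lborel" and vr': "AE x in lborel. Re (rep_L2 g x) = vr x"
    using completion_ex_borel_measurable_real[OF gm(1)] by blast
  obtain vi where vi [measurable]: "vi \<in> borel_measurable lborel" and vi': "AE x in lborel. Im (rep_L2 g x) = vi x"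
    using completion_ex_borel_measurable_real[OF gm(2)] by blast
  define v where "v x = Complex (vr x) (vi x)" for x
  have v_alt: "v = (\<lambda>x. complex_of_real (vr x) + \<i> * complex_of_real (vi x))"
    by (simp add: v_def fun_eq_iff complex_eq_iff)
  have v [measurable]: "v \<in> borel_measurable borel" unfolding v_alt by simp
  have gv: "AE x in lborel. rep_L2 g x = v x"
    using vr' vi' by eventually_elim (simp add: v_def complex_eq_iff)
  have gv': "AE x in lebesgue. rep_L2 g x = v x" using gv by (rule AE_completion)
  have step_m [measurable]: "(\<lambda>z. step_fun (fst z) (snd z)) \<in> borel_measurable (borel \<Otimes>\<^sub>M borel)"
  proof -
    have "(\<lambda>z. step_fun (fst z) (snd z)) = (\<lambda>z. (if 0 < snd z \<and> snd z \<le> fst z then 1 else 0) -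
        (if fst z < snd z \<and> snd z \<le> 0 then 1 else (0::real)))"
      by (auto simp: step_fun_def indicator_def fun_eq_iff)
    also have "\<dots> \<in> borel_measurable (borel \<Otimes>\<^sub>M borel)" by measurable
    finally show ?thesis .
  qed
  have step_m1 [measurable]: "step_fun x \<in> borel_measurable borel" for x
    unfolding step_fun_def by measurable
  have prim_v: "prim g x = (\<integral>t. step_fun x t *\<^sub>R v t \<partial>lborel)" for x
  proof -
    have "prim g x = (\<integral>t. step_fun x t *\<^sub>R v t \<partial>lebesgue)"
      unfolding prim_def
    proof (rule integral_cong_AE)
      have "(\<lambda>t. step_fun x t *\<^sub>R v t) \<in> borel_measurable lborel" by simp
      then show "(\<lambda>t. step_fun x t *\<^sub>R v t) \<in> borel_measurable lebesgue" by (rule measurable_completion)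
    qed (use gv' in \<open>auto elim!: eventually_mono intro!: borel_measurable_integrable integrable_step\<close>)
    also have "\<dots> = (\<integral>t. step_fun x t *\<^sub>R v t \<partial>lborel)" by (rule integral_completion) simp
    finally show ?thesis .
  qed
  have iv: "integrable lborel (\<lambda>t. indicat_real {-R<..R} t *\<^sub>R v t)"
  proof -
    have "integrable lebesgue (\<lambda>t. indicat_real {-R<..R} t *\<^sub>R v t)"
    proof (rule integrable_cong_AE_imp[OF integrable_rep_Ioc[of "-R" R g]])
      have "(\<lambda>t. indicat_real {-R<..R} t *\<^sub>R v t) \<in> borel_measurable lborel" by simp
      then show "(\<lambda>t. indicat_real {-R<..R} t *\<^sub>R v t) \<in> borel_measurable lebesgue" by (rule measurable_completion)
    qed (use gv' in \<open>auto elim!: eventually_mono\<close>)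
    then show ?thesis by (subst (asm) integrable_completion) simp_all
  qed
  define F where "F x t = (deriv \<phi> x * step_fun x t) *\<^sub>R v t" for x t
  have Fm: "(\<lambda>(x, t). F x t) \<in> borel_measurable (lborel \<Otimes>\<^sub>M lborel)"
    unfolding F_def case_prod_beta by measurable
  \<comment> \<open>For \<open>x\<close> in \<open>[-R, R]\<close> the kernel lives on
    \<open>(-R, R]\<close>, elsewhere \<open>deriv \<phi>\<close> vanishes. So a product of one
    function of \<open>x\<close> and one of \<open>t\<close> dominates, which gives integrability on
    the plane.\<close>
  have F_le: "norm (F x t) \<le> (\<bar>B\<bar> * indicator {-R..R} x) * norm (indicat_real {-R<..R} t *\<^sub>R v t)" for x t
  proof (cases "x \<in> {-R..R}")
    case True
    have "\<bar>step_fun x t\<bar> \<le> indicator {-R<..R} t" using True by (auto simp: step_fun_def indicator_def)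
    then have "\<bar>deriv \<phi> x\<bar> * \<bar>step_fun x t\<bar> \<le> (\<bar>B\<bar> * indicator {-R..R} x) * indicator {-R<..R} t"
      using B[of x] by (intro mult_mono) auto
    then show ?thesis unfolding F_def norm_scaleR abs_mult
      by (simp add: mult_right_mono mult.assoc[symmetric])
  next
    case False
    then show ?thesis using B[of x] by (simp add: F_def)
  qed
  have Fi: "integrable lborel (F x)" for x
  proof (rule Bochner_Integration.integrable_bound)
    show "integrable lborel (\<lambda>t. (\<bar>B\<bar> * indicator {-R..R} x) * norm (indicat_real {-R<..R} t *\<^sub>R v t))"
      by (intro integrable_mult_right integrable_norm iv)
    show "F x \<in> borel_measurable lborel" unfolding F_def by simp
  qed (auto intro!: always_eventually order_trans[OF F_le])
  have "integrable (lborel \<Otimes>\<^sub>M lborel) (\<lambda>(x, t). F x t)"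
  proof (rule lborel_pair.Fubini_integrable[OF Fm])
    define I where "I = (\<integral>t. norm (indicat_real {-R<..R} t *\<^sub>R v t) \<partial>lborel)"
    show "integrable lborel (\<lambda>x. \<integral>t. norm (case (x, t) of (x, t) \<Rightarrow> F x t) \<partial>lborel)"
    proof (rule Bochner_Integration.integrable_bound)
      show "integrable lborel (\<lambda>x. indicat_real {-R..R} x *\<^sub>R (\<bar>B\<bar> * I))"
        by (rule borel_integrable_compact) auto
      show "(\<lambda>x. \<integral>t. norm (case (x, t) of (x, t) \<Rightarrow> F x t) \<partial>lborel) \<in> borel_measurable lborel"
        using Fm by measurable
      have "(\<integral>t. norm (F x t) \<partial>lborel) \<le> indicator {-R..R} x * (\<bar>B\<bar> * I)" for x
      proof -
        have "(\<integral>t. norm (F x t) \<partial>lborel) \<le>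
            (\<integral>t. (\<bar>B\<bar> * indicator {-R..R} x) * norm (indicat_real {-R<..R} t *\<^sub>R v t) \<partial>lborel)"
          by (intro integral_mono integrable_norm Fi integrable_mult_right iv F_le)
        also have "\<dots> = indicator {-R..R} x * (\<bar>B\<bar> * I)" by (simp add: I_def)
        finally show ?thesis .
      qed
      then have "\<bar>\<integral>t. norm (F x t) \<partial>lborel\<bar> \<le> \<bar>indicator {-R..R} x * (\<bar>B\<bar> * I)\<bar>" for x
        using Bochner_Integration.integral_nonneg[of lborel "\<lambda>t. norm (F x t)"]
        by (metis abs_ge_self abs_of_nonneg norm_ge_zero order_trans)
      then show "AE x in lborel. norm (\<integral>t. norm (case (x, t) of (x, t) \<Rightarrow> F x t) \<partial>lborel)
          \<le> norm (indicat_real {-R..R} x *\<^sub>R (\<bar>B\<bar> * I))"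
        by (simp only: prod.case real_norm_def real_scaleR_def) simp
    qed
  qed (use Fi in auto)
  from lborel_pair.Fubini_integral[OF this]
  have "(\<integral>x. \<integral>t. F x t \<partial>lborel \<partial>lborel) = (\<integral>t. \<integral>x. F x t \<partial>lborel \<partial>lborel)" by simp
  also have "\<dots> = (\<integral>t. - (\<phi> t *\<^sub>R v t) \<partial>lborel)"
  proof (intro Bochner_Integration.integral_cong refl)
    fix t
    have "integrable lborel (\<lambda>x. deriv \<phi> x * step_fun x t)"
    proof (rule Bochner_Integration.integrable_bound)
      show "integrable lborel (\<lambda>x. indicat_real {-R..R} x *\<^sub>R \<bar>B\<bar>)"
        by (rule borel_integrable_compact) auto
      show "(\<lambda>x. deriv \<phi> x * step_fun x t) \<in> borel_measurable lborel"
        using measurable_Pair1[OF step_m, of t] by simp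
      have "\<bar>deriv \<phi> x\<bar> * \<bar>step_fun x t\<bar> \<le> (\<bar>B\<bar> * indicator {-R..R} x) * 1" for x
        by (intro mult_mono B) (auto simp: step_fun_def indicator_def)
      then show "AE x in lborel. norm (deriv \<phi> x * step_fun x t) \<le> norm (indicat_real {-R..R} x *\<^sub>R \<bar>B\<bar>)"
        by (simp add: abs_mult mult.commute)
    qed
    then show "(\<integral>x. F x t \<partial>lborel) = - (\<phi> t *\<^sub>R v t)"
      unfolding F_def by (simp add: test_tail[OF assms])
  qed
  also have "\<dots> = - (\<integral>t. \<phi> t *\<^sub>R v t \<partial>lebesgue)"
    by (simp add: integral_completion)
  also have "(\<integral>t. \<phi> t *\<^sub>R v t \<partial>lebesgue) = (\<integral>t. \<phi> t *\<^sub>R rep_L2 g t \<partial>lebesgue)"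
  proof (rule integral_cong_AE)
    have m: "\<phi> \<in> borel_measurable lebesgue" "v \<in> borel_measurable lebesgue"
      using measurable_completion[of \<phi> lborel borel] measurable_completion[of v lborel borel] by simp_all
    then show "(\<lambda>t. \<phi> t *\<^sub>R v t) \<in> borel_measurable lebesgue"
        "(\<lambda>t. \<phi> t *\<^sub>R rep_L2 g t) \<in> borel_measurable lebesgue"
      by simp_all
  qed (use gv' in \<open>auto elim!: eventually_mono\<close>)
  finally have 1: "(\<integral>x. \<integral>t. F x t \<partial>lborel \<partial>lborel) = - (\<integral>t. \<phi> t *\<^sub>R rep_L2 g t \<partial>lebesgue)" .
  have "(\<integral>x. \<integral>t. F x t \<partial>lborel \<partial>lborel) = (\<integral>x. deriv \<phi> x *\<^sub>R prim g x \<partial>lborel)"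
    unfolding F_def prim_v by (simp flip: scaleR_scaleR)
  also have "\<dots> = (\<integral>x. deriv \<phi> x *\<^sub>R prim g x \<partial>lebesgue)"
    using borel_measurable_continuous_onI[OF prim_continuous, of g]
    by (intro integral_completion[symmetric]) simp
  finally show ?thesis using 1 by simp
qed

section \<open>Du Bois-Reymond's lemma and weak solutions of \<open>f'' = f\<close>\<close>

lemma integrable_test_scaleR:
  assumes "\<phi> \<in> test_functions S" "continuous_on UNIV u"
  shows "integrable lebesgue (\<lambda>x. \<phi> x *\<^sub>R (u x :: complex))"
proof -
  obtain K where "compact K" "\<And>x. x \<notin> K \<Longrightarrow> \<phi> x = 0"
    using assms(1) by (auto simp: test_functions_iff)
  then show ?thesis
    using assms smooth_continuous[OF test_smooth[OF assms(1)], of UNIV]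
    by (intro integrable_compact_support[of _ K] continuous_on_scaleR) auto
qed

lemma integrable_test_rep:
  assumes "\<phi> \<in> test_functions S"
  shows "integrable lebesgue (\<lambda>x. \<phi> x *\<^sub>R rep_L2 f x)"
  using integrable_cinner[OF square_integrable_rep_L2[of f] square_integrable_test[OF assms]]
  by (simp add: scaleR_conv_of_real mult.commute)

lemma integral_test_lborel:
  assumes "\<phi> \<in> test_functions S"
  shows "(\<integral>x. \<phi> x \<partial>lebesgue) = (\<integral>x. \<phi> x \<partial>lborel)"
  using borel_measurable_continuous_onI[OF smooth_continuous[OF test_smooth[OF assms]]]
  by (intro integral_completion) simp

lemma integral_bump_pos:
  assumes "a < b"
  shows "(\<integral>x. bump 1 a b x \<partial>lebesgue) > 0"
proof -
  have i: "integrable lebesgue (bump 1 a b)"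
    by (rule integrable_test[OF bump_test[OF _ order_refl]]) simp
  have "(\<integral>x. bump 1 a b x \<partial>lebesgue) \<noteq> 0"
  proof
    assume "(\<integral>x. bump 1 a b x \<partial>lebesgue) = 0"
    then have "AE x in lebesgue. bump 1 a b x = 0"
      using integral_nonneg_eq_0_iff_AE[OF i] by (simp add: bump_nonneg)
    then have "AE x in lebesgue. x \<notin> {a<..<b}"
    proof eventually_elim
      case (elim x)
      then show ?case using bump_pos[of 1 a x b] by auto
    qed
    then have "negligible {a<..<b}"
      by (simp add: negligible_iff_null_sets AE_iff_null_sets[OF sets_lebesgue_open])
    then show False using open_not_negligible[of "{a<..<b}"] assms by auto
  qed
  moreover have "(\<integral>x. bump 1 a b x \<partial>lebesgue) \<ge> 0"
    by (intro Bochner_Integration.integral_nonneg) (simp add: bump_nonneg)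
  ultimately show ?thesis by simp
qed

text \<open>The difference \<open>f - prim g\<close> annihilates derivatives of test functions, that
  is, all test functions of mean 0. Hence it acts on every test function as a constant
  \<open>C\<close> does.\<close>

lemma du_bois_reymond:
  assumes S: "open S" "is_interval S" and fg: "has_weak_deriv_on S f g"
  shows "\<exists>C. AE x in lebesgue. x \<in> S \<longrightarrow> rep_L2 f x = C + prim g x"
proof (cases "S = {}")
  case False
  then obtain s where "s \<in> S" by auto
  then obtain e where e: "e > 0" "cball s e \<subseteq> S" using S(1) open_contains_cball by blast
  have ab: "{s - e..s + e} \<subseteq> S" using e by (auto simp: dist_real_def subset_iff abs_le_iff)
  define c where "c = (\<integral>x. bump 1 (s - e) (s + e) x \<partial>lebesgue)"
  have c: "c > 0" unfolding c_def using e by (intro integral_bump_pos) simp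
  \<comment> \<open>A test function of integral 1; subtracting a multiple of it removes the mean of
    any other, and its pairing with \<open>f - prim g\<close> is the constant.\<close>
  define \<theta>0 where "\<theta>0 x = (1 / c) * bump 1 (s - e) (s + e) x" for x
  have \<theta>0: "\<theta>0 \<in> test_functions S"
    unfolding \<theta>0_def by (intro test_cmult bump_test ab) simp
  have I\<theta>0: "(\<integral>x. \<theta>0 x \<partial>lebesgue) = 1"
    unfolding \<theta>0_def using c by (simp add: c_def)
  define h where "h x = rep_L2 f x - prim g x" for x
  define L where "L \<theta> = (\<integral>x. \<theta> x *\<^sub>R h x \<partial>lebesgue)" for \<theta> :: "real \<Rightarrow> real"
  have ih: "integrable lebesgue (\<lambda>x. \<theta> x *\<^sub>R h x)" if "\<theta> \<in> test_functions S" for \<theta>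
    unfolding h_def scaleR_diff_right
    by (intro Bochner_Integration.integrable_diff integrable_test_rep[OF that]
        integrable_test_scaleR[OF that] prim_continuous)
  have L0: "L \<theta> = 0" if \<theta>: "\<theta> \<in> test_functions S" "(\<integral>x. \<theta> x \<partial>lebesgue) = 0" for \<theta>
  proof -
    obtain \<phi> where \<phi>: "\<phi> \<in> test_functions S" "deriv \<phi> = \<theta>"
      using test_antiderivative[OF \<theta>(1) _ S(2) False] \<theta> by (auto simp: integral_test_lborel)
    have "L \<theta> = (\<integral>x. deriv \<phi> x *\<^sub>R rep_L2 f x \<partial>lebesgue) - (\<integral>x. deriv \<phi> x *\<^sub>R prim g x \<partial>lebesgue)"
      unfolding L_def h_def scaleR_diff_right \<phi>(2)
      by (intro Bochner_Integration.integral_diff integrable_test_rep[OF \<theta>(1)]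
          integrable_test_scaleR[OF \<theta>(1)] prim_continuous)
    also have "(\<integral>x. deriv \<phi> x *\<^sub>R prim g x \<partial>lebesgue) = - (\<integral>x. \<phi> x *\<^sub>R rep_L2 g x \<partial>lebesgue)"
      by (rule prim_weak_deriv[OF test_mono[OF \<phi>(1)]]) simp
    also have "(\<integral>x. deriv \<phi> x *\<^sub>R rep_L2 f x \<partial>lebesgue) = - (\<integral>x. \<phi> x *\<^sub>R rep_L2 g x \<partial>lebesgue)"
      using fg \<phi>(1) unfolding has_weak_deriv_on.rep_eq by blast
    finally show ?thesis by simp
  qed
  define C where "C = L \<theta>0"
  have LC: "L \<theta> = (\<integral>x. \<theta> x \<partial>lebesgue) *\<^sub>R C" if \<theta>: "\<theta> \<in> test_functions S" for \<theta>
  proof -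
    define a where "a = (\<integral>x. \<theta> x \<partial>lebesgue)"
    have t: "(\<lambda>x. \<theta> x + (- a) * \<theta>0 x) \<in> test_functions S" by (intro test_add test_cmult \<theta> \<theta>0)
    have "(\<integral>x. \<theta> x + (- a) * \<theta>0 x \<partial>lebesgue) = a + (- a) * 1"
      using integrable_test[OF \<theta>] integrable_test[OF \<theta>0]
      by (simp only: Bochner_Integration.integral_add integrable_mult_right integral_mult_right_zero
          a_def I\<theta>0)
    then have "0 = L (\<lambda>x. \<theta> x + (- a) * \<theta>0 x)" using L0[OF t] by simp
    also have "\<dots> = (\<integral>x. \<theta> x *\<^sub>R h x - a *\<^sub>R (\<theta>0 x *\<^sub>R h x) \<partial>lebesgue)"
      unfolding L_def by (simp add: scaleR_add_left scaleR_diff_left algebra_simps)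
    also have "\<dots> = L \<theta> - a *\<^sub>R C"
      unfolding L_def C_def using ih[OF \<theta>] ih[OF \<theta>0]
      by (simp only: Bochner_Integration.integral_diff integrable_scaleR_right integral_scaleR_right)
    finally show ?thesis by (simp add: a_def)
  qed
  \<comment> \<open>Neither the constant nor \<open>prim g\<close> need be square-integrable on an
    unbounded \<open>S\<close>, so the fundamental lemma is applied on bounded pieces.\<close>
  have local: "AE x in lebesgue. x \<in> S \<inter> {- real n<..<real n} \<longrightarrow> rep_L2 f x = C + prim g x" for n
  proof -
    let ?S = "S \<inter> {- real n<..<real n}"
    have So: "open ?S" using S(1) by (intro open_Int) auto
    define B where "B = norm g * sqrt (real n) + cmod C + cmod (prim g 0)"
    have prim_le: "cmod (indicat_real ?S x *\<^sub>R (prim g x + C)) \<le>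
        B * cmod (complex_of_real (indicator {- real n<..real n} x))" for x
    proof (cases "x \<in> ?S")
      case True
      have "cmod (prim g x - prim g 0) \<le> norm g * sqrt (real n)"
        using True by (intro order_trans[OF prim_bound] mult_left_mono) auto
      then have "cmod (prim g x + C) \<le> B"
        using norm_triangle_ineq[of "prim g x" C] norm_triangle_ineq[of "prim g x - prim g 0" "prim g 0"]
        by (simp add: B_def)
      then show ?thesis using True by (simp add: indicator_def)
    next
      case False
      have "0 \<le> B" by (auto simp: B_def intro!: add_nonneg_nonneg mult_nonneg_nonneg)
      then show ?thesis using False by simp
    qed
    have m: "indicat_real ?S \<in> borel_measurable lebesgue"
      using sets_lebesgue_open[OF So] by (rule borel_measurable_indicator)
    have pm: "prim g \<in> borel_measurable lebesgue"
      by (rule measurable_completion) (simp add: borel_measurable_continuous_onI[OF prim_continuous])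
    have sq: "square_integrable (\<lambda>x. indicat_real ?S x *\<^sub>R rep_L2 f x - indicat_real ?S x *\<^sub>R (prim g x + C))"
    proof (rule square_integrable_diff)
      show "square_integrable (\<lambda>x. indicat_real ?S x *\<^sub>R rep_L2 f x)"
        by (rule square_integrable_bound[OF _ square_integrable_rep_L2[of f], of _ 1])
          (use m in \<open>simp_all split: split_indicator\<close>)
      show "square_integrable (\<lambda>x. indicat_real ?S x *\<^sub>R (prim g x + C))"
        by (rule square_integrable_bound[OF _ square_integrable_indicator_Ioc[of "- real n" "real n"], of _ B])
          (use m pm prim_le in simp_all)
    qed
    define d where "d = abs_L2 (\<lambda>x. indicat_real ?S x *\<^sub>R rep_L2 f x - indicat_real ?S x *\<^sub>R (prim g x + C))"
    have d: "AE x in lebesgue. rep_L2 d x = indicat_real ?S x *\<^sub>R rep_L2 f x - indicat_real ?S x *\<^sub>R (prim g x + C)"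
      unfolding d_def by (rule AE_rep_abs_L2[OF sq])
    have "AE x in lebesgue. x \<in> ?S \<longrightarrow> rep_L2 d x = 0"
    proof (rule fundamental_lemma[OF So])
      fix \<theta> assume \<theta>': "\<theta> \<in> test_functions ?S"
      have \<theta>: "\<theta> \<in> test_functions S" by (rule test_mono[OF \<theta>']) auto
      have \<theta>0': "\<theta> x = 0" if "x \<notin> ?S" for x using that \<theta>' by (auto simp: test_functions_iff)
      have "cinner d (emb \<theta>) = (\<integral>x. \<theta> x *\<^sub>R rep_L2 d x \<partial>lebesgue)" by (rule cinner_emb[OF \<theta>])
      also have "\<dots> = (\<integral>x. \<theta> x *\<^sub>R h x - \<theta> x *\<^sub>R C \<partial>lebesgue)"
      proof (rule integral_cong_AE)
        show "(\<lambda>x. \<theta> x *\<^sub>R rep_L2 d x) \<in> borel_measurable lebesgue"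
          by (intro borel_measurable_integrable integrable_test_rep[OF \<theta>])
        show "(\<lambda>x. \<theta> x *\<^sub>R h x - \<theta> x *\<^sub>R C) \<in> borel_measurable lebesgue"
          by (intro borel_measurable_integrable Bochner_Integration.integrable_diff ih[OF \<theta>]
              integrable_scaleR_left integrable_test[OF \<theta>])
        show "AE x in lebesgue. \<theta> x *\<^sub>R rep_L2 d x = \<theta> x *\<^sub>R h x - \<theta> x *\<^sub>R C"
          using d
        proof eventually_elim
          case (elim x)
          then show ?case using \<theta>0'[of x]
            by (cases "x \<in> ?S") (simp_all add: h_def scaleR_diff_right scaleR_add_right)
        qed
      qed
      also have "\<dots> = L \<theta> - (\<integral>x. \<theta> x \<partial>lebesgue) *\<^sub>R C"
        unfolding L_def using ih[OF \<theta>] integrable_test[OF \<theta>]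
        by (subst Bochner_Integration.integral_diff) (auto simp: integral_scaleR_left)
      finally show "cinner d (emb \<theta>) = 0" using LC[OF \<theta>] by simp
    qed
    with d show ?thesis
      by eventually_elim (auto simp: indicator_def algebra_simps)
  qed
  have "AE x in lebesgue. \<forall>n. x \<in> S \<inter> {- real n<..<real n} \<longrightarrow> rep_L2 f x = C + prim g x"
    using local by (simp only: AE_all_countable) blast
  then have "AE x in lebesgue. x \<in> S \<longrightarrow> rep_L2 f x = C + prim g x"
  proof eventually_elim
    case (elim x)
    obtain n where "\<bar>x\<bar> < real n" using reals_Archimedean2 by blast
    then show ?case using elim[rule_format, of n] by (auto simp: abs_less_iff)
  qed
  then show ?thesis by blast
qed simp

text \<open>The continuous representatives \<open>u\<close>, \<open>v\<close> solve
  \<open>u' = v\<close>, \<open>v' = u\<close> classically, so \<open>(u + v) exp (-x)\<close> and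
  \<open>(u - v) exp x\<close> have derivative 0 and are constant.\<close>

lemma weak_exp_solution:
  assumes S: "open S" "is_interval S" and d: "has_weak_deriv_on S d e" and e: "has_weak_deriv_on S e d"
  shows "\<exists>P Q :: complex. (AE x in lebesgue. x \<in> S \<longrightarrow> rep_L2 d x = P * complex_of_real (exp x) + Q * complex_of_real (exp (- x))) \<and>
    (AE x in lebesgue. x \<in> S \<longrightarrow> rep_L2 e x = P * complex_of_real (exp x) - Q * complex_of_real (exp (- x)))"
proof -
  obtain Cd where Cd: "AE x in lebesgue. x \<in> S \<longrightarrow> rep_L2 d x = Cd + prim e x"
    using du_bois_reymond[OF S d] by blast
  obtain Ce where Ce: "AE x in lebesgue. x \<in> S \<longrightarrow> rep_L2 e x = Ce + prim d x"
    using du_bois_reymond[OF S e] by blast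
  define u v where "u x = Cd + prim e x" and "v x = Ce + prim d x" for x
  have uv: "continuous_on S u" "continuous_on S v"
    unfolding u_def v_def by (intro continuous_intros prim_continuous)+
  have pe: "(prim e has_vector_derivative v x) (at x)" and pd: "(prim d has_vector_derivative u x) (at x)"
    if "x \<in> S" for x
    using prim_has_derivative[OF S uv(2) _ that, of e] prim_has_derivative[OF S uv(1) _ that, of d] Cd Ce
    by (auto simp: u_def v_def)
  have u': "(u has_vector_derivative v x) (at x)" and v': "(v has_vector_derivative u x) (at x)"
    if "x \<in> S" for x
    using has_vector_derivative_add[OF has_vector_derivative_const[of Cd] pe[OF that]]
      has_vector_derivative_add[OF has_vector_derivative_const[of Ce] pd[OF that]]
    by (simp_all add: u_def[abs_def] v_def[abs_def])
  have conv: "convex S" using S(2) is_interval_convex_1 by blast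
  have const: "\<exists>c. \<forall>x\<in>S. w x = c"
    if "\<And>x. x \<in> S \<Longrightarrow> (w has_vector_derivative 0) (at x)" for w :: "real \<Rightarrow> complex"
    using has_vector_derivative_zero_constant[OF conv, of w] that has_vector_derivative_at_within
    by metis
  have e1: "((\<lambda>x. complex_of_real (exp (- x))) has_vector_derivative - complex_of_real (exp (- x))) (at x)"
    and e2: "((\<lambda>x. complex_of_real (exp x)) has_vector_derivative complex_of_real (exp x)) (at x)" for x
    by (auto intro!: derivative_eq_intros has_vector_derivative_of_real)
  have "\<exists>c. \<forall>x\<in>S. (u x + v x) * complex_of_real (exp (- x)) = c"
  proof (rule const)
    fix x assume x: "x \<in> S"
    show "((\<lambda>x. (u x + v x) * complex_of_real (exp (- x))) has_vector_derivative 0) (at x)"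
      using has_vector_derivative_mult[OF has_vector_derivative_add[OF u'[OF x] v'[OF x]] e1[of x]]
      by (simp add: algebra_simps)
  qed
  then obtain P where P: "\<And>x. x \<in> S \<Longrightarrow> (u x + v x) * complex_of_real (exp (- x)) = P" by blast
  have "\<exists>c. \<forall>x\<in>S. (u x - v x) * complex_of_real (exp x) = c"
  proof (rule const)
    fix x assume x: "x \<in> S"
    show "((\<lambda>x. (u x - v x) * complex_of_real (exp x)) has_vector_derivative 0) (at x)"
      using has_vector_derivative_mult[OF has_vector_derivative_diff[OF u'[OF x] v'[OF x]] e2[of x]]
      by (simp add: algebra_simps)
  qed
  then obtain Q where Q: "\<And>x. x \<in> S \<Longrightarrow> (u x - v x) * complex_of_real (exp x) = Q" by blast
  have sol: "u x = P / 2 * complex_of_real (exp x) + Q / 2 * complex_of_real (exp (- x))" "v x = P / 2 * complex_of_real (exp x) - Q / 2 * complex_of_real (exp (- x))"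
    if "x \<in> S" for x
  proof -
    have ee: "complex_of_real (exp x) * complex_of_real (exp (- x)) = 1"
      by (simp flip: of_real_mult exp_add)
    have "P * complex_of_real (exp x) = (u x + v x) * (complex_of_real (exp x) * complex_of_real (exp (- x)))"
      unfolding P[OF that, symmetric] by (simp add: mult_ac)
    moreover have "Q * complex_of_real (exp (- x)) = (u x - v x) * (complex_of_real (exp x) * complex_of_real (exp (- x)))"
      unfolding Q[OF that, symmetric] by (simp add: mult_ac)
    ultimately have "P * complex_of_real (exp x) = u x + v x" "Q * complex_of_real (exp (- x)) = u x - v x"
      by (simp_all only: ee mult_1_right)
    then have "P / 2 * complex_of_real (exp x) = (u x + v x) / 2" "Q / 2 * complex_of_real (exp (- x)) = (u x - v x) / 2"
      by simp_all
    then show "u x = P / 2 * complex_of_real (exp x) + Q / 2 * complex_of_real (exp (- x))" "v x = P / 2 * complex_of_real (exp x) - Q / 2 * complex_of_real (exp (- x))"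
      by (simp_all only:) (simp_all add: field_simps)
  qed
  show ?thesis
    by (rule exI[of _ "P / 2"], rule exI[of _ "Q / 2"])
      (use Cd Ce sol in \<open>auto simp: u_def v_def elim!: eventually_mono\<close>)
qed

lemma continuous_AE_eq_0:
  fixes u :: "real \<Rightarrow> complex"
  assumes "open S" "continuous_on S u" "AE x in lebesgue. x \<in> S \<longrightarrow> u x = 0" "x \<in> S"
  shows "u x = 0"
proof (rule ccontr)
  assume "u x \<noteq> 0"
  let ?N = "S \<inter> u -` (- {0})"
  have "open ?N" using assms by (intro continuous_open_preimage) auto
  moreover have "AE x in lebesgue. x \<notin> ?N" using assms(3) by eventually_elim auto
  ultimately have "negligible ?N"
    by (simp add: negligible_iff_null_sets AE_iff_null_sets[OF sets_lebesgue_open])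
  with \<open>open ?N\<close> have "?N = {}" using open_not_negligible by blast
  then show False using \<open>u x \<noteq> 0\<close> assms(4) by auto
qed

lemma exp_solution_zero:
  fixes P Q :: complex and r :: real
  assumes r: "r > 0" and u: "continuous_on {-r..r} u" "u (-r) = 0" "u r = 0"
    and eq: "AE x in lebesgue. x \<in> {-r<..<r} \<longrightarrow> u x = P * complex_of_real (exp x) + Q * complex_of_real (exp (- x))"
  shows "P = 0" "Q = 0"
proof -
  define w where "w x = u x - (P * complex_of_real (exp x) + Q * complex_of_real (exp (- x)))" for x
  have w: "continuous_on {-r..r} w" unfolding w_def by (intro continuous_intros u)
  have w0: "w x = 0" if "x \<in> {-r<..<r}" for x
  proof (rule continuous_AE_eq_0[OF _ _ _ that])
    show "continuous_on {-r<..<r} w" by (rule continuous_on_subset[OF w]) auto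
    show "AE x in lebesgue. x \<in> {-r<..<r} \<longrightarrow> w x = 0"
      using eq by eventually_elim (simp add: w_def)
  qed simp
  have cl: "closure {-r<..<r} = {-r..r}" using r by simp
  have w1: "w x = 0" if "x \<in> {-r..r}" for x
    using continuous_constant_on_closure[of "{-r<..<r}" w 0 x] w w0 that unfolding cl by blast
  have E: "P * complex_of_real (exp r) + Q * complex_of_real (exp (- r)) = 0"
    "P * complex_of_real (exp (- r)) + Q * complex_of_real (exp r) = 0"
    using w1[of r] w1[of "-r"] u r unfolding w_def by (simp_all only: diff_0 neg_equal_0_iff_equal) auto
  define a b where "a = complex_of_real (exp r)" and "b = complex_of_real (exp (- r))"
  \<comment> \<open>The determinant of the linear system that the two boundary conditions impose on
    \<open>P\<close> and \<open>Q\<close>.\<close>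
  have ab: "a * a - b * b \<noteq> 0"
  proof -
    have "exp (- r) * exp (- r) < exp r * exp r"
      using r by (intro mult_strict_mono) auto
    then have "complex_of_real (exp r * exp r - exp (- r) * exp (- r)) \<noteq> 0"
      unfolding of_real_eq_0_iff by simp
    then show ?thesis by (simp add: a_def b_def)
  qed
  have E': "P * a + Q * b = 0" "P * b + Q * a = 0" using E by (simp_all add: a_def b_def)
  have "P * (a * a - b * b) = a * (P * a + Q * b) - b * (P * b + Q * a)"
    "Q * (a * a - b * b) = a * (P * b + Q * a) - b * (P * a + Q * b)"
    by (simp_all add: algebra_simps)
  then show "P = 0" "Q = 0" using E' ab by simp_all
qed

section \<open>First-order Sobolev spaces\<close>

definition symmetric_interval :: "real set \<Rightarrow> bool" where
  "symmetric_interval S \<longleftrightarrow> S = UNIV \<or> (\<exists>r>0. S = {-r<..<r})"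

text \<open>For a symmetric interval \<open>S\<close> this is the graph of the derivative on \<open>H\<^sup>1\<^sub>0(S)\<close>, since extension
  by zero of such a function is weakly differentiable on the whole line.\<close>

definition H1_graph :: "real set \<Rightarrow> (L2 \<times> L2) set" where
  "H1_graph S = {(f, g). f \<in> L2_on S \<and> has_weak_deriv_on UNIV f g}"

lemma mem_H1_graph: "(f, g) \<in> H1_graph S \<longleftrightarrow> f \<in> L2_on S \<and> has_weak_deriv_on UNIV f g"
  by (simp add: H1_graph_def)

lemma
  assumes "symmetric_interval S"
  shows symmetric_interval_open: "open S"
    and symmetric_interval_is_interval: "is_interval S"
    and symmetric_interval_sets: "S \<in> sets lebesgue"
proof -
  show "open S" using assms by (auto simp: symmetric_interval_def)
  then show "S \<in> sets lebesgue" by (rule sets_lebesgue_open)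
  show "is_interval S"
    using assms by (auto simp: symmetric_interval_def is_interval_1)
qed

lemma has_weak_deriv_on_scaleR:
  "has_weak_deriv_on S f g \<Longrightarrow> has_weak_deriv_on S (c *\<^sub>R f) (c *\<^sub>R g)"
  unfolding scaleR_conv_scaleC by (rule has_weak_deriv_on_scaleC)

lemma subspace_H1_graph: "subspace (H1_graph S)"
proof -
  note U = csubspace_L2_on[of S]
  show ?thesis
    unfolding subspace_def
    by (auto simp: mem_H1_graph zero_prod_def csubspace_zero[OF U] csubspace_add[OF U]
        csubspace_scaleR[OF U] has_weak_deriv_on_zero has_weak_deriv_on_add has_weak_deriv_on_scaleR)
qed

lemma H1_graph_scaleC: "(f, g) \<in> H1_graph S \<Longrightarrow> (z *\<^sub>C f, z *\<^sub>C g) \<in> H1_graph S"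
  by (simp add: mem_H1_graph csubspace_scaleC[OF csubspace_L2_on] has_weak_deriv_on_scaleC)

lemma H1_graph_diff:
  "(f, g) \<in> H1_graph S \<Longrightarrow> (f', g') \<in> H1_graph S \<Longrightarrow> (f - f', g - g') \<in> H1_graph S"
  by (simp add: mem_H1_graph csubspace_diff[OF csubspace_L2_on] has_weak_deriv_on_diff)

lemma H1_graph_add:
  "(f, g) \<in> H1_graph S \<Longrightarrow> (f', g') \<in> H1_graph S \<Longrightarrow> (f + f', g + g') \<in> H1_graph S"
  by (simp add: mem_H1_graph csubspace_add[OF csubspace_L2_on] has_weak_deriv_on_add)

lemma H1_graph_mono: "S \<subseteq> S' \<Longrightarrow> H1_graph S \<subseteq> H1_graph S'"
  by (auto simp: H1_graph_def dest: subsetD[OF L2_on_mono])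

lemma closed_H1_graph:
  assumes "S \<in> sets lebesgue"
  shows "closed (H1_graph S)"
  unfolding closed_sequential_limits
proof (intro allI impI, elim conjE)
  fix X :: "nat \<Rightarrow> L2 \<times> L2" and l
  assume X: "\<forall>n. X n \<in> H1_graph S" and l: "X \<longlonglongrightarrow> l"
  have f: "(\<lambda>n. fst (X n)) \<longlonglongrightarrow> fst l" and g: "(\<lambda>n. snd (X n)) \<longlonglongrightarrow> snd l"
    by (intro tendsto_intros l)+
  have X': "fst (X n) \<in> L2_on S" "has_weak_deriv_on UNIV (fst (X n)) (snd (X n))" for n
    using X[rule_format, of n] by (cases "X n"; simp add: mem_H1_graph)+
  have "fst l \<in> L2_on S" using closed_sequentially[OF closed_L2_on[OF assms] _ f] X' by blast
  moreover have "has_weak_deriv_on UNIV (fst l) (snd l)"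
    by (rule has_weak_deriv_on_limit[OF X'(2) f g])
  ultimately show "l \<in> H1_graph S" by (cases l) (simp add: mem_H1_graph)
qed

lemma H1_graph_unique: "(f, g) \<in> H1_graph S \<Longrightarrow> (f, g') \<in> H1_graph S' \<Longrightarrow> g = g'"
  using weak_deriv_eq[of UNIV g f] weak_deriv_eq[of UNIV g' f] by (auto simp: mem_H1_graph L2_on_UNIV)

text \<open>On the open exterior \<open>f\<close> is 0, hence so is its weak derivative there; the
  two boundary points form a null set.\<close>

lemma H1_graph_deriv_L2_on:
  assumes S: "symmetric_interval S" and fg: "(f, g) \<in> H1_graph S"
  shows "g \<in> L2_on S"
proof (cases "S = UNIV")
  case False
  then obtain r where r: "r > 0" "S = {-r<..<r}" using S by (auto simp: symmetric_interval_def)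
  let ?E = "{..<-r} \<union> {r<..}"
  have f: "AE x in lebesgue. x \<notin> S \<longrightarrow> rep_L2 f x = 0" and d: "has_weak_deriv_on UNIV f g"
    using fg by (auto simp: mem_H1_graph mem_L2_on)
  have "AE x in lebesgue. x \<in> ?E \<longrightarrow> rep_L2 g x = 0"
  proof (rule fundamental_lemma)
    fix \<phi> assume \<phi>: "\<phi> \<in> test_functions ?E"
    have "cinner f (emb (deriv \<phi>)) = (\<integral>x. deriv \<phi> x *\<^sub>R rep_L2 f x \<partial>lebesgue)"
      by (rule cinner_emb[OF test_deriv[OF \<phi>]])
    also have "\<dots> = 0"
    proof (rule integral_eq_zero_AE)
      show "AE x in lebesgue. deriv \<phi> x *\<^sub>R rep_L2 f x = 0"
        using f
      proof eventually_elim
        case (elim x)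
        have "deriv \<phi> x = 0" if "x \<in> S"
          using that test_deriv[OF \<phi>] r by (auto simp: test_functions_iff)
        then show ?case using elim by auto
      qed
    qed
    finally show "cinner g (emb \<phi>) = 0"
      using d test_mono[OF \<phi>, of UNIV] by (simp add: has_weak_deriv_on_iff)
  qed auto
  moreover have "AE x in lebesgue. x \<noteq> r" "AE x in lebesgue. x \<noteq> - r"
    by (intro AE_completion AE_lborel_singleton)+
  ultimately show ?thesis
    unfolding mem_L2_on by eventually_elim (auto simp: r)
qed (simp add: L2_on_UNIV)

lemma H1_graph_continuous_rep:
  assumes "(f, g) \<in> H1_graph S"
  obtains u where "continuous_on UNIV u" "AE x in lebesgue. rep_L2 f x = u x"
proof -
  obtain C where C: "AE x in lebesgue. x \<in> UNIV \<longrightarrow> rep_L2 f x = C + prim g x"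
    using du_bois_reymond[of UNIV f g] assms by (auto simp: mem_H1_graph)
  show thesis
    by (rule that[of "\<lambda>x. C + prim g x"]) (use C in \<open>auto intro!: continuous_intros prim_continuous\<close>)
qed

text \<open>This is how extension by zero encodes the Dirichlet condition: the continuous
  representative vanishes on the exterior and therefore on its closure.\<close>

lemma H1_graph_boundary:
  assumes "r > 0" "(f, g) \<in> H1_graph {-r<..<r}" "continuous_on UNIV u" "AE x in lebesgue. rep_L2 f x = u x"
  shows "u r = 0" "u (- r) = 0"
proof -
  let ?E = "{..<-r} \<union> {r<..}"
  have "AE x in lebesgue. x \<notin> {-r<..<r} \<longrightarrow> rep_L2 f x = 0"
    using assms(2) by (auto simp: mem_H1_graph mem_L2_on)
  with assms(4) have ae: "AE x in lebesgue. x \<in> ?E \<longrightarrow> u x = 0"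
    by eventually_elim auto
  have u0: "u x = 0" if "x \<in> ?E" for x
    by (rule continuous_AE_eq_0[OF open_Un[OF open_lessThan open_greaterThan]
        continuous_on_subset[OF assms(3)] ae that]) simp
  have "closure ?E = {..-r} \<union> {r..}" by (simp add: closure_Un)
  then have cl: "x \<in> {..-r} \<union> {r..} \<Longrightarrow> u x = 0" for x
    using continuous_constant_on_closure[of ?E u 0 x] continuous_on_subset[OF assms(3)] u0 by simp
  show "u r = 0" "u (- r) = 0" by (auto intro!: cl)
qed

text \<open>On the line, \<open>f + g\<close> and \<open>f - g\<close> are multiples of
  \<open>exp x\<close> and \<open>exp (-x)\<close>; a nonzero multiple stays away from 0 on
  intervals of every length and is not square-integrable. On a bounded interval the boundary values
  decide.\<close>

lemma H1_graph_weak_exp_zero: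
  assumes S: "symmetric_interval S" and fg: "(f, g) \<in> H1_graph S" and gf: "has_weak_deriv_on S g f"
  shows "f = 0" "g = 0"
proof -
  have fg': "has_weak_deriv_on S f g"
    using fg has_weak_deriv_on_subset[of UNIV f g S] by (auto simp: mem_H1_graph)
  obtain P Q where P: "AE x in lebesgue. x \<in> S \<longrightarrow> rep_L2 f x = P * complex_of_real (exp x) + Q * complex_of_real (exp (- x))"
    and Q: "AE x in lebesgue. x \<in> S \<longrightarrow> rep_L2 g x = P * complex_of_real (exp x) - Q * complex_of_real (exp (- x))"
    using weak_exp_solution[OF symmetric_interval_open[OF S] symmetric_interval_is_interval[OF S] fg' gf]
    by blast
  have PQ: "P = 0 \<and> Q = 0"
  proof (cases "S = UNIV")
    case True
    have zero: "c = 0" if box: "\<And>n::nat. \<exists>a. (norm (c *\<^sub>C box_L2 a (a + real n)) \<le> norm h)" for c and h :: L2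
    proof (rule ccontr)
      assume "c \<noteq> 0"
      then have c: "(cmod c)\<^sup>2 > 0" by simp
      have le: "(cmod c)\<^sup>2 * real n \<le> (norm h)\<^sup>2" for n
      proof -
        obtain a where "norm (c *\<^sub>C box_L2 a (a + real n)) \<le> norm h" using box by blast
        then have "(cmod c * norm (box_L2 a (a + real n)))\<^sup>2 \<le> (norm h)\<^sup>2"
          by (intro power_mono) (auto simp: norm_scaleC)
        then show ?thesis using norm_box[of a "a + real n"] by (simp add: power_mult_distrib)
      qed
      obtain n where "real n > (norm h)\<^sup>2 / (cmod c)\<^sup>2" using reals_Archimedean2 by blast
      then have "(norm h)\<^sup>2 < (cmod c)\<^sup>2 * real n" using c by (simp add: field_simps)
      with le[of n] show False by simp
    qed
    have bound: "norm (c *\<^sub>C box_L2 a b) \<le> norm h"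
      if "AE x in lebesgue. x \<in> {a<..b} \<longrightarrow> cmod c \<le> cmod (rep_L2 h x)" for c a b and h :: L2
    proof -
      have "AE x in lebesgue. cmod (rep_L2 (c *\<^sub>C box_L2 a b) x) \<le> 1 * cmod (rep_L2 h x)"
        using that AE_rep_box[of a b] AE_rep_scaleC[of c "box_L2 a b"]
        by eventually_elim (auto simp: norm_mult split: split_indicator)
      then show ?thesis using norm_L2_mono[of _ 1] by simp
    qed
    have "2 * P = 0"
    proof (rule zero)
      fix n :: nat
      have "AE x in lebesgue. x \<in> {0<..0 + real n} \<longrightarrow> cmod (2 * P) \<le> cmod (rep_L2 (f + g) x)"
        using P Q AE_rep_add[of f g]
      proof eventually_elim
        case (elim x)
        then have "rep_L2 (f + g) x = 2 * P * complex_of_real (exp x)" using True by simp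
        then show ?case using mult_left_mono[of 1 "exp x" "cmod P"] by (auto simp: norm_mult)
      qed
      then show "\<exists>a. norm ((2 * P) *\<^sub>C box_L2 a (a + real n)) \<le> norm (f + g)"
        using bound by blast
    qed
    moreover have "2 * Q = 0"
    proof (rule zero)
      fix n :: nat
      have "AE x in lebesgue. x \<in> {- real n<..- real n + real n} \<longrightarrow> cmod (2 * Q) \<le> cmod (rep_L2 (f - g) x)"
        using P Q AE_rep_diff[of f g]
      proof eventually_elim
        case (elim x)
        then have "rep_L2 (f - g) x = 2 * Q * complex_of_real (exp (- x))" using True by simp
        then show ?case using mult_left_mono[of 1 "exp (- x)" "cmod Q"] by (auto simp: norm_mult)
      qed
      then show "\<exists>a. norm ((2 * Q) *\<^sub>C box_L2 a (a + real n)) \<le> norm (f - g)"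
        using bound by blast
    qed
    ultimately show ?thesis by simp
  next
    case False
    then obtain r where r: "r > 0" "S = {-r<..<r}" using S by (auto simp: symmetric_interval_def)
    obtain u where u: "continuous_on UNIV u" "AE x in lebesgue. rep_L2 f x = u x"
      using H1_graph_continuous_rep[OF fg] by blast
    have "AE x in lebesgue. x \<in> {-r<..<r} \<longrightarrow> u x = P * complex_of_real (exp x) + Q * complex_of_real (exp (- x))"
      using P u(2) by eventually_elim (simp add: r)
    then show ?thesis
      using exp_solution_zero[OF r(1) continuous_on_subset[OF u(1)], of P Q]
        H1_graph_boundary[OF r(1) fg[unfolded r(2)] u] by auto
  qed
  have "AE x in lebesgue. x \<notin> S \<longrightarrow> rep_L2 f x = 0" using fg by (simp add: mem_H1_graph mem_L2_on)
  then have "AE x in lebesgue. rep_L2 f x = rep_L2 0 x"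
    using P AE_rep_zero by eventually_elim (use PQ in auto)
  then show "f = 0" by (rule L2_eqI)
  then show "g = 0"
    using H1_graph_unique[OF fg, of 0 UNIV] by (simp add: mem_H1_graph has_weak_deriv_on_zero L2_on_UNIV)
qed

lemma emb_weak_deriv:
  assumes "\<phi> \<in> test_functions S"
  shows "has_weak_deriv_on UNIV (emb \<phi>) (emb (deriv \<phi>))"
  unfolding has_weak_deriv_on_iff
proof
  fix \<eta> assume \<eta>: "\<eta> \<in> test_functions UNIV"
  have \<phi>: "\<phi> \<in> test_functions UNIV" using assms by (rule test_mono) simp
  have rep: "cinner (emb \<psi>) (emb \<xi>) = complex_of_real (\<integral>x. \<xi> x * \<psi> x \<partial>lebesgue)"
    if "\<psi> \<in> test_functions UNIV" "\<xi> \<in> test_functions UNIV" for \<psi> \<xi>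
  proof -
    have "cinner (emb \<psi>) (emb \<xi>) = (\<integral>x. complex_of_real (\<xi> x * \<psi> x) \<partial>lebesgue)"
      unfolding cinner_emb[OF that(2)]
    proof (rule integral_cong_AE)
      show "(\<lambda>x. complex_of_real (\<xi> x * \<psi> x)) \<in> borel_measurable lebesgue"
        using borel_measurable_integrable[OF integrable_test[OF that(1)]]
          borel_measurable_integrable[OF integrable_test[OF that(2)]] by simp
      show "AE x in lebesgue. \<xi> x *\<^sub>R rep_L2 (emb \<psi>) x = complex_of_real (\<xi> x * \<psi> x)"
        using AE_rep_emb[OF that(1)] by eventually_elim (simp add: scaleR_conv_of_real)
    qed (rule borel_measurable_integrable[OF integrable_test_rep[OF that(2)]])
    then show ?thesis by (simp only: integral_complex_of_real)
  qed
  have prod: "(\<lambda>x. \<eta> x * \<phi> x) \<in> test_functions UNIV" by (rule test_mult[OF test_smooth[OF \<eta>] \<phi>])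
  have d: "deriv (\<lambda>x. \<eta> x * \<phi> x) = (\<lambda>x. \<eta> x * deriv \<phi> x + deriv \<eta> x * \<phi> x)"
    by (rule ext, rule DERIV_imp_deriv) (intro DERIV_mult' smooth_DERIV test_smooth[OF \<eta>] test_smooth[OF \<phi>])
  obtain p q where pq: "p \<le> q" "\<And>x. x \<notin> {p..q} \<Longrightarrow> \<eta> x * \<phi> x = 0"
    using test_support_interval[OF prod] by auto
  obtain p' q' where pq': "p' \<le> q'" "\<And>x. x \<notin> {p'..q'} \<Longrightarrow> deriv (\<lambda>x. \<eta> x * \<phi> x) x = 0"
    using test_support_interval[OF test_deriv[OF prod]] by auto
  \<comment> \<open>One unit beyond the intervals containing the supports, where the product surely
    vanishes; at their endpoints this has not been shown.\<close>
  define a b where "a = min p p' - 1" and "b = max q q' + 1"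
  have "(\<integral>x. deriv (\<lambda>x. \<eta> x * \<phi> x) x \<partial>lebesgue) =
      (\<integral>x. deriv (\<lambda>x. \<eta> x * \<phi> x) x * indicator {a..b} x \<partial>lborel)"
    unfolding integral_test_lborel[OF test_deriv[OF prod]]
    by (intro Bochner_Integration.integral_cong) (use pq' in \<open>force simp: indicator_def a_def b_def\<close>)+
  also have "\<dots> = \<eta> b * \<phi> b - \<eta> a * \<phi> a"
    using pq pq' by (intro test_FTC test_smooth[OF prod]) (auto simp: a_def b_def)
  also have "\<dots> = 0"
  proof -
    have ab: "a \<notin> {p..q}" "b \<notin> {p..q}" by (auto simp: a_def b_def)
    from pq(2)[OF ab(1)] pq(2)[OF ab(2)] show ?thesis by linarith
  qed
  finally have "(\<integral>x. \<eta> x * deriv \<phi> x + deriv \<eta> x * \<phi> x \<partial>lebesgue) = 0" by (simp add: d)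
  then have "(\<integral>x. \<eta> x * deriv \<phi> x \<partial>lebesgue) + (\<integral>x. deriv \<eta> x * \<phi> x \<partial>lebesgue) = 0"
    using integrable_test[OF test_mult[OF test_smooth[OF \<eta>] test_deriv[OF \<phi>]]]
      integrable_test[OF test_mult[OF smooth_deriv[OF test_smooth[OF \<eta>]] \<phi>]]
    by (simp add: Bochner_Integration.integral_add)
  then show "cinner (emb \<phi>) (emb (deriv \<eta>)) = - cinner (emb (deriv \<phi>)) (emb \<eta>)"
    unfolding rep[OF \<phi> test_deriv[OF \<eta>]] rep[OF test_deriv[OF \<phi>] \<eta>]
    by (simp flip: of_real_minus add: add_eq_0_iff)
qed

lemma H1_graph_emb:
  assumes "\<phi> \<in> test_functions S"
  shows "(z *\<^sub>C emb \<phi>, z *\<^sub>C emb (deriv \<phi>)) \<in> H1_graph S"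
  using assms by (intro H1_graph_scaleC) (simp add: mem_H1_graph emb_L2_on emb_weak_deriv)

text \<open>The orthogonal complement of the test functions in \<open>H\<^sup>1\<^sub>0(S)\<close> consists of weak solutions of
  \<open>f'' = f\<close>, which vanish.\<close>

lemma H1_graph_dense:
  assumes S: "symmetric_interval S" and X: "subspace X" "closed X"
    and test: "\<And>\<phi> z. \<phi> \<in> test_functions S \<Longrightarrow> (z *\<^sub>C emb \<phi>, z *\<^sub>C emb (deriv \<phi>)) \<in> X"
    and fg: "(f, g) \<in> H1_graph S"
  shows "(f, g) \<in> X"
proof -
  let ?Y = "X \<inter> H1_graph S"
  have Y: "subspace ?Y" "closed ?Y"
    using X subspace_H1_graph closed_H1_graph[OF symmetric_interval_sets[OF S]]
    by (auto intro: subspace_inter)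
  obtain p where p: "p \<in> ?Y" "\<And>q. q \<in> ?Y \<Longrightarrow> inner ((f, g) - p) q = 0"
    using projection_theorem[OF Y] by blast
  define d e where "d = f - fst p" and "e = g - snd p"
  have de: "(d, e) \<in> H1_graph S"
    unfolding d_def e_def using p(1) fg by (intro H1_graph_diff) auto
  have orth: "inner d a + inner e b = 0" if "(a, b) \<in> ?Y" for a b
    using p(2)[OF that] by (cases p) (simp add: inner_prod_def d_def e_def)
  have "has_weak_deriv_on S e d"
    unfolding has_weak_deriv_on_iff
  proof
    fix \<phi> assume \<phi>: "\<phi> \<in> test_functions S"
    have *: "Re (cinner d (z *\<^sub>C emb \<phi>)) + Re (cinner e (z *\<^sub>C emb (deriv \<phi>))) = 0" for z
      using orth[of "z *\<^sub>C emb \<phi>" "z *\<^sub>C emb (deriv \<phi>)"] test[OF \<phi>] H1_graph_emb[OF \<phi>]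
      by (simp add: inner_eq_Re_cinner)
    show "cinner e (emb (deriv \<phi>)) = - cinner d (emb \<phi>)"
      using *[of 1] *[of \<i>] unfolding Im_cinner[symmetric] by (simp add: complex_eq_iff)
  qed
  then have "d = 0" "e = 0" using H1_graph_weak_exp_zero[OF S de] by auto
  then have "(f, g) = p" by (simp add: d_def e_def prod_eq_iff)
  then show ?thesis using p(1) by auto
qed

text \<open>For test functions this is the definition of the weak derivative, and the identity is
  closed under limits in the H1 norm. Only the second factor has zero boundary values;
  \<open>g\<close> may be arbitrary at the boundary.\<close>

lemma weak_integration_by_parts:
  assumes S: "symmetric_interval S" and gh: "has_weak_deriv_on S g h" and k: "(k, k') \<in> H1_graph S"
  shows "cinner h k = - cinner g k'"
proof -
  let ?X = "{p. cinner h (fst p) + cinner g (snd p) = 0}"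
  have sub: "subspace ?X"
    unfolding subspace_def by (auto simp: cinner_algebra cinner_scaleR_right algebra_simps)
      (metis add.assoc add.left_commute add_0 distrib_left mult_zero_right)+
  have cl: "closed ?X"
    by (intro closed_Collect_eq continuous_intros
        bounded_bilinear.continuous_on[OF bounded_bilinear_cinner])
  have "(k, k') \<in> ?X"
    by (rule H1_graph_dense[OF S sub cl _ k])
      (use gh in \<open>auto simp: has_weak_deriv_on_iff cinner_scaleC_right\<close>)
  then show ?thesis by (simp add: eq_neg_iff_add_eq_0)
qed

section \<open>Schroedinger operators on symmetric intervals\<close>

text \<open>Weak solvability of \<open>-u'' + u = y\<close>: project \<open>(y, 0)\<close>
  orthogonally onto the closed graph in \<open>L2 \<times> L2\<close>, whose inner product is that
  of H1. The orthogonality relation is the weak equation.\<close>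

lemma laplace_resolvent:
  assumes S: "symmetric_interval S"
  shows "\<exists>u u'. (u, u') \<in> H1_graph S \<and> has_weak_deriv_on S u' (u - y) \<and>
    (\<forall>(k, k')\<in>H1_graph S. cinner (y - u) k = cinner u' k')"
proof -
  obtain p where p: "p \<in> H1_graph S" "\<And>q. q \<in> H1_graph S \<Longrightarrow> inner ((y, 0) - p) q = 0"
    using projection_theorem[OF subspace_H1_graph closed_H1_graph[OF symmetric_interval_sets[OF S]]]
    by metis
  define u u' where "u = fst p" and "u' = snd p"
  have orth: "cinner (y - u) k = cinner u' k'" if k: "(k, k') \<in> H1_graph S" for k k'
  proof -
    have *: "Re (cinner (y - u) (z *\<^sub>C k)) - Re (cinner u' (z *\<^sub>C k')) = 0" for z
      using p(2)[OF H1_graph_scaleC[OF k, of z]]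
      by (cases p) (simp add: inner_prod_def inner_eq_Re_cinner u_def u'_def cinner_minus_left)
    show ?thesis
      using *[of 1] *[of \<i>] unfolding Im_cinner[symmetric] by (simp add: complex_eq_iff)
  qed
  have "has_weak_deriv_on S u' (u - y)"
    unfolding has_weak_deriv_on_iff
  proof
    fix \<phi> assume "\<phi> \<in> test_functions S"
    from orth[OF H1_graph_emb[OF this, of 1, simplified]]
    show "cinner u' (emb (deriv \<phi>)) = - cinner (u - y) (emb \<phi>)" by (simp add: cinner_algebra)
  qed
  moreover have "(u, u') \<in> H1_graph S" using p(1) by (simp add: u_def u'_def)
  ultimately show ?thesis using orth by (intro exI[of _ u] exI[of _ u']) auto
qed

text \<open>The domain of the form operator; the Dirichlet condition is hidden in
  \<open>H1_graph\<close>. It is identified below with the domains on the line and on the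
  intervals.\<close>

definition sdom :: "real set \<Rightarrow> L2 set" where
  "sdom S = {f. \<exists>g h. (f, g) \<in> H1_graph S \<and> h \<in> L2_on S \<and> has_weak_deriv_on S g h}"

lemma sdomI: "(f, g) \<in> H1_graph S \<Longrightarrow> h \<in> L2_on S \<Longrightarrow> has_weak_deriv_on S g h \<Longrightarrow> f \<in> sdom S"
  by (auto simp: sdom_def)

lemma schroedinger_eq:
  assumes S: "symmetric_interval S" and f: "(f, g) \<in> H1_graph S" "h \<in> L2_on S" "has_weak_deriv_on S g h"
  shows "schroedinger V S f = - h + mult_op V f"
proof -
  have "has_weak_deriv_on S f g"
    using f(1) has_weak_deriv_on_subset[of UNIV f g S] by (auto simp: mem_H1_graph)
  then have "weak_deriv S f = g"
    by (rule weak_deriv_eq[OF symmetric_interval_open[OF S] H1_graph_deriv_L2_on[OF S f(1)]])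
  moreover have "weak_deriv S g = h"
    by (rule weak_deriv_eq[OF symmetric_interval_open[OF S] f(2,3)])
  ultimately show ?thesis by (simp add: schroedinger_def)
qed

lemma sdomE:
  assumes "symmetric_interval S" "f \<in> sdom S"
  obtains g h where "(f, g) \<in> H1_graph S" "h \<in> L2_on S" "has_weak_deriv_on S g h"
    "\<And>V. schroedinger V S f = - h + mult_op V f"
  using assms schroedinger_eq unfolding sdom_def by blast

lemma symmetric_interval_UNIV: "symmetric_interval UNIV"
  by (simp add: symmetric_interval_def)

lemma symmetric_interval_Ioo: "r > 0 \<Longrightarrow> symmetric_interval {-r<..<r}"
  by (auto simp: symmetric_interval_def)

lemma W22_UNIV_eq_sdom: "W22 UNIV = sdom UNIV"
  by (auto simp: W22_def sdom_def L2_on_UNIV mem_H1_graph)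

text \<open>The inclusion from left to right must show that extension by zero creates no jump.
  Compare \<open>f\<close> with the solution \<open>v\<close> of \<open>-v'' + v = f - f''\<close>
  that already extends by zero: \<open>f - v\<close> is a combination of exponentials with zero
  boundary values, so it vanishes.\<close>

lemma W22_dirichlet_eq_sdom:
  assumes r: "r > 0"
  shows "W22_dirichlet r = sdom {-r<..<r}"
proof (intro equalityI subsetI)
  let ?S = "{-r<..<r}"
  note S = symmetric_interval_Ioo[OF r]
  fix f assume "f \<in> sdom ?S"
  then obtain g h where f: "(f, g) \<in> H1_graph ?S" "h \<in> L2_on ?S" "has_weak_deriv_on ?S g h"
    by (rule sdomE[OF S])
  have "f \<in> L2_on ?S" "has_weak_deriv_on ?S f g"
    using f(1) has_weak_deriv_on_subset[of UNIV f g ?S] by (auto simp: mem_H1_graph)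
  then have "f \<in> W22 ?S"
    using f H1_graph_deriv_L2_on[OF S f(1)] by (auto simp: W22_def)
  moreover obtain u where u: "continuous_on UNIV u" "AE x in lebesgue. rep_L2 f x = u x"
    using H1_graph_continuous_rep[OF f(1)] by blast
  ultimately show "f \<in> W22_dirichlet r"
    unfolding W22_dirichlet_def agree_on.rep_eq using H1_graph_boundary[OF r f(1) u]
    by (auto intro!: exI[of _ u] continuous_on_subset[OF u(1)] elim!: eventually_mono)
next
  let ?S = "{-r<..<r}"
  note S = symmetric_interval_Ioo[OF r]
  fix f assume "f \<in> W22_dirichlet r"
  then have fW: "f \<in> W22 ?S" and "\<exists>u. continuous_on {-r..r} u \<and>
      (AE x in lebesgue. x \<in> ?S \<longrightarrow> rep_L2 f x = u x) \<and> u (-r) = 0 \<and> u r = 0"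
    by (simp_all add: W22_dirichlet_def agree_on.rep_eq)
  then obtain u where u: "continuous_on {-r..r} u" "AE x in lebesgue. x \<in> ?S \<longrightarrow> rep_L2 f x = u x"
      "u (-r) = 0" "u r = 0"
    by (elim exE conjE)
  have "f \<in> L2_on ?S \<and> (\<exists>g\<in>L2_on ?S. \<exists>h\<in>L2_on ?S. has_weak_deriv_on ?S f g \<and> has_weak_deriv_on ?S g h)"
    using fW by (simp add: W22_def)
  then obtain g h where f: "f \<in> L2_on ?S" "g \<in> L2_on ?S" "h \<in> L2_on ?S"
      "has_weak_deriv_on ?S f g" "has_weak_deriv_on ?S g h"
    by (elim conjE bexE)
  obtain v v' where v: "(v, v') \<in> H1_graph ?S" "has_weak_deriv_on ?S v' (v - (f - h))"
    using laplace_resolvent[OF S, of "f - h"] by (elim exE conjE)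
  have vL: "v \<in> L2_on ?S" and "has_weak_deriv_on ?S v v'"
    using v(1) has_weak_deriv_on_subset[of UNIV v v' ?S] by (auto simp: mem_H1_graph)
  then have d: "has_weak_deriv_on ?S (f - v) (g - v')"
    by (intro has_weak_deriv_on_diff f)
  have "has_weak_deriv_on ?S (g - v') (h - (v - (f - h)))"
    by (intro has_weak_deriv_on_diff f v)
  then have e: "has_weak_deriv_on ?S (g - v') (f - v)" by (simp add: algebra_simps)
  obtain P Q where PQ: "AE x in lebesgue. x \<in> ?S \<longrightarrow>
      rep_L2 (f - v) x = P * complex_of_real (exp x) + Q * complex_of_real (exp (- x))"
    using weak_exp_solution[OF symmetric_interval_open[OF S] symmetric_interval_is_interval[OF S] d e]
    by blast
  obtain w where w: "continuous_on UNIV w" "AE x in lebesgue. rep_L2 v x = w x"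
    using H1_graph_continuous_rep[OF v(1)] by blast
  have ae: "AE x in lebesgue. x \<in> ?S \<longrightarrow> u x - w x = P * complex_of_real (exp x) + Q * complex_of_real (exp (- x))"
    using PQ u(2) w(2) AE_rep_diff[of f v] by eventually_elim auto
  have c: "continuous_on {-r..r} (\<lambda>x. u x - w x)"
    by (intro continuous_on_diff u(1) continuous_on_subset[OF w(1)]) simp
  have "u (-r) - w (-r) = 0" "u r - w r = 0" using H1_graph_boundary[OF r v(1) w] u by simp_all
  from exp_solution_zero[OF r c this ae]
  have "AE x in lebesgue. x \<in> ?S \<longrightarrow> rep_L2 (f - v) x = 0" using PQ by simp
  moreover have "AE x in lebesgue. x \<notin> ?S \<longrightarrow> rep_L2 (f - v) x = 0"
    using csubspace_diff[OF csubspace_L2_on f(1) vL] by (simp add: mem_L2_on)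
  ultimately have "AE x in lebesgue. rep_L2 (f - v) x = rep_L2 0 x"
    using AE_rep_zero by eventually_elim auto
  then have "f = v" using L2_eqI by fastforce
  then show "f \<in> sdom ?S"
    using v f by (intro sdomI[of f v' _ h]) (simp_all add: algebra_simps)
qed

lemma schroedinger_form:
  assumes S: "symmetric_interval S" and f: "f \<in> sdom S" "(f, g) \<in> H1_graph S" and k: "(k, k') \<in> H1_graph S"
  shows "cinner (schroedinger V S f) k = cinner g k' + cinner (mult_op V f) k"
proof -
  obtain g' h where h: "(f, g') \<in> H1_graph S" "has_weak_deriv_on S g' h"
      "schroedinger V S f = - h + mult_op V f"
    using sdomE[OF S f(1)] by metis
  have "g' = g" using H1_graph_unique[OF h(1) f(2)] .
  then show ?thesis
    using weak_integration_by_parts[OF S h(2) k] by (simp add: h(3) cinner_algebra)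
qed

lemma csubspace_sdom: "csubspace (sdom S)"
  unfolding csubspace_def
proof (intro conjI ballI allI)
  note U = csubspace_L2_on[of S]
  show "0 \<in> sdom S"
    by (rule sdomI[of 0 0 S 0])
      (simp_all add: mem_H1_graph csubspace_zero[OF U] has_weak_deriv_on_zero)
  fix f k z
  assume f: "f \<in> sdom S"
  then show "z *\<^sub>C f \<in> sdom S"
    by (auto simp: sdom_def intro: H1_graph_scaleC csubspace_scaleC[OF U] has_weak_deriv_on_scaleC)
  assume "k \<in> sdom S"
  with f show "f + k \<in> sdom S"
    by (auto simp: sdom_def intro: H1_graph_add csubspace_add[OF U] has_weak_deriv_on_add)
qed

lemma schroedinger_pencil:
  assumes S: "symmetric_interval S" and V: "V \<in> L_infinity" and J: "J \<in> L_infinity"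
    and M: "\<And>f. norm (mult_op J f) \<le> M * norm f"
  shows "selfadjoint_pencil (L2_on S) (sdom S) (schroedinger V S) (mult_op J) M"
proof
  let ?T = "schroedinger V S"
  note U = csubspace_L2_on[of S]
  show "csubspace (L2_on S)" "closed (L2_on S)" "csubspace (sdom S)" "sdom S \<subseteq> L2_on S"
    using csubspace_L2_on closed_L2_on[OF symmetric_interval_sets[OF S]] csubspace_sdom
    by (auto simp: sdom_def mem_H1_graph)
  fix x y :: L2 and z
  show "?T x \<in> L2_on S" if "x \<in> sdom S"
    using that
    by (rule sdomE[OF S])
      (auto simp: mem_H1_graph intro!: csubspace_add[OF U] csubspace_diff[OF U] mult_op_L2_on V)
  show "?T (z *\<^sub>C x) = z *\<^sub>C ?T x" if x: "x \<in> sdom S"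
  proof -
    obtain g h where h: "(x, g) \<in> H1_graph S" "h \<in> L2_on S" "has_weak_deriv_on S g h"
        "?T x = - h + mult_op V x"
      using sdomE[OF S x] by metis
    show ?thesis
      unfolding h(4) schroedinger_eq[OF S H1_graph_scaleC[OF h(1)] csubspace_scaleC[OF U h(2)]
          has_weak_deriv_on_scaleC[OF h(3)]]
      by (simp add: mult_op_scaleC[OF V] scaleC_add_right scaleC_minus_right scaleC_diff_right)
  qed
  show "?T (x + y) = ?T x + ?T y" if x: "x \<in> sdom S" and y: "y \<in> sdom S"
  proof -
    obtain g h where h: "(x, g) \<in> H1_graph S" "h \<in> L2_on S" "has_weak_deriv_on S g h"
        "?T x = - h + mult_op V x"
      using sdomE[OF S x] by metis
    obtain g' h' where h': "(y, g') \<in> H1_graph S" "h' \<in> L2_on S" "has_weak_deriv_on S g' h'"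
        "?T y = - h' + mult_op V y"
      using sdomE[OF S y] by metis
    show ?thesis
      unfolding h(4) h'(4) schroedinger_eq[OF S H1_graph_add[OF h(1) h'(1)] csubspace_add[OF U h(2) h'(2)]
          has_weak_deriv_on_add[OF h(3) h'(3)]]
      by (simp add: mult_op_add[OF V])
  qed
  show "cinner (?T x) y = cinner x (?T y)" if x: "x \<in> sdom S" and y: "y \<in> sdom S"
  proof -
    obtain g where g: "(x, g) \<in> H1_graph S" using x by (auto simp: sdom_def)
    obtain g' where g': "(y, g') \<in> H1_graph S" using y by (auto simp: sdom_def)
    have "cinner x (?T y) = cnj (cinner (?T y) x)" by (rule cinner_commute)
    also have "\<dots> = cnj (cinner g' g) + cnj (cinner (mult_op V y) x)"
      by (simp add: schroedinger_form[OF S y g' g])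
    also have "\<dots> = cinner g g' + cinner (mult_op V x) y"
      by (simp add: mult_op_sym[OF V] flip: cinner_commute)
    finally show ?thesis by (simp add: schroedinger_form[OF S x g g'])
  qed
  show "mult_op J x \<in> L2_on S" if "x \<in> L2_on S"
    using that by (rule mult_op_L2_on[OF J])
  show "mult_op J (x + y) = mult_op J x + mult_op J y" "mult_op J (z *\<^sub>C x) = z *\<^sub>C mult_op J x"
    "cinner (mult_op J x) y = cinner x (mult_op J y)" "norm (mult_op J x) \<le> M * norm x"
    by (rule mult_op_add[OF J] mult_op_scaleC[OF J] mult_op_sym[OF J] M)+
  show "u \<in> sdom S \<and> ?T u = w"
    if u: "u \<in> L2_on S" and w: "w \<in> L2_on S" and eq: "\<And>x. x \<in> sdom S \<Longrightarrow> cinner (?T x) u = cinner x w"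
    for u w
  proof -
    \<comment> \<open>If \<open>u\<close> were in the domain, it would solve
      \<open>-u'' + u = y\<close>. Let \<open>v\<close> be the true solution of this equation and
      \<open>x\<close> that of the equation with right side \<open>u - v\<close>. Testing with
      \<open>x\<close> gives \<open>u - v\<close> the same inner product with \<open>u\<close> and
      with \<open>v\<close>, whence \<open>u = v\<close>.\<close>
    define y where "y = w - mult_op V u + u"
    have yL: "y \<in> L2_on S"
      unfolding y_def by (intro csubspace_add[OF U] csubspace_diff[OF U] u w mult_op_L2_on V)
    obtain v v' where v: "(v, v') \<in> H1_graph S" "has_weak_deriv_on S v' (v - y)"
        "\<forall>(k, k')\<in>H1_graph S. cinner (y - v) k = cinner v' k'"
      using laplace_resolvent[OF S, of y] by (elim exE conjE)
    have vL: "v \<in> L2_on S" using v(1) by (simp add: mem_H1_graph)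
    obtain x x' where x: "(x, x') \<in> H1_graph S" "has_weak_deriv_on S x' (x - (u - v))"
      using laplace_resolvent[OF S, of "u - v"] by (elim exE conjE)
    have xL: "x - (u - v) \<in> L2_on S"
      using x(1) by (intro csubspace_diff[OF U] u vL) (simp add: mem_H1_graph)
    have Tx: "?T x = - (x - (u - v)) + mult_op V x"
      by (rule schroedinger_eq[OF S x(1) xL x(2)])
    have "cinner (- (x - (u - v)) + mult_op V x) u = cinner x w"
      using eq[OF sdomI[OF x(1) xL x(2)]] by (simp add: Tx)
    then have 1: "cinner (u - v) u = cinner x y"
      by (simp add: y_def cinner_algebra mult_op_sym[OF V] algebra_simps)
    have "cinner (x - (u - v)) v = - cinner x' v'"
      by (rule weak_integration_by_parts[OF S x(2) v(1)])
    moreover have "cinner x (y - v) = cinner x' v'"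
      using bspec[OF v(3) x(1)] by (metis case_prod_conv cinner_commute)
    ultimately have 2: "cinner (u - v) v = cinner x y"
      by (simp add: cinner_algebra algebra_simps)
    have "cinner (u - v) (u - v) = 0" using 1 2 by (simp add: cinner_diff_right)
    then have "u = v" by (simp add: cinner_self)
    moreover have "v - y \<in> L2_on S" by (intro csubspace_diff[OF U] vL yL)
    ultimately show ?thesis
      using v(1,2) schroedinger_eq[OF S v(1) _ v(2), of V] sdomI[OF v(1) _ v(2)]
      by (simp add: y_def)
  qed
qed

section \<open>Form cores and approximation of the line by intervals\<close>

lemma subspace_closure:
  fixes U :: "'a::real_normed_vector set"
  assumes "subspace U"
  shows "subspace (closure U)"
  unfolding subspace_def
proof (intro conjI ballI allI)
  show "0 \<in> closure U" using subspace_0[OF assms] closure_subset by blast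
  fix x y :: 'a and c
  assume "x \<in> closure U"
  then obtain X where X: "\<And>n. X n \<in> U" "X \<longlonglongrightarrow> x" unfolding closure_sequential by blast
  have "(\<lambda>n. c *\<^sub>R X n) \<longlonglongrightarrow> c *\<^sub>R x" "\<And>n. c *\<^sub>R X n \<in> U"
    by (intro tendsto_intros X subspace_mul[OF assms])+
  then show "c *\<^sub>R x \<in> closure U"
    unfolding closure_sequential by (intro exI[of _ "\<lambda>n. c *\<^sub>R X n"]) simp
  assume "y \<in> closure U"
  then obtain Y where Y: "\<And>n. Y n \<in> U" "Y \<longlonglongrightarrow> y" unfolding closure_sequential by blast
  have "(\<lambda>n. X n + Y n) \<longlonglongrightarrow> x + y" "\<And>n. X n + Y n \<in> U"
    by (intro tendsto_intros X Y subspace_add[OF assms])+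
  then show "x + y \<in> closure U"
    unfolding closure_sequential by (intro exI[of _ "\<lambda>n. X n + Y n"]) simp
qed

lemma continuous_on_mult_op:
  assumes "V \<in> L_infinity" "continuous_on A f"
  shows "continuous_on A (\<lambda>x. mult_op V (f x))"
  using assms(2) tendsto_mult_op[OF assms(1)] unfolding continuous_on_def by blast

text \<open>The test functions form a form core, so lower bounds for the operator on the line carry over
  to \<open>H\<^sup>1\<close> and hence to all Dirichlet restrictions.\<close>

lemma form_lower_bound:
  assumes V: "V \<in> L_infinity"
    and c: "\<And>f. f \<in> sdom UNIV \<Longrightarrow> c * (norm f)\<^sup>2 \<le> Re (cinner (schroedinger V UNIV f) f)"
    and fg: "(f, g) \<in> H1_graph S"
  shows "c * (norm f)\<^sup>2 \<le> (norm g)\<^sup>2 + Re (cinner (mult_op V f) f)"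
proof -
  let ?U = "{(f, g). (f, g) \<in> H1_graph UNIV \<and> f \<in> sdom UNIV}"
  let ?X = "{p. c * (norm (fst p))\<^sup>2 \<le> (norm (snd p))\<^sup>2 + Re (cinner (mult_op V (fst p)) (fst p))}"
  have sub: "subspace ?U"
    using subspace_H1_graph[of UNIV] csubspace_imp_subspace[OF csubspace_sdom, of UNIV]
    unfolding subspace_def
    by (auto simp: zero_prod_def intro: H1_graph_add H1_graph_scaleC[of _ _ _ "complex_of_real _", unfolded scaleC_of_real])
  have "(f, g) \<in> closure ?U"
  proof (rule H1_graph_dense[OF symmetric_interval_UNIV subspace_closure[OF sub] closed_closure])
    fix \<phi> z assume \<phi>: "\<phi> \<in> test_functions UNIV"
    have "z *\<^sub>C emb \<phi> \<in> sdom UNIV"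
      by (rule sdomI[OF H1_graph_emb[OF \<phi>], of "z *\<^sub>C emb (deriv (deriv \<phi>))"])
        (simp_all add: L2_on_UNIV has_weak_deriv_on_scaleC emb_weak_deriv[OF test_deriv[OF \<phi>]])
    then show "(z *\<^sub>C emb \<phi>, z *\<^sub>C emb (deriv \<phi>)) \<in> closure ?U"
      using H1_graph_emb[OF \<phi>, of z] by (intro subsetD[OF closure_subset]) simp
  next
    show "(f, g) \<in> H1_graph UNIV" using fg H1_graph_mono[of S UNIV] by auto
  qed
  also have "closure ?U \<subseteq> ?X"
  proof (rule closure_minimal)
    show "?U \<subseteq> ?X"
    proof clarify
      fix f g assume fg: "(f, g) \<in> H1_graph UNIV" "f \<in> sdom UNIV"
      show "c * (norm (fst (f, g)))\<^sup>2 \<le> (norm (snd (f, g)))\<^sup>2 + Re (cinner (mult_op V (fst (f, g))) (fst (f, g)))"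
        using c[OF fg(2)] schroedinger_form[OF symmetric_interval_UNIV fg(2,1,1), of V]
        by (simp add: cinner_self)
    qed
    show "closed ?X"
      by (intro closed_Collect_le continuous_intros continuous_on_mult_op V
          bounded_bilinear.continuous_on[OF bounded_bilinear_cinner])
  qed
  finally show ?thesis by simp
qed

lemma tendsto_restrict:
  "(\<lambda>n. mult_op (indicator {- real n<..<real n}) f) \<longlonglongrightarrow> f"
proof -
  have lim: "(\<lambda>n. \<integral>x. (cmod (rep_L2 (mult_op (indicator {- real n<..<real n}) f - f) x))\<^sup>2 \<partial>lebesgue)
      \<longlonglongrightarrow> (\<integral>x. 0 \<partial>(lebesgue :: real measure))"
  proof (rule integral_dominated_convergence[where f = "\<lambda>_. 0::real" and w = "\<lambda>x. (cmod (rep_L2 f x))\<^sup>2"])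
    have "AE x in lebesgue. \<forall>n. rep_L2 (mult_op (indicator {- real n<..<real n}) f - f) x =
        (indicator {- real n<..<real n} x - 1) * rep_L2 f x"
    proof (subst AE_all_countable, intro allI)
      fix n
      show "AE x in lebesgue. rep_L2 (mult_op (indicator {- real n<..<real n}) f - f) x =
          (indicator {- real n<..<real n} x - 1) * rep_L2 f x"
        using AE_rep_mult_op[OF indicator_L_infinity[OF sets_lebesgue_open[of "{- real n<..<real n}"]], of f]
          AE_rep_diff[of "mult_op (indicator {- real n<..<real n}) f" f]
        by simp (auto elim!: eventually_elim2 simp: left_diff_distrib split: split_indicator)
    qed
    note AE = this
    show "AE x in lebesgue. (\<lambda>n. (cmod (rep_L2 (mult_op (indicator {- real n<..<real n}) f - f) x))\<^sup>2) \<longlonglongrightarrow> 0"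
      using AE
    proof eventually_elim
      case (elim x)
      obtain N where N: "\<bar>x\<bar> < real N" using reals_Archimedean2 by blast
      have "\<forall>\<^sub>F n in sequentially. (cmod (rep_L2 (mult_op (indicator {- real n<..<real n}) f - f) x))\<^sup>2 = 0"
        unfolding eventually_sequentially elim[rule_format]
        by (intro exI[of _ N]) (use N in \<open>auto simp: indicator_def\<close>)
      then show ?case by (rule tendsto_eventually)
    qed
    show "AE x in lebesgue. norm ((cmod (rep_L2 (mult_op (indicator {- real n<..<real n}) f - f) x))\<^sup>2)
        \<le> (cmod (rep_L2 f x))\<^sup>2" for n
      using AE by eventually_elim (simp split: split_indicator)
  qed (auto intro: integrable_rep_square)
  then have "(\<lambda>n. (norm (mult_op (indicator {- real n<..<real n}) f - f))\<^sup>2) \<longlonglongrightarrow> 0"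
    by (simp add: norm_L2_square)
  then have "(\<lambda>n. sqrt ((norm (mult_op (indicator {- real n<..<real n}) f - f))\<^sup>2)) \<longlonglongrightarrow> sqrt 0"
    by (rule tendsto_real_sqrt)
  then have "(\<lambda>n. mult_op (indicator {- real n<..<real n}) f - f) \<longlonglongrightarrow> 0"
    by (simp add: tendsto_norm_zero_iff)
  then show ?thesis by (rule LIM_zero_cancel)
qed

text \<open>The Dirichlet solutions \<open>F n\<close> of \<open>-u'' + u = y\<close> on \<open>(-n, n)\<close> are the \<open>H\<^sup>1\<close>-orthogonal
  projections of the solution on the line.\<close>

lemma schroedinger_consistent:
  assumes V: "V \<in> L_infinity" and f: "f \<in> sdom UNIV"
  shows "\<exists>F. (\<forall>n>0. F n \<in> sdom {- real n<..<real n}) \<and> F \<longlonglongrightarrow> f \<and>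
    (\<lambda>n. schroedinger V {- real n<..<real n} (F n)) \<longlonglongrightarrow> schroedinger V UNIV f"
proof -
  let ?S = "\<lambda>n. {- real n<..<real n}"
  obtain g h where gh: "(f, g) \<in> H1_graph UNIV" "has_weak_deriv_on UNIV g h"
      "schroedinger V UNIV f = - h + mult_op V f"
    using sdomE[OF symmetric_interval_UNIV f] by metis
  define y where "y = f - h"
  define Y where "Y n = mult_op (indicator (?S n)) y" for n
  have sets: "?S n \<in> sets lebesgue" for n by (intro sets_lebesgue_open) auto
  have YL: "Y n \<in> L2_on (?S n)" for n unfolding Y_def by (rule restrict_L2_on[OF sets])
  have "\<exists>u u'. n > 0 \<longrightarrow> (u, u') \<in> H1_graph (?S n) \<and> has_weak_deriv_on (?S n) u' (u - Y n) \<and>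
      (\<forall>(k, k')\<in>H1_graph (?S n). cinner (Y n - u) k = cinner u' k')" for n
  proof (cases "n > 0")
    case True
    then show ?thesis
      using laplace_resolvent[OF symmetric_interval_Ioo[of "real n"], of "Y n"] by auto
  qed simp
  then obtain F where "\<forall>n. \<exists>u'. n > 0 \<longrightarrow> (F n, u') \<in> H1_graph (?S n) \<and>
      has_weak_deriv_on (?S n) u' (F n - Y n) \<and>
      (\<forall>(k, k')\<in>H1_graph (?S n). cinner (Y n - F n) k = cinner u' k')"
    by metis
  then obtain F' where FF': "\<forall>n. n > 0 \<longrightarrow> (F n, F' n) \<in> H1_graph (?S n) \<and>
      has_weak_deriv_on (?S n) (F' n) (F n - Y n) \<and>
      (\<forall>(k, k')\<in>H1_graph (?S n). cinner (Y n - F n) k = cinner (F' n) k')"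
    by metis
  have F: "\<And>n. n > 0 \<Longrightarrow> (F n, F' n) \<in> H1_graph (?S n)"
      "\<And>n. n > 0 \<Longrightarrow> has_weak_deriv_on (?S n) (F' n) (F n - Y n)"
      "\<And>n k k'. n > 0 \<Longrightarrow> (k, k') \<in> H1_graph (?S n) \<Longrightarrow> cinner (Y n - F n) k = cinner (F' n) k'"
    using FF' by blast+
  have FL: "F n - Y n \<in> L2_on (?S n)" if "n > 0" for n
    using F(1)[OF that] by (intro csubspace_diff[OF csubspace_L2_on] YL) (simp add: mem_H1_graph)
  have best: "norm ((f, g) - (F n, F' n)) \<le> norm ((f, g) - p)" if n: "n > 0" and p: "p \<in> H1_graph (?S n)" for n p
  proof -
    obtain k k' where k: "p = (k, k')" by (cases p)
    have orth: "inner ((f, g) - (F n, F' n)) q = 0" if q: "q \<in> H1_graph (?S n)" for q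
    proof -
      obtain k k' where k: "q = (k, k')" by (cases q)
      have kk: "(k, k') \<in> H1_graph (?S n)" using q k by simp
      have "cinner (Y n) k = cinner y k"
        using restrict_L2_on_eq[OF sets, of k n] kk
        by (simp add: Y_def mult_op_sym[OF indicator_L_infinity[OF sets]] mem_H1_graph)
      then have "cinner (y - F n) k = cinner (F' n) k'"
        using F(3)[OF n kk] by (simp add: cinner_diff_left)
      moreover have "(k, k') \<in> H1_graph UNIV" using kk H1_graph_mono[of "?S n" UNIV] by auto
      from weak_integration_by_parts[OF symmetric_interval_UNIV gh(2) this]
      have "cinner h k = - cinner g k'" .
      ultimately have "cinner (f - F n) k + cinner (g - F' n) k' = 0"
        by (simp add: y_def cinner_algebra algebra_simps)
      then show ?thesis
        unfolding k by (simp add: inner_prod_def inner_eq_Re_cinner flip: plus_complex.sel(1))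
    qed
    have "(F n, F' n) - p \<in> H1_graph (?S n)" by (intro subspace_diff[OF subspace_H1_graph] F(1) n p)
    from orth[OF this] have "(norm ((f, g) - p))\<^sup>2 = (norm ((f, g) - (F n, F' n)))\<^sup>2 + (norm ((F n, F' n) - p))\<^sup>2"
      using norm_add_Pythagorean[of "(f, g) - (F n, F' n)" "(F n, F' n) - p"]
      by (simp only: orthogonal_def add_diff_eq diff_add_cancel)
    then have "(norm ((f, g) - (F n, F' n)))\<^sup>2 \<le> (norm ((f, g) - p))\<^sup>2" by simp
    then show ?thesis by (rule power2_le_imp_le) simp
  qed
  \<comment> \<open>The spaces increase and their union contains every test function, so it is dense
    in the graph on the line; best approximation then forces convergence.\<close>
  let ?U = "\<Union>n. H1_graph (?S n)"
  have mono: "H1_graph (?S m) \<subseteq> H1_graph (?S n)" if "m \<le> n" for m n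
    using that by (intro H1_graph_mono) auto
  have "subspace ?U"
    unfolding subspace_def
  proof (intro conjI ballI allI)
    show "0 \<in> ?U" using subspace_0[OF subspace_H1_graph] by blast
    fix p q :: "L2 \<times> L2" and c
    assume p: "p \<in> ?U"
    then show "c *\<^sub>R p \<in> ?U" using subspace_mul[OF subspace_H1_graph] by blast
    assume q: "q \<in> ?U"
    obtain m n where "p \<in> H1_graph (?S m)" "q \<in> H1_graph (?S n)" using p q by blast
    then have "p \<in> H1_graph (?S (max m n))" "q \<in> H1_graph (?S (max m n))"
      using mono[of m "max m n"] mono[of n "max m n"] by auto
    then show "p + q \<in> ?U" using subspace_add[OF subspace_H1_graph] by blast
  qed
  then have "(f, g) \<in> closure ?U"
  proof (intro H1_graph_dense[OF symmetric_interval_UNIV subspace_closure closed_closure _ gh(1)])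
    fix \<phi> z assume "\<phi> \<in> test_functions UNIV"
    then obtain K where K: "smooth \<phi>" "compact K" "\<And>x. x \<notin> K \<Longrightarrow> \<phi> x = 0"
      by (auto simp: test_functions_iff)
    obtain B where B: "\<And>x. x \<in> K \<Longrightarrow> \<bar>x\<bar> \<le> B"
      using compact_imp_bounded[OF K(2)] by (auto simp: bounded_iff)
    obtain n where n: "B < real n" using reals_Archimedean2 by blast
    have "K \<subseteq> ?S n" using B n by fastforce
    then have "\<phi> \<in> test_functions (?S n)" using K by (auto simp: test_functions_iff)
    from H1_graph_emb[OF this, of z] show "(z *\<^sub>C emb \<phi>, z *\<^sub>C emb (deriv \<phi>)) \<in> closure ?U"
      by (intro subsetD[OF closure_subset] UN_I) simp_all
  qed
  have FF: "(\<lambda>n. (F n, F' n)) \<longlonglongrightarrow> (f, g)"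
  proof (rule metric_LIMSEQ_I)
    fix e :: real assume "e > 0"
    then obtain p where "p \<in> ?U" "dist p (f, g) < e"
      using \<open>(f, g) \<in> closure ?U\<close> unfolding closure_approachable by blast
    then obtain m where m: "p \<in> H1_graph (?S m)" "dist p (f, g) < e" by blast
    show "\<exists>N. \<forall>n\<ge>N. dist (F n, F' n) (f, g) < e"
    \<comment> \<open>\<open>Suc m\<close> keeps \<open>n\<close> positive.\<close>
    proof (intro exI[of _ "Suc m"] allI impI)
      fix n assume n: "n \<ge> Suc m"
      then have "norm ((f, g) - (F n, F' n)) \<le> norm ((f, g) - p)"
        using mono[of m n] m(1) by (intro best) auto
      then show "dist (F n, F' n) (f, g) < e"
        using m(2) by (simp only: dist_norm norm_minus_commute[of _ "(f, g)"])
    qed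
  qed
  have Flim: "F \<longlonglongrightarrow> f" using tendsto_fst[OF FF] by simp
  \<comment> \<open>Convergence in H1 does not control second derivatives; the equation does, as it
    expresses \<open>-F''\<close> by \<open>Y n - F n\<close>.\<close>
  have "(\<lambda>n. - (F n - Y n) + mult_op V (F n)) \<longlonglongrightarrow> - (f - y) + mult_op V f"
    unfolding Y_def by (intro tendsto_intros Flim tendsto_mult_op V tendsto_restrict)
  then have "(\<lambda>n. - (F n - Y n) + mult_op V (F n)) \<longlonglongrightarrow> schroedinger V UNIV f"
    by (simp add: gh(3) y_def)
  moreover have "\<forall>\<^sub>F n in sequentially. - (F n - Y n) + mult_op V (F n) = schroedinger V (?S n) (F n)"
    unfolding eventually_sequentially
    by (intro exI[of _ 1] allI impI schroedinger_eq[symmetric, OF symmetric_interval_Ioo F(1) FL F(2)]) auto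
  ultimately have "(\<lambda>n. schroedinger V (?S n) (F n)) \<longlonglongrightarrow> schroedinger V UNIV f"
    by (rule Lim_transform_eventually)
  moreover have "\<forall>n>0. F n \<in> sdom (?S n)"
    using sdomI[OF F(1) FL F(2)] by blast
  ultimately show ?thesis using Flim by blast
qed

section \<open>Coercivity up to finite rank\<close>

lemma sets_lebesgue_Ioc: "{a<..b::real} \<in> sets lebesgue"
  by (simp add: sets_completionI_sets)

lemma AE_rep_restrict:
  "AE x in lebesgue. rep_L2 (mult_op (indicator {a<..b}) f) x = indicat_real {a<..b} x *\<^sub>R rep_L2 f x"
  using AE_rep_mult_op[OF indicator_L_infinity[OF sets_lebesgue_Ioc], of a b f]
  by (simp add: scaleR_conv_of_real)

lemma norm_restrict_square:
  "(norm (mult_op (indicator {a<..b}) f))\<^sup>2 =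
    (\<integral>x. indicator {a<..b} x * (cmod (rep_L2 f x))\<^sup>2 \<partial>lebesgue)"
  unfolding norm_L2_square
proof (rule integral_cong_AE)
  show "AE x in lebesgue. (cmod (rep_L2 (mult_op (indicator {a<..b}) f) x))\<^sup>2 =
      indicator {a<..b} x * (cmod (rep_L2 f x))\<^sup>2"
    using AE_rep_restrict[of a b f] by eventually_elim (simp split: split_indicator)
  show "(\<lambda>x. indicator {a<..b} x * (cmod (rep_L2 f x))\<^sup>2) \<in> borel_measurable lebesgue"
    using borel_measurable_integrable[OF integrable_indicator_Ioc[of a b]] by simp
qed simp

lemma integrable_restrict_square:
  "integrable lebesgue (\<lambda>x. indicator {a<..b} x * (cmod (rep_L2 f x))\<^sup>2)"
  using integrable_mult_indicator[OF sets_lebesgue_Ioc integrable_rep_square[of f], of a b] by simp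

text \<open>Only the part of \<open>g\<close> on \<open>(a, b]\<close> enters, so that estimates on
  disjoint intervals can be added without loss.\<close>

lemma prim_bound_restrict:
  assumes "a \<le> x" "x \<le> b" "a \<le> y" "y \<le> b"
  shows "cmod (prim g x - prim g y) \<le> norm (mult_op (indicator {a<..b}) g) * sqrt (b - a)"
proof -
  let ?g = "mult_op (indicator {a<..b}) g"
  have eq: "prim g y - prim g x = prim ?g y - prim ?g x" if "a \<le> x" "x \<le> y" "y \<le> b" for x y
    unfolding prim_diff[OF that(2)]
  proof (rule integral_cong_AE)
    show "AE t in lebesgue. indicat_real {x<..y} t *\<^sub>R rep_L2 g t = indicat_real {x<..y} t *\<^sub>R rep_L2 ?g t"
      using AE_rep_restrict[of a b g] by eventually_elim (use that in \<open>auto split: split_indicator\<close>)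
  qed (rule borel_measurable_integrable[OF integrable_rep_Ioc])+
  have "prim g x - prim g y = prim ?g x - prim ?g y"
    using eq[of x y] eq[of y x] assms by (cases "x \<le> y") (auto simp: algebra_simps)
  then have "cmod (prim g x - prim g y) \<le> norm ?g * sqrt \<bar>x - y\<bar>" by (simp add: prim_bound)
  also have "\<dots> \<le> norm ?g * sqrt (b - a)"
    using assms by (intro mult_left_mono real_sqrt_le_mono) auto
  finally show ?thesis .
qed

text \<open>A primitive differs from its mean \<open>A / h\<close> by at most \<open>G\<close> at
  every point of the interval; squaring and integrating over the length \<open>h\<close> gives the
  constants.\<close>

lemma poincare_interval:
  assumes fg: "(f, g) \<in> H1_graph UNIV" and ab: "a < b"
  shows "(norm (mult_op (indicator {a<..b}) f))\<^sup>2 \<le>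
    2 * (b - a)\<^sup>2 * (norm (mult_op (indicator {a<..b}) g))\<^sup>2 + 2 / (b - a) * (cmod (cinner f (box_L2 a b)))\<^sup>2"
proof -
  obtain C where C: "AE x in lebesgue. rep_L2 f x = C + prim g x"
    using du_bois_reymond[of UNIV f g] fg by (auto simp: mem_H1_graph)
  define u where "u x = C + prim g x" for x
  define h where "h = b - a"
  have h: "h > 0" using ab by (simp add: h_def)
  define G where "G = norm (mult_op (indicator {a<..b}) g) * sqrt h"
  define A where "A = cinner f (box_L2 a b)"
  have cu: "continuous_on {a..b} u" unfolding u_def by (intro continuous_intros prim_continuous)
  have iu: "integrable lebesgue (\<lambda>y. indicat_real {a<..b} y *\<^sub>R u y)"
  proof (rule integrable_cong_AE_imp[OF integrable_rep_Ioc[of a b f]])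
    have "u \<in> borel_measurable borel"
      unfolding u_def by (intro borel_measurable_continuous_onI continuous_intros prim_continuous)
    then have "(\<lambda>y. indicat_real {a<..b} y *\<^sub>R u y) \<in> borel_measurable lborel" by simp
    then show "(\<lambda>y. indicat_real {a<..b} y *\<^sub>R u y) \<in> borel_measurable lebesgue"
      by (rule measurable_completion)
    show "AE x in lebesgue. indicat_real {a<..b} x *\<^sub>R rep_L2 f x = indicat_real {a<..b} x *\<^sub>R u x"
      using C by eventually_elim (simp add: u_def)
  qed
  have A: "A = (\<integral>y. indicat_real {a<..b} y *\<^sub>R u y \<partial>lebesgue)"
    unfolding A_def cinner_box
  proof (rule integral_cong_AE)
    show "AE x in lebesgue. indicat_real {a<..b} x *\<^sub>R rep_L2 f x = indicat_real {a<..b} x *\<^sub>R u x"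
      using C by eventually_elim (simp add: u_def)
  qed (use iu integrable_rep_Ioc in \<open>auto intro: borel_measurable_integrable\<close>)
  have bound: "(cmod (u x))\<^sup>2 \<le> 2 * G\<^sup>2 + 2 * (cmod A)\<^sup>2 / h\<^sup>2" if x: "x \<in> {a<..b}" for x
  proof -
    have ic: "integrable lebesgue (\<lambda>y. indicat_real {a<..b} y *\<^sub>R u x)"
      by (intro integrable_scaleR_left integrable_indicator_Ioc)
    have "h *\<^sub>R u x - A = (\<integral>y. indicat_real {a<..b} y *\<^sub>R u x - indicat_real {a<..b} y *\<^sub>R u y \<partial>lebesgue)"
      unfolding A Bochner_Integration.integral_diff[OF ic iu]
      using ab by (simp add: measure_completion integrable_indicator_Ioc h_def)
    also have "cmod \<dots> \<le> (\<integral>y. norm (indicat_real {a<..b} y *\<^sub>R u x - indicat_real {a<..b} y *\<^sub>R u y) \<partial>lebesgue)"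
      by (rule integral_norm_bound)
    also have "\<dots> \<le> (\<integral>y. indicat_real {a<..b} y * G \<partial>lebesgue)"
    proof (rule integral_mono)
      show "integrable lebesgue (\<lambda>y. norm (indicat_real {a<..b} y *\<^sub>R u x - indicat_real {a<..b} y *\<^sub>R u y))"
        by (intro integrable_norm Bochner_Integration.integrable_diff ic iu)
      show "integrable lebesgue (\<lambda>y. indicat_real {a<..b} y * G)"
        by (intro integrable_mult_left integrable_indicator_Ioc)
      fix y
      show "norm (indicat_real {a<..b} y *\<^sub>R u x - indicat_real {a<..b} y *\<^sub>R u y) \<le> indicat_real {a<..b} y * G"
        using prim_bound_restrict[of a x b y g] x
        by (auto simp: u_def G_def h_def split: split_indicator)
    qed
    also have "\<dots> = h * G" using ab by (simp add: measure_completion h_def)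
    finally have "cmod (h *\<^sub>R u x - A) \<le> h * G" .
    then have "cmod (h *\<^sub>R u x) \<le> h * G + cmod A"
      using norm_triangle_sub[of "h *\<^sub>R u x" A] by linarith
    then have "cmod (u x) \<le> G + cmod A / h" using h by (simp add: field_simps)
    then have "(cmod (u x))\<^sup>2 \<le> (G + cmod A / h)\<^sup>2" by (intro power_mono) auto
    also have "\<dots> \<le> 2 * G\<^sup>2 + 2 * (cmod A / h)\<^sup>2"
      using sum_squares_bound[of G "cmod A / h"] by (simp add: power2_sum)
    finally show ?thesis by (simp add: power_divide)
  qed
  have "(norm (mult_op (indicator {a<..b}) f))\<^sup>2 \<le>
      (\<integral>x. indicat_real {a<..b} x * (2 * G\<^sup>2 + 2 * (cmod A)\<^sup>2 / h\<^sup>2) \<partial>lebesgue)"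
    unfolding norm_restrict_square
  proof (rule integral_mono_AE)
    show "AE x in lebesgue. indicator {a<..b} x * (cmod (rep_L2 f x))\<^sup>2 \<le>
        indicat_real {a<..b} x * (2 * G\<^sup>2 + 2 * (cmod A)\<^sup>2 / h\<^sup>2)"
      using C by eventually_elim (use bound in \<open>auto simp: u_def split: split_indicator\<close>)
  qed (intro integrable_restrict_square integrable_mult_left integrable_indicator_Ioc)+
  also have "\<dots> = h * (2 * G\<^sup>2 + 2 * (cmod A)\<^sup>2 / h\<^sup>2)"
    using ab by (simp add: measure_completion h_def)
  also have "\<dots> = 2 * h\<^sup>2 * (norm (mult_op (indicator {a<..b}) g))\<^sup>2 + 2 / h * (cmod A)\<^sup>2"
    using h by (simp add: G_def power_mult_distrib) (simp add: power2_eq_square field_simps)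
  finally show ?thesis by (simp add: h_def A_def)
qed

lemma sum_indicator_Ioc:
  fixes p :: "nat \<Rightarrow> real"
  assumes "mono p"
  shows "(\<Sum>j<N. indicat_real {p j<..p (Suc j)} x) = indicator {p 0<..p N} x"
proof (induction N)
  case (Suc N)
  have "p 0 \<le> p N" "p N \<le> p (Suc N)" using assms by (auto intro: monoD)
  then show ?case using Suc by (auto simp: indicator_def)
qed simp

lemma sum_norm_restrict:
  fixes p :: "nat \<Rightarrow> real"
  assumes "mono p"
  shows "(\<Sum>j<N. (norm (mult_op (indicator {p j<..p (Suc j)}) f))\<^sup>2) =
    (norm (mult_op (indicator {p 0<..p N}) f))\<^sup>2"
  unfolding norm_restrict_square sum_indicator_Ioc[OF assms, symmetric] sum_distrib_right
  by (rule Bochner_Integration.integral_sum[symmetric]) (rule integrable_restrict_square)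

lemma Re_cinner_mult_op:
  assumes "W \<in> L_infinity"
  shows "Re (cinner (mult_op W f) f) = (\<integral>x. W x * (cmod (rep_L2 f x))\<^sup>2 \<partial>lebesgue)"
    and "integrable lebesgue (\<lambda>x. W x * (cmod (rep_L2 f x))\<^sup>2)"
proof -
  let ?F = "\<lambda>x. rep_L2 (mult_op W f) x * cnj (rep_L2 f x)"
  have F: "integrable lebesgue ?F" by (intro integrable_cinner square_integrable_rep_L2)
  have AE: "AE x in lebesgue. Re (?F x) = W x * (cmod (rep_L2 f x))\<^sup>2"
    using AE_rep_mult_op[OF assms, of f]
  proof eventually_elim
    case (elim x)
    have "?F x = complex_of_real (W x * (cmod (rep_L2 f x))\<^sup>2)"
      unfolding elim mult.assoc complex_norm_square[symmetric] by simp
    then show ?case by (simp only: Re_complex_of_real)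
  qed
  have m: "(\<lambda>x. W x * (cmod (rep_L2 f x))\<^sup>2) \<in> borel_measurable lebesgue"
    using assms by (auto simp: L_infinity_def)
  show "Re (cinner (mult_op W f) f) = (\<integral>x. W x * (cmod (rep_L2 f x))\<^sup>2 \<partial>lebesgue)"
    unfolding cinner_L2.rep_eq integral_Re[OF F, symmetric]
    by (rule integral_cong_AE[OF borel_measurable_integrable[OF integrable_Re[OF F]] m AE])
  show "integrable lebesgue (\<lambda>x. W x * (cmod (rep_L2 f x))\<^sup>2)"
    by (rule integrable_cong_AE_imp[OF integrable_Re[OF F] m]) (use AE in \<open>auto elim!: eventually_mono\<close>)
qed

text \<open>Inside \<open>[-R, R]\<close> the potential may be negative, but on short cells
  Poincare's inequality trades the norm of \<open>f\<close> for a small multiple of that of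
  \<open>g\<close> plus the cell means. The means are the finite-rank term.\<close>

lemma coercive_up_to_finite_rank:
  assumes W: "W \<in> L_infinity" and w0: "w0 > 0" and R: "R > 0"
    and far: "AE x in lebesgue. \<bar>x\<bar> \<ge> R \<longrightarrow> w0 \<le> W x"
  shows "\<exists>C \<Phi>. finite \<Phi> \<and> (\<forall>(f, g)\<in>H1_graph UNIV. w0 * (norm f)\<^sup>2 \<le>
    (norm g)\<^sup>2 + Re (cinner (mult_op W f) f) + C * (\<Sum>\<phi>\<in>\<Phi>. (cmod (cinner f \<phi>))\<^sup>2))"
proof -
  obtain M0 where M0: "AE x in lebesgue. \<bar>W x\<bar> \<le> M0" using W by (auto simp: L_infinity_def)
  \<comment> \<open>Large enough that \<open>w0 - M\<close> is a lower bound for \<open>W\<close> on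
    the middle part.\<close>
  define M where "M = \<bar>M0\<bar> + w0"
  have M: "M > 0" using w0 by (simp add: M_def)
  \<comment> \<open>With \<open>h = 2 R / N\<close> the requirement
    \<open>M * (2 * h\<^sup>2) \<le> 1\<close> reads \<open>8 R\<^sup>2 M \<le> N\<^sup>2\<close>;
    the added 1 ensures \<open>N \<ge> 1\<close>.\<close>
  obtain N where N: "8 * R\<^sup>2 * M + 1 < real N" using reals_Archimedean2 by blast
  have N1: "real N \<ge> 1" using N M by (smt (verit) mult_nonneg_nonneg zero_le_power2)
  define h where "h = 2 * R / real N"
  have h: "h > 0" using R N1 by (simp add: h_def)
  have Mh: "M * (2 * h\<^sup>2) \<le> 1"
  proof -
    have "M * (2 * h\<^sup>2) = (8 * R\<^sup>2 * M) / (real N)\<^sup>2" by (simp add: h_def power2_eq_square)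
    also have "\<dots> \<le> real N / (real N)\<^sup>2" using N by (intro divide_right_mono) auto
    also have "\<dots> \<le> 1" using N1 by (simp add: power2_eq_square)
    finally show ?thesis .
  qed
  define p where "p j = - R + real j * h" for j
  have p: "mono p" "p 0 = - R" "p N = R" and pd: "p (Suc j) - p j = h" for j
  proof -
    show "mono p" using h by (auto simp: p_def mono_def intro: mult_right_mono)
    show "p 0 = - R" "p N = R" using N1 by (simp_all add: p_def h_def)
    show "p (Suc j) - p j = h" for j by (simp add: p_def algebra_simps)
  qed
  define b where "b j = box_L2 (p j) (p (Suc j))" for j
  let ?\<Phi> = "b ` {..<N}"
  have "w0 * (norm f)\<^sup>2 \<le> (norm g)\<^sup>2 + Re (cinner (mult_op W f) f) +
      (M * (2 / h) * real N) * (\<Sum>\<phi>\<in>?\<Phi>. (cmod (cinner f \<phi>))\<^sup>2)" if fg: "(f, g) \<in> H1_graph UNIV" for f g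
  proof -
    have "w0 * (norm f)\<^sup>2 - M * (norm (mult_op (indicator {-R<..R}) f))\<^sup>2 =
        (\<integral>x. w0 * (cmod (rep_L2 f x))\<^sup>2 - M * (indicator {-R<..R} x * (cmod (rep_L2 f x))\<^sup>2) \<partial>lebesgue)"
      unfolding norm_restrict_square norm_L2_square[of f]
      using integrable_rep_square[of f] integrable_restrict_square[of "-R" R f]
      by (simp only: Bochner_Integration.integral_diff integrable_mult_right integral_mult_right_zero)
    also have "\<dots> \<le> Re (cinner (mult_op W f) f)"
      unfolding Re_cinner_mult_op(1)[OF W]
    proof (rule integral_mono_AE)
      show "integrable lebesgue (\<lambda>x. w0 * (cmod (rep_L2 f x))\<^sup>2 - M * (indicator {-R<..R} x * (cmod (rep_L2 f x))\<^sup>2))"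
        by (intro Bochner_Integration.integrable_diff integrable_mult_right integrable_rep_square integrable_restrict_square)
      show "integrable lebesgue (\<lambda>x. W x * (cmod (rep_L2 f x))\<^sup>2)" by (rule Re_cinner_mult_op(2)[OF W])
      show "AE x in lebesgue. w0 * (cmod (rep_L2 f x))\<^sup>2 - M * (indicator {-R<..R} x * (cmod (rep_L2 f x))\<^sup>2)
          \<le> W x * (cmod (rep_L2 f x))\<^sup>2"
        using far M0
      proof eventually_elim
        case (elim x)
        have "w0 - M * indicator {-R<..R} x \<le> W x"
          using elim R by (auto simp: M_def split: split_indicator)
        then have "(w0 - M * indicator {-R<..R} x) * (cmod (rep_L2 f x))\<^sup>2 \<le> W x * (cmod (rep_L2 f x))\<^sup>2"
          by (rule mult_right_mono) simp
        then show ?case by (simp add: algebra_simps)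
      qed
    qed
    finally have 1: "w0 * (norm f)\<^sup>2 \<le> Re (cinner (mult_op W f) f) + M * (norm (mult_op (indicator {-R<..R}) f))\<^sup>2"
      by simp
    have "(norm (mult_op (indicator {-R<..R}) f))\<^sup>2 = (\<Sum>j<N. (norm (mult_op (indicator {p j<..p (Suc j)}) f))\<^sup>2)"
      using sum_norm_restrict[OF p(1), of f N] by (simp add: p)
    also have "\<dots> \<le> (\<Sum>j<N. 2 * h\<^sup>2 * (norm (mult_op (indicator {p j<..p (Suc j)}) g))\<^sup>2 +
        2 / h * (cmod (cinner f (b j)))\<^sup>2)"
      using poincare_interval[OF fg, of "p j" "p (Suc j)" for j] h pd
      by (intro sum_mono) (metis b_def diff_gt_0_iff_gt)
    also have "\<dots> = 2 * h\<^sup>2 * (norm (mult_op (indicator {-R<..R}) g))\<^sup>2 + 2 / h * (\<Sum>j<N. (cmod (cinner f (b j)))\<^sup>2)"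
      using sum_norm_restrict[OF p(1), of g N]
      by (simp only: p sum.distrib sum_distrib_left[symmetric])
    also have "\<dots> \<le> 2 * h\<^sup>2 * (norm g)\<^sup>2 + 2 / h * (real N * (\<Sum>\<phi>\<in>?\<Phi>. (cmod (cinner f \<phi>))\<^sup>2))"
    proof (intro add_mono mult_left_mono)
      have "norm (mult_op (indicator {-R<..R}) g) \<le> 1 * norm g"
        by (rule norm_mult_op_le[OF indicator_L_infinity[OF sets_lebesgue_Ioc]]) (auto simp: indicator_def)
      then show "(norm (mult_op (indicator {-R<..R}) g))\<^sup>2 \<le> (norm g)\<^sup>2" by (intro power_mono) auto
      \<comment> \<open>Each term is bounded by the whole sum over the image of \<open>b\<close>;
        this costs the factor \<open>N\<close> and avoids an injectivity argument.\<close>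
      have "(\<Sum>j<N. (cmod (cinner f (b j)))\<^sup>2) \<le> (\<Sum>j<N. \<Sum>\<phi>\<in>?\<Phi>. (cmod (cinner f \<phi>))\<^sup>2)"
        by (intro sum_mono member_le_sum[of _ ?\<Phi> "\<lambda>\<phi>. (cmod (cinner f \<phi>))\<^sup>2"]) auto
      then show "(\<Sum>j<N. (cmod (cinner f (b j)))\<^sup>2) \<le> real N * (\<Sum>\<phi>\<in>?\<Phi>. (cmod (cinner f \<phi>))\<^sup>2)" by simp
    qed (use h in auto)
    finally have "M * (norm (mult_op (indicator {-R<..R}) f))\<^sup>2 \<le>
        M * (2 * h\<^sup>2 * (norm g)\<^sup>2 + 2 / h * (real N * (\<Sum>\<phi>\<in>?\<Phi>. (cmod (cinner f \<phi>))\<^sup>2)))"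
      using M by (intro mult_left_mono) auto
    also have "\<dots> = (M * (2 * h\<^sup>2)) * (norm g)\<^sup>2 + M * (2 / h) * real N * (\<Sum>\<phi>\<in>?\<Phi>. (cmod (cinner f \<phi>))\<^sup>2)"
      by (simp add: algebra_simps)
    also have "\<dots> \<le> 1 * (norm g)\<^sup>2 + M * (2 / h) * real N * (\<Sum>\<phi>\<in>?\<Phi>. (cmod (cinner f \<phi>))\<^sup>2)"
      by (intro add_right_mono mult_right_mono Mh) auto
    finally show ?thesis using 1 by simp
  qed
  then show ?thesis
    by (intro exI[of _ "M * (2 / h) * real N"] exI[of _ ?\<Phi>]) auto
qed

section \<open>Singular sequences at infinity\<close>

lemma norm_emb_square:
  assumes "\<phi> \<in> test_functions S"
  shows "(norm (emb \<phi>))\<^sup>2 = (\<integral>x. (\<phi> x)\<^sup>2 \<partial>lebesgue)" and "integrable lebesgue (\<lambda>x. (\<phi> x)\<^sup>2)"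
proof -
  show i: "integrable lebesgue (\<lambda>x. (\<phi> x)\<^sup>2)"
    using square_integrable_test[OF assms] by (simp add: square_integrable_def)
  show "(norm (emb \<phi>))\<^sup>2 = (\<integral>x. (\<phi> x)\<^sup>2 \<partial>lebesgue)"
    unfolding norm_L2_square
  proof (rule integral_cong_AE)
    show "AE x in lebesgue. (cmod (rep_L2 (emb \<phi>) x))\<^sup>2 = (\<phi> x)\<^sup>2"
      using AE_rep_emb[OF assms] by eventually_elim simp
  qed (use i in auto)
qed

lemma test_bounded:
  assumes "\<phi> \<in> test_functions S"
  shows "\<exists>B\<ge>0. \<forall>x. \<bar>\<phi> x\<bar> \<le> B"
proof -
  obtain K where K: "compact K" "\<And>x. x \<notin> K \<Longrightarrow> \<phi> x = 0"
    using assms by (auto simp: test_functions_iff)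
  have "bounded (\<phi> ` K)"
    by (intro compact_imp_bounded compact_continuous_image smooth_continuous[OF test_smooth[OF assms]] K)
  then obtain B where B: "\<forall>x\<in>K. \<bar>\<phi> x\<bar> \<le> B" by (auto simp: bounded_iff)
  have "\<bar>\<phi> x\<bar> \<le> \<bar>B\<bar>" for x
    using B K(2)[of x] by (cases "x \<in> K") (auto intro: order_trans)
  then show ?thesis by (intro exI[of _ "\<bar>B\<bar>"]) simp
qed

text \<open>Modulating a wide bump by \<open>s = cos (\<kappa> \<cdot>)\<close> or \<open>s = sin (\<kappa> \<cdot>)\<close>.\<close>

lemma modulated_bump:
  assumes W: "W \<in> L_infinity" and k: "k \<ge> 1" and \<epsilon>: "\<epsilon> \<ge> 0"
    and near: "AE x in lebesgue. \<bar>x - c\<bar> \<le> k \<longrightarrow> \<bar>W x + \<kappa>\<^sup>2\<bar> \<le> \<epsilon>"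
    and s: "smooth s" "\<And>x. (s has_real_derivative s' x) (at x)"
      "\<And>x. (s' has_real_derivative - \<kappa>\<^sup>2 * s x) (at x)" "\<And>x. \<bar>s x\<bar> \<le> 1" "\<And>x. \<bar>s' x\<bar> \<le> \<bar>\<kappa>\<bar>"
    and \<phi>: "\<phi> \<in> test_functions UNIV" "\<And>x. x \<notin> {-1..1} \<Longrightarrow> \<phi> x = 0" "\<And>x. \<bar>\<phi> x\<bar> \<le> 1"
    and B: "\<And>x. \<bar>deriv \<phi> x\<bar> \<le> B" "\<And>x. \<bar>deriv (deriv \<phi>) x\<bar> \<le> B"
  defines "F \<equiv> \<lambda>x. s x * \<phi> (1 / k * x + (- c / k))"
  shows "F \<in> test_functions UNIV"
    "norm (schroedinger W UNIV (emb F)) \<le> ((2 * \<bar>\<kappa>\<bar> + 1) * B / k + \<epsilon>) * sqrt (2 * k)"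
proof -
  define \<alpha> \<beta> where "\<alpha> = 1 / k" and "\<beta> = - c / k"
  have \<alpha>: "0 < \<alpha>" "\<alpha> \<le> 1" using k by (auto simp: \<alpha>_def)
  have B0: "0 \<le> B" using B(1)[of 0] by linarith
  have sm: "smooth \<phi>" "smooth (deriv \<phi>)" using \<phi>(1) by (auto intro: test_smooth smooth_deriv)
  have d0: "deriv \<phi> y = 0 \<and> deriv (deriv \<phi>) y = 0 \<and> \<phi> y = 0" if y: "y \<notin> {-1..1}" for y
  proof -
    have d: "deriv \<phi> x = 0" if "x \<notin> {-1..1}" for x
      by (rule deriv_eq_0_outside[OF closed_atLeastAtMost \<phi>(2) that])
    have "deriv (deriv \<phi>) y = 0"
      by (rule deriv_eq_0_outside[OF closed_atLeastAtMost d y])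
    then show ?thesis using d[OF y] \<phi>(2)[OF y] by simp
  qed
  define \<eta> where "\<eta> x = \<phi> (\<alpha> * x + \<beta>)" for x
  have supp: "\<alpha> * x + \<beta> \<notin> {-1..1}" if "x \<notin> {c - k..c + k}" for x
  proof -
    have "\<alpha> * x + \<beta> = (x - c) / k" by (simp add: \<alpha>_def \<beta>_def diff_divide_distrib)
    moreover have "(x - c) / k < -1 \<or> 1 < (x - c) / k"
      using that k by (auto simp: pos_less_divide_eq pos_divide_less_eq)
    ultimately show ?thesis by auto
  qed
  have "\<eta> \<in> test_functions UNIV"
    unfolding test_functions_iff
  proof (intro conjI exI[of _ "{c - k..c + k}"])
    show "smooth \<eta>" unfolding \<eta>_def by (rule smooth_affine[OF sm(1)])
  qed (use supp d0 in \<open>auto simp: \<eta>_def\<close>)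
  then have "(\<lambda>x. s x * \<eta> x) \<in> test_functions UNIV" by (rule test_mult[OF s(1)])
  then show F: "F \<in> test_functions UNIV" by (simp add: F_def \<eta>_def \<alpha>_def \<beta>_def)
  have F_eq: "F x = s x * \<phi> (\<alpha> * x + \<beta>)" for x by (simp add: F_def \<alpha>_def \<beta>_def)
  have c0: "((\<lambda>x. \<alpha> * x + \<beta>) has_real_derivative \<alpha>) (at x)" for x
    by (auto intro!: derivative_eq_intros)
  have c1: "((\<lambda>x. \<phi> (\<alpha> * x + \<beta>)) has_real_derivative \<alpha> * deriv \<phi> (\<alpha> * x + \<beta>)) (at x)" for x
    by (rule DERIV_cong[OF DERIV_chain2[OF smooth_DERIV[OF sm(1)] c0]]) (rule mult.commute)
  have c2: "((\<lambda>x. deriv \<phi> (\<alpha> * x + \<beta>)) has_real_derivative \<alpha> * deriv (deriv \<phi>) (\<alpha> * x + \<beta>)) (at x)" for x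
    by (rule DERIV_cong[OF DERIV_chain2[OF smooth_DERIV[OF sm(2)] c0]]) (rule mult.commute)
  have F': "deriv F = (\<lambda>x. s x * (\<alpha> * deriv \<phi> (\<alpha> * x + \<beta>)) + s' x * \<phi> (\<alpha> * x + \<beta>))"
  proof (rule ext, rule DERIV_imp_deriv)
    fix x
    show "(F has_real_derivative s x * (\<alpha> * deriv \<phi> (\<alpha> * x + \<beta>)) + s' x * \<phi> (\<alpha> * x + \<beta>)) (at x)"
      unfolding F_eq[abs_def] by (rule DERIV_mult'[OF s(2) c1])
  qed
  have F'': "deriv (deriv F) x = - \<kappa>\<^sup>2 * F x +
      (2 * \<alpha> * s' x * deriv \<phi> (\<alpha> * x + \<beta>) + \<alpha>\<^sup>2 * s x * deriv (deriv \<phi>) (\<alpha> * x + \<beta>))" for x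
  proof (rule DERIV_imp_deriv)
    have "(deriv F has_real_derivative (s x * (\<alpha> * (\<alpha> * deriv (deriv \<phi>) (\<alpha> * x + \<beta>))) + s' x * (\<alpha> * deriv \<phi> (\<alpha> * x + \<beta>))) +
        (s' x * (\<alpha> * deriv \<phi> (\<alpha> * x + \<beta>)) + (- \<kappa>\<^sup>2 * s x) * \<phi> (\<alpha> * x + \<beta>))) (at x)"
      unfolding F' by (intro DERIV_add DERIV_mult' s c1 DERIV_cmult c2)
    then show "(deriv F has_real_derivative - \<kappa>\<^sup>2 * F x +
      (2 * \<alpha> * s' x * deriv \<phi> (\<alpha> * x + \<beta>) + \<alpha>\<^sup>2 * s x * deriv (deriv \<phi>) (\<alpha> * x + \<beta>))) (at x)"
      by (rule DERIV_cong) (simp add: F_eq power2_eq_square algebra_simps)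
  qed
  \<comment> \<open>In \<open>F'' + \<kappa>\<^sup>2 F\<close> only terms with a derivative of
    \<open>\<phi>\<close> remain, each with a factor \<open>\<alpha> = 1/k\<close> or its square,
    which is at most \<open>\<alpha>\<close>. The summand \<open>\<epsilon>\<close> accounts for the
    potential.\<close>
  define \<delta> where "\<delta> = (2 * \<bar>\<kappa>\<bar> + 1) * B / k + \<epsilon>"
  have \<delta>: "0 \<le> \<delta>" using B0 k \<epsilon> by (simp add: \<delta>_def)
  have T: "schroedinger W UNIV (emb F) = - emb (deriv (deriv F)) + mult_op W (emb F)"
    by (rule schroedinger_eq[OF symmetric_interval_UNIV, of _ "emb (deriv F)"])
      (simp_all add: mem_H1_graph L2_on_UNIV emb_weak_deriv[OF F] emb_weak_deriv[OF test_deriv[OF F]])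
  have "norm (schroedinger W UNIV (emb F)) \<le> \<delta> * norm (box_L2 (c - k) (c + k))"
  proof (rule norm_L2_mono[OF _ \<delta>])
    have "AE x in lebesgue. rep_L2 (schroedinger W UNIV (emb F)) x =
        - complex_of_real (deriv (deriv F) x) + complex_of_real (W x * F x)"
      using AE_rep_emb[OF F] AE_rep_emb[OF test_deriv[OF test_deriv[OF F]]] AE_rep_mult_op[OF W, of "emb F"]
        AE_rep_diff[of "mult_op W (emb F)" "emb (deriv (deriv F))"]
      unfolding T by eventually_elim (simp add: algebra_simps)
    moreover have "AE x in lebesgue. x \<noteq> c - k" by (intro AE_completion AE_lborel_singleton)
    ultimately show "AE x in lebesgue. cmod (rep_L2 (schroedinger W UNIV (emb F)) x) \<le>
        \<delta> * cmod (rep_L2 (box_L2 (c - k) (c + k)) x)"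
      using near AE_rep_box[of "c - k" "c + k"]
    proof eventually_elim
      case (elim x)
      let ?y = "\<alpha> * x + \<beta>"
      let ?E = "2 * \<alpha> * s' x * deriv \<phi> ?y + \<alpha>\<^sup>2 * s x * deriv (deriv \<phi>) ?y"
      have eq: "rep_L2 (schroedinger W UNIV (emb F)) x = complex_of_real ((W x + \<kappa>\<^sup>2) * F x - ?E)"
        unfolding elim(1) F'' by (simp add: algebra_simps)
      show ?case
      proof (cases "x \<in> {c - k..c + k}")
        case False
        then have "(W x + \<kappa>\<^sup>2) * F x - ?E = 0" using d0[OF supp[OF False]] by (simp add: F_eq)
        then show ?thesis unfolding eq using \<delta> by (simp only:) simp
      next
        case True
        have "\<bar>W x + \<kappa>\<^sup>2\<bar> \<le> \<epsilon>" using True elim(3) by (auto simp: abs_le_iff)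
        moreover have "\<bar>F x\<bar> \<le> 1 * 1"
          unfolding F_eq abs_mult using s(4) \<phi>(3) by (intro mult_mono) auto
        ultimately have 1: "\<bar>(W x + \<kappa>\<^sup>2) * F x\<bar> \<le> \<epsilon> * 1"
          unfolding abs_mult using \<epsilon> by (intro mult_mono) auto
        have 2: "\<bar>2 * \<alpha> * s' x * deriv \<phi> ?y\<bar> \<le> 2 * \<alpha> * \<bar>\<kappa>\<bar> * B"
          unfolding abs_mult using s(5) B(1) \<alpha> by (intro mult_mono) auto
        have "\<alpha>\<^sup>2 \<le> \<alpha> * 1" unfolding power2_eq_square using \<alpha> by (intro mult_left_mono) auto
        then have 3: "\<bar>\<alpha>\<^sup>2 * s x * deriv (deriv \<phi>) ?y\<bar> \<le> \<alpha> * 1 * B"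
          unfolding abs_mult using s(4) B(2) \<alpha> by (intro mult_mono) auto
        have "\<bar>(W x + \<kappa>\<^sup>2) * F x - ?E\<bar> \<le> \<epsilon> * 1 + (2 * \<alpha> * \<bar>\<kappa>\<bar> * B + \<alpha> * 1 * B)"
          using 1 2 3 by linarith
        also have "\<dots> = \<delta>" by (simp add: \<delta>_def \<alpha>_def add_divide_distrib algebra_simps)
        finally have "\<bar>(W x + \<kappa>\<^sup>2) * F x - ?E\<bar> \<le> \<delta>" .
        moreover have "indicat_real {c - k<..c + k} x = 1" using True elim(2) by auto
        ultimately show ?thesis unfolding eq elim(4) norm_of_real by simp
      qed
    qed
  qed
  also have "norm (box_L2 (c - k) (c + k)) = sqrt (2 * k)"
    using norm_box[of "c - k" "c + k"] k by (simp add: real_sqrt_unique)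
  finally show "norm (schroedinger W UNIV (emb F)) \<le> ((2 * \<bar>\<kappa>\<bar> + 1) * B / k + \<epsilon>) * sqrt (2 * k)"
    by (simp add: \<delta>_def)
qed

text \<open>A Weyl sequence argument. The squares of the cosine and the sine modulation add up to
  the square of the bump, so one of them has large norm, and no oscillating integral has to be
  estimated.\<close>

lemma not_bounded_below_at_infinity:
  assumes W: "W \<in> L_infinity"
    and near: "\<And>\<epsilon> k. \<epsilon> > 0 \<Longrightarrow> k > 0 \<Longrightarrow> \<exists>c. AE x in lebesgue. \<bar>x - c\<bar> \<le> k \<longrightarrow> \<bar>W x + \<kappa>\<^sup>2\<bar> \<le> \<epsilon>"
    and bb: "\<And>f. f \<in> sdom UNIV \<Longrightarrow> norm f \<le> C * norm (schroedinger W UNIV f)" and C: "C > 0"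
  shows False
proof -
  let ?\<phi> = "bump 1 (-1) 1"
  have \<phi>: "?\<phi> \<in> test_functions UNIV" by (rule bump_test) auto
  obtain B1 where B1: "B1 \<ge> 0" "\<And>x. \<bar>deriv ?\<phi> x\<bar> \<le> B1"
    using test_bounded[OF test_deriv[OF \<phi>]] by auto
  obtain B2 where B2: "B2 \<ge> 0" "\<And>x. \<bar>deriv (deriv ?\<phi>) x\<bar> \<le> B2"
    using test_bounded[OF test_deriv[OF test_deriv[OF \<phi>]]] by auto
  define B where "B = max B1 B2"
  have B: "\<bar>deriv ?\<phi> x\<bar> \<le> B" "\<bar>deriv (deriv ?\<phi>) x\<bar> \<le> B" "B \<ge> 0" for x
    using B1(1) B1(2)[of x] B2(2)[of x] by (auto simp: B_def)
  \<comment> \<open>\<open>exp (-4)\<close> bounds the bump from below on the middle half of its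
    support. With total relative residual \<open>3 / 4 * \<epsilon>\<close> the two modulations
    together reach only 9/64 of the lower bound for the squared norm of the bump.\<close>
  define \<epsilon> where "\<epsilon> = exp (-4) / (4 * C)"
  have \<epsilon>: "\<epsilon> > 0" using C by (simp add: \<epsilon>_def)
  define D where "D = (2 * \<bar>\<kappa>\<bar> + 1) * B"
  have D: "D \<ge> 0" using B(3) by (simp add: D_def)
  define k where "k = D / (\<epsilon> / 2) + 1"
  have k: "k \<ge> 1" using D \<epsilon> by (simp add: k_def)
  have Dk: "D / k \<le> \<epsilon> / 2"
  proof -
    have "D \<le> \<epsilon> / 2 * k" using \<epsilon> by (simp add: k_def field_simps)
    then show ?thesis using k by (simp add: field_simps)
  qed
  obtain c where c: "AE x in lebesgue. \<bar>x - c\<bar> \<le> k \<longrightarrow> \<bar>W x + \<kappa>\<^sup>2\<bar> \<le> \<epsilon> / 4"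
    using near[of "\<epsilon> / 4" k] \<epsilon> k by auto
  define F where "F s x = s x * ?\<phi> (1 / k * x + (- c / k))" for s :: "real \<Rightarrow> real" and x
  have est: "F s \<in> test_functions UNIV \<and> (norm (emb (F s)))\<^sup>2 \<le> (C * (3 / 4 * \<epsilon>))\<^sup>2 * (2 * k)"
    if s: "smooth s" "\<And>x. (s has_real_derivative s' x) (at x)"
      "\<And>x. (s' has_real_derivative - \<kappa>\<^sup>2 * s x) (at x)" "\<And>x. \<bar>s x\<bar> \<le> 1" "\<And>x. \<bar>s' x\<bar> \<le> \<bar>\<kappa>\<bar>" for s s'
  proof -
    have e0: "0 \<le> \<epsilon> / 4" using \<epsilon> by simp
    have \<phi>0: "?\<phi> x = 0" if "x \<notin> {-1..1}" for x using that by (intro bump_outside) auto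
    have \<phi>1: "\<bar>?\<phi> x\<bar> \<le> 1" for x by (simp add: bump_nonneg bump_le_1)
    have Fs: "F s = (\<lambda>x. s x * ?\<phi> (1 / k * x + (- c / k)))" by (rule ext) (simp only: F_def)
    have FT: "F s \<in> test_functions UNIV"
      unfolding Fs by (rule modulated_bump(1)[OF W k e0 c s \<phi> \<phi>0 \<phi>1 B(1,2)])
    have Fn: "norm (schroedinger W UNIV (emb (F s))) \<le> ((2 * \<bar>\<kappa>\<bar> + 1) * B / k + \<epsilon> / 4) * sqrt (2 * k)"
      unfolding Fs by (rule modulated_bump(2)[OF W k e0 c s \<phi> \<phi>0 \<phi>1 B(1,2)])
    have "emb (F s) \<in> sdom UNIV"
      by (rule sdomI[of _ "emb (deriv (F s))" _ "emb (deriv (deriv (F s)))"])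
        (simp_all add: mem_H1_graph L2_on_UNIV emb_weak_deriv[OF FT] emb_weak_deriv[OF test_deriv[OF FT]])
    then have "norm (emb (F s)) \<le> C * norm (schroedinger W UNIV (emb (F s)))" by (rule bb)
    also have "\<dots> \<le> C * ((D / k + \<epsilon> / 4) * sqrt (2 * k))"
      using Fn C by (intro mult_left_mono) (auto simp: D_def)
    also have "\<dots> \<le> C * ((3 / 4 * \<epsilon>) * sqrt (2 * k))"
    proof -
      have "D / k + \<epsilon> / 4 \<le> 3 / 4 * \<epsilon>" using Dk by linarith
      then show ?thesis using C k by (intro mult_left_mono mult_right_mono) auto
    qed
    finally have "(norm (emb (F s)))\<^sup>2 \<le> (C * ((3 / 4 * \<epsilon>) * sqrt (2 * k)))\<^sup>2" by (intro power_mono) auto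
    also have "\<dots> = (C * (3 / 4 * \<epsilon>))\<^sup>2 * (sqrt (2 * k))\<^sup>2"
      by (simp only: power_mult_distrib mult.assoc)
    finally show ?thesis using FT k by simp
  qed
  have scos: "smooth (\<lambda>x. cos (\<kappa> * x))" "smooth (\<lambda>x. sin (\<kappa> * x))"
    using smooth_sin_cos[of 0 \<kappa> 1] smooth_sin_cos[of 1 \<kappa> 0] by simp_all
  have c1: "F (\<lambda>x. cos (\<kappa> * x)) \<in> test_functions UNIV \<and> (norm (emb (F (\<lambda>x. cos (\<kappa> * x)))))\<^sup>2 \<le> (C * (3 / 4 * \<epsilon>))\<^sup>2 * (2 * k)"
    by (rule est[OF scos(1), of "\<lambda>x. - \<kappa> * sin (\<kappa> * x)"])
      (auto intro!: derivative_eq_intros simp: power2_eq_square abs_mult mult_left_le)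
  have c2: "F (\<lambda>x. sin (\<kappa> * x)) \<in> test_functions UNIV \<and> (norm (emb (F (\<lambda>x. sin (\<kappa> * x)))))\<^sup>2 \<le> (C * (3 / 4 * \<epsilon>))\<^sup>2 * (2 * k)"
    by (rule est[OF scos(2), of "\<lambda>x. \<kappa> * cos (\<kappa> * x)"])
      (auto intro!: derivative_eq_intros simp: power2_eq_square abs_mult mult_left_le)
  have "(\<integral>x. indicat_real {c - k / 2<..c + k / 2} x * (exp (-4))\<^sup>2 \<partial>lebesgue) \<le>
      (\<integral>x. (F (\<lambda>x. cos (\<kappa> * x)) x)\<^sup>2 + (F (\<lambda>x. sin (\<kappa> * x)) x)\<^sup>2 \<partial>lebesgue)"
  proof (rule integral_mono)
    show "integrable lebesgue (\<lambda>x. (F (\<lambda>x. cos (\<kappa> * x)) x)\<^sup>2 + (F (\<lambda>x. sin (\<kappa> * x)) x)\<^sup>2)"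
      using c1 c2 norm_emb_square(2) by (intro Bochner_Integration.integrable_add) blast+
    show "integrable lebesgue (\<lambda>x. indicat_real {c - k / 2<..c + k / 2} x * (exp (-4))\<^sup>2)"
      by (intro integrable_mult_left integrable_indicator_Ioc)
    fix x
    let ?y = "1 / k * x + (- c / k)"
    have sq: "(F (\<lambda>x. cos (\<kappa> * x)) x)\<^sup>2 + (F (\<lambda>x. sin (\<kappa> * x)) x)\<^sup>2 = (?\<phi> ?y)\<^sup>2"
      unfolding F_def power_mult_distrib distrib_right[symmetric] by simp
    show "indicat_real {c - k / 2<..c + k / 2} x * (exp (-4))\<^sup>2 \<le>
        (F (\<lambda>x. cos (\<kappa> * x)) x)\<^sup>2 + (F (\<lambda>x. sin (\<kappa> * x)) x)\<^sup>2"
    proof (cases "x \<in> {c - k / 2<..c + k / 2}")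
      case True
      have "?y = (x - c) / k" by (simp add: diff_divide_distrib)
      then have y: "- (1 / 2) < ?y" "?y \<le> 1 / 2" using True k by (auto simp: field_simps)
      have le: "exp (-2) \<le> flat 1 t" if "t \<ge> 1 / 2" for t
        using that by (simp add: flat_1 field_simps)
      have "exp (-2) * exp (-2) \<le> ?\<phi> y" if "- (1 / 2) < y" "y \<le> 1 / 2" for y
        unfolding bump_def using that by (intro mult_mono le) (auto simp: flat_1)
      from this[OF y] have "exp (-2) * exp (-2) \<le> ?\<phi> ?y" .
      then have "exp (-4) \<le> ?\<phi> ?y" by (simp flip: exp_add)
      then have "(exp (-4))\<^sup>2 \<le> (?\<phi> ?y)\<^sup>2" by (intro power_mono) auto
      then show ?thesis unfolding sq using True by simp
    qed simp
  qed
  also have "\<dots> = (norm (emb (F (\<lambda>x. cos (\<kappa> * x)))))\<^sup>2 + (norm (emb (F (\<lambda>x. sin (\<kappa> * x)))))\<^sup>2"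
    using c1 c2 norm_emb_square by (subst Bochner_Integration.integral_add) auto
  also have "\<dots> \<le> 4 * (C * (3 / 4 * \<epsilon>))\<^sup>2 * k" using c1 c2 by linarith
  finally have "k * (exp (-4))\<^sup>2 \<le> 4 * (C * (3 / 4 * \<epsilon>))\<^sup>2 * k"
    using k by (simp add: measure_completion)
  then have "(exp (-4))\<^sup>2 \<le> 4 * (C * (3 / 4 * \<epsilon>))\<^sup>2" using k by simp
  also have "C * (3 / 4 * \<epsilon>) = 3 / 16 * exp (-4)" using C by (simp add: \<epsilon>_def)
  finally show False by (simp add: power_mult_distrib power_divide)
qed

section \<open>The two approximations\<close>

text \<open>An everywhere defined symmetric operator is self-adjoint: test the difference
  \<open>compression H T u - w\<close> against itself.\<close>

lemma selfadjoint_pencil_compression: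
  assumes "selfadjoint_pencil UNIV D T J M" and H: "csubspace H" "closed H" and HD: "H \<subseteq> D"
  shows "selfadjoint_pencil H H (compression H T) (compression H J) M"
proof -
  interpret selfadjoint_pencil UNIV D T J M by fact
  note P = cinner_orth_proj[OF H]
  have P': "cinner x (orth_proj H y) = cinner x y" if "x \<in> H" for x y
    using P[OF that, of y] by (metis cinner_commute)
  show ?thesis
  proof (rule selfadjoint_pencil.intro[OF H H(1) order_refl])
    fix x y z
    show "compression H T x \<in> H" "compression H J x \<in> H"
      unfolding compression_def by (rule orth_proj_in[OF H])+
    show "compression H T (z *\<^sub>C x) = z *\<^sub>C compression H T x" if "x \<in> H"
      using that HD by (simp add: compression_def T_scaleC subsetD orth_proj_scaleC[OF H])
    show "compression H J (z *\<^sub>C x) = z *\<^sub>C compression H J x"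
      by (simp add: compression_def J_scaleC orth_proj_scaleC[OF H])
    show "compression H J (x + y) = compression H J x + compression H J y"
      by (simp add: compression_def J_add orth_proj_add[OF H])
    show "norm (compression H J x) \<le> M * norm x"
      unfolding compression_def using norm_orth_proj_le[OF H, of "J x"] J_bound[of x] by simp
    assume x: "x \<in> H" and y: "y \<in> H"
    show "compression H T (x + y) = compression H T x + compression H T y"
      using x y HD by (simp add: compression_def T_add subsetD orth_proj_add[OF H])
    show "cinner (compression H T x) y = cinner x (compression H T y)"
      using x y HD by (simp add: compression_def P P' T_sym subsetD)
    show "cinner (compression H J x) y = cinner x (compression H J y)"
      using x y by (simp add: compression_def P P' J_sym)
  next
    fix u w
    assume u: "u \<in> H" and w: "w \<in> H"
      and eq: "\<And>x. x \<in> H \<Longrightarrow> cinner (compression H T x) u = cinner x w"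
    define z where "z = compression H T u - w"
    have zH: "z \<in> H"
      unfolding z_def compression_def by (intro csubspace_diff[OF H(1)] orth_proj_in[OF H] w)
    have "cinner z (compression H T u) = cinner z (T u)" using zH by (simp add: compression_def P')
    also have "\<dots> = cinner (T z) u" using zH u HD by (simp add: T_sym subsetD)
    also have "\<dots> = cinner z w" using eq[OF zH] u by (simp add: compression_def P)
    finally have "cinner z z = 0" unfolding z_def by (simp add: cinner_diff_right)
    then have "z = 0" by (simp add: cinner_self)
    then show "u \<in> H \<and> compression H T u = w" using u by (simp add: z_def)
  qed
qed

section \<open>The Sturm-Liouville pencil with indefinite weight\<close>

locale indefinite_sturm_liouville =
  fixes a b m_minus m_plus :: real and J V :: "real \<Rightarrow> real"
  assumes J: "J \<in> L_infinity"
    and J_left: "AE x in lebesgue. x < a \<longrightarrow> J x = -1"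
    and J_right: "AE x in lebesgue. x > b \<longrightarrow> J x = 1"
    and V: "V \<in> L_infinity"
    and m: "m_minus > 0" "m_plus > 0"
    and V_left: "ess_tendsto V m_minus at_bot"
    and V_right: "ess_tendsto V m_plus at_top"
begin

text \<open>Any essential bound of \<open>J\<close> will do; the absolute value makes it
  nonnegative.\<close>

definition M :: real where "M = \<bar>SOME C. AE x in lebesgue. \<bar>J x\<bar> \<le> C\<bar>"

lemma norm_J: "norm (mult_op J f) \<le> M * norm f"
proof (rule norm_mult_op_le[OF J])
  have "AE x in lebesgue. \<bar>J x\<bar> \<le> (SOME C. AE x in lebesgue. \<bar>J x\<bar> \<le> C)"
    by (rule someI_ex) (use J in \<open>simp add: L_infinity_def\<close>)
  then show "AE x in lebesgue. \<bar>J x\<bar> \<le> M" by eventually_elim (simp add: M_def)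
qed (simp add: M_def)

abbreviation T where "T \<equiv> schroedinger V UNIV"

lemmas pencil_on = schroedinger_pencil[OF _ V J norm_J]

sublocale lim: selfadjoint_pencil UNIV "sdom UNIV" T "mult_op J" M
  using pencil_on[OF symmetric_interval_UNIV] by (simp add: L2_on_UNIV)

abbreviation W where "W \<mu> \<equiv> \<lambda>x. V x - \<mu> * J x"

lemma W_L_infinity: "W \<mu> \<in> L_infinity"
proof -
  obtain C D where C: "AE x in lebesgue. \<bar>V x\<bar> \<le> C" and D: "AE x in lebesgue. \<bar>J x\<bar> \<le> D"
    using V J by (auto simp: L_infinity_def)
  have "AE x in lebesgue. \<bar>W \<mu> x\<bar> \<le> C + \<bar>\<mu>\<bar> * D"
    using C D
  proof eventually_elim
    case (elim x)
    have "\<bar>V x - \<mu> * J x\<bar> \<le> \<bar>V x\<bar> + \<bar>\<mu>\<bar> * \<bar>J x\<bar>"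
      using abs_triangle_ineq4[of "V x" "\<mu> * J x"] by (simp add: abs_mult)
    also have "\<dots> \<le> C + \<bar>\<mu>\<bar> * D" by (intro add_mono mult_left_mono elim) auto
    finally show ?case .
  qed
  then show ?thesis using V J by (auto simp: L_infinity_def)
qed

lemma mult_op_W: "mult_op (W \<mu>) f = mult_op V f - complex_of_real \<mu> *\<^sub>C mult_op J f"
proof (rule L2_eqI)
  show "AE x in lebesgue. rep_L2 (mult_op (W \<mu>) f) x =
      rep_L2 (mult_op V f - complex_of_real \<mu> *\<^sub>C mult_op J f) x"
    using AE_rep_mult_op[OF W_L_infinity, of \<mu> f] AE_rep_mult_op[OF V, of f] AE_rep_mult_op[OF J, of f]
      AE_rep_scaleC[of \<mu> "mult_op J f"] AE_rep_diff[of "mult_op V f" "complex_of_real \<mu> *\<^sub>C mult_op J f"]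
    by eventually_elim (simp add: left_diff_distrib mult.assoc)
qed

lemma near_right:
  assumes "\<epsilon> > 0"
  shows "\<exists>X. AE x in lebesgue. x \<ge> X \<longrightarrow> \<bar>W \<mu> x - (m_plus - \<mu>)\<bar> \<le> \<epsilon>"
proof -
  obtain V' where V': "AE x in lebesgue. V' x = V x" "(V' \<longlongrightarrow> m_plus) at_top"
    using V_right by (auto simp: ess_tendsto_def)
  have "\<forall>\<^sub>F x in at_top. dist (V' x) m_plus < \<epsilon>" using V'(2) assms by (rule tendstoD)
  then obtain X where X: "\<And>x. x \<ge> X \<Longrightarrow> dist (V' x) m_plus < \<epsilon>"
    by (auto simp: eventually_at_top_linorder)
  have "AE x in lebesgue. x \<ge> max X (b + 1) \<longrightarrow> \<bar>W \<mu> x - (m_plus - \<mu>)\<bar> \<le> \<epsilon>"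
    using V'(1) J_right
  proof eventually_elim
    case (elim x)
    show ?case
    proof
      assume "x \<ge> max X (b + 1)"
      then have "J x = 1" "\<bar>V x - m_plus\<bar> < \<epsilon>" using elim X[of x] by (auto simp: dist_real_def)
      then show "\<bar>W \<mu> x - (m_plus - \<mu>)\<bar> \<le> \<epsilon>" by simp
    qed
  qed
  then show ?thesis by blast
qed

lemma near_left:
  assumes "\<epsilon> > 0"
  shows "\<exists>X. AE x in lebesgue. x \<le> X \<longrightarrow> \<bar>W \<mu> x - (m_minus + \<mu>)\<bar> \<le> \<epsilon>"
proof -
  obtain V' where V': "AE x in lebesgue. V' x = V x" "(V' \<longlongrightarrow> m_minus) at_bot"
    using V_left by (auto simp: ess_tendsto_def)
  have "\<forall>\<^sub>F x in at_bot. dist (V' x) m_minus < \<epsilon>" using V'(2) assms by (rule tendstoD)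
  then obtain X where X: "\<And>x. x \<le> X \<Longrightarrow> dist (V' x) m_minus < \<epsilon>"
    by (auto simp: eventually_at_bot_linorder)
  have "AE x in lebesgue. x \<le> min X (a - 1) \<longrightarrow> \<bar>W \<mu> x - (m_minus + \<mu>)\<bar> \<le> \<epsilon>"
    using V'(1) J_left
  proof eventually_elim
    case (elim x)
    show ?case
    proof
      assume "x \<le> min X (a - 1)"
      then have "J x = -1" "\<bar>V x - m_minus\<bar> < \<epsilon>" using elim X[of x] by (auto simp: dist_real_def)
      then show "\<bar>W \<mu> x - (m_minus + \<mu>)\<bar> \<le> \<epsilon>" by simp
    qed
  qed
  then show ?thesis by blast
qed

text \<open>The potential \<open>V - l J\<close> tends to \<open>m_plus - l\<close> on the right and
  to \<open>m_minus + l\<close> on the left. If a limit is not positive, it is minus a square, and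
  waves of that frequency far out are approximate kernel elements of \<open>S l\<close>.\<close>

lemma real_resolvent_gap:
  assumes "complex_of_real l \<notin> lim.spec"
  shows "- m_minus < l" "l < m_plus"
proof -
  obtain C where C: "C > 0" "\<And>x. x \<in> sdom UNIV \<Longrightarrow> norm x \<le> C * norm (lim.S (complex_of_real l) x)"
    using assms lim.not_spec_iff lim.bounded_belowE by metis
  have bb: "norm f \<le> C * norm (schroedinger (W l) UNIV f)" if f: "f \<in> sdom UNIV" for f
  proof -
    have "schroedinger (W l) UNIV f = lim.S (complex_of_real l) f"
      by (simp add: schroedinger_def lim.S_def mult_op_W)
    then show ?thesis using C(2)[OF f] by simp
  qed
  show "l < m_plus"
  proof (rule ccontr)
    assume "\<not> l < m_plus"
    then have \<kappa>: "(sqrt (l - m_plus))\<^sup>2 = l - m_plus" by simp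
    show False
    proof (rule not_bounded_below_at_infinity[OF W_L_infinity _ bb C(1), where \<kappa> = "sqrt (l - m_plus)"])
      fix \<epsilon> k :: real assume "\<epsilon> > 0"
      then obtain X where X: "AE x in lebesgue. x \<ge> X \<longrightarrow> \<bar>W l x - (m_plus - l)\<bar> \<le> \<epsilon>"
        using near_right by blast
      have "AE x in lebesgue. \<bar>x - (X + k)\<bar> \<le> k \<longrightarrow> \<bar>W l x + (sqrt (l - m_plus))\<^sup>2\<bar> \<le> \<epsilon>"
        using X by eventually_elim (unfold \<kappa>, auto simp: abs_le_iff)
      then show "\<exists>c. AE x in lebesgue. \<bar>x - c\<bar> \<le> k \<longrightarrow> \<bar>W l x + (sqrt (l - m_plus))\<^sup>2\<bar> \<le> \<epsilon>" by blast
    qed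
  qed
  show "- m_minus < l"
  proof (rule ccontr)
    assume "\<not> - m_minus < l"
    then have \<kappa>: "(sqrt (- l - m_minus))\<^sup>2 = - l - m_minus" by simp
    show False
    proof (rule not_bounded_below_at_infinity[OF W_L_infinity _ bb C(1), where \<kappa> = "sqrt (- l - m_minus)"])
      fix \<epsilon> k :: real assume "\<epsilon> > 0"
      then obtain X where X: "AE x in lebesgue. x \<le> X \<longrightarrow> \<bar>W l x - (m_minus + l)\<bar> \<le> \<epsilon>"
        using near_left by blast
      have "AE x in lebesgue. \<bar>x - (X - k)\<bar> \<le> k \<longrightarrow> \<bar>W l x + (sqrt (- l - m_minus))\<^sup>2\<bar> \<le> \<epsilon>"
        using X by eventually_elim (unfold \<kappa>, auto simp: abs_le_iff)
      then show "\<exists>c. AE x in lebesgue. \<bar>x - c\<bar> \<le> k \<longrightarrow> \<bar>W l x + (sqrt (- l - m_minus))\<^sup>2\<bar> \<le> \<epsilon>" by blast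
    qed
  qed
qed

text \<open>For nonreal \<open>z\<close> the weight \<open>t\<close> eliminates the indefinite term altogether; for real \<open>z\<close> outside
  the spectrum, \<open>V - z J\<close> is positive near infinity.\<close>

lemma coercive_form:
  assumes z: "z \<notin> lim.spec"
  shows "\<exists>t c C \<Phi>. c > 0 \<and> finite \<Phi> \<and> (\<forall>(f, g)\<in>H1_graph UNIV. c * (norm f)\<^sup>2 \<le>
    (norm g)\<^sup>2 + Re (cinner (mult_op V f) f) - (Re z + t * Im z) * Re (cinner (mult_op J f) f) +
    C * (\<Sum>\<phi>\<in>\<Phi>. (cmod (cinner f \<phi>))\<^sup>2))"
proof -
  have "\<exists>t. - m_minus < Re z + t * Im z \<and> Re z + t * Im z < m_plus"
  proof (cases "Im z = 0")
    case True
    then have "z = complex_of_real (Re z)" by (simp add: complex_eq_iff)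
    then show ?thesis using real_resolvent_gap[of "Re z"] z True by simp
  next
    case False
    then show ?thesis using m by (intro exI[of _ "- Re z / Im z"]) simp
  qed
  then obtain t where t: "- m_minus < Re z + t * Im z" "Re z + t * Im z < m_plus" by blast
  define \<mu> where "\<mu> = Re z + t * Im z"
  \<comment> \<open>Half the smaller of the two limits of \<open>V - \<mu> J\<close>; with tolerance
    \<open>c\<close> the potential is at least \<open>c\<close> near infinity on both sides.\<close>
  define c where "c = min ((m_plus - \<mu>) / 2) ((m_minus + \<mu>) / 2)"
  have c: "c > 0" using t by (simp add: c_def \<mu>_def)
  obtain X where X: "AE x in lebesgue. x \<ge> X \<longrightarrow> \<bar>W \<mu> x - (m_plus - \<mu>)\<bar> \<le> c"
    using near_right[OF c] by blast
  obtain Y where Y: "AE x in lebesgue. x \<le> Y \<longrightarrow> \<bar>W \<mu> x - (m_minus + \<mu>)\<bar> \<le> c"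
    using near_left[OF c] by blast
  define R where "R = \<bar>X\<bar> + \<bar>Y\<bar> + 1"
  have cle: "c \<le> (m_plus - \<mu>) / 2" "c \<le> (m_minus + \<mu>) / 2"
    unfolding c_def by (rule min.cobounded1 min.cobounded2)+
  have "AE x in lebesgue. \<bar>x\<bar> \<ge> R \<longrightarrow> c \<le> W \<mu> x"
    using X Y
  proof eventually_elim
    case (elim x)
    show ?case
    proof
      assume "\<bar>x\<bar> \<ge> R"
      then consider "x \<ge> X" | "x \<le> Y" by (cases "x \<ge> 0") (auto simp: R_def)
      then show "c \<le> W \<mu> x"
      proof cases
        case 1
        then show ?thesis using elim(1) cle(1) by (auto simp: abs_le_iff)
      next
        case 2
        then show ?thesis using elim(2) cle(2) by (auto simp: abs_le_iff)
      qed
    qed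
  qed
  moreover have "R > 0" by (simp add: R_def)
  ultimately obtain C \<Phi> where C: "finite \<Phi>" "\<forall>(f, g)\<in>H1_graph UNIV. c * (norm f)\<^sup>2 \<le>
      (norm g)\<^sup>2 + Re (cinner (mult_op (W \<mu>) f) f) + C * (\<Sum>\<phi>\<in>\<Phi>. (cmod (cinner f \<phi>))\<^sup>2)"
    using coercive_up_to_finite_rank[OF W_L_infinity c, of R \<mu>] by blast
  have "Re (cinner (mult_op (W \<mu>) f) f) =
      Re (cinner (mult_op V f) f) - (Re z + t * Im z) * Re (cinner (mult_op J f) f)" for f
    by (simp add: mult_op_W cinner_diff_left cinner_scaleC_left \<mu>_def)
  with C c show ?thesis
    by (intro exI[of _ t] exI[of _ c] exI[of _ C] exI[of _ \<Phi>]) auto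
qed

lemma Re_form:
  assumes "symmetric_interval S" "f \<in> sdom S" "(f, g) \<in> H1_graph S"
  shows "Re (cinner (schroedinger V S f) f) = (norm g)\<^sup>2 + Re (cinner (mult_op V f) f)"
  using schroedinger_form[OF assms(1,2,3,3), of V] by (simp add: cinner_self)

text \<open>On \<open>H n\<close> a compression has the same quadratic form as the operator itself,
  so coercivity and positivity on the line are inherited; the projections of \<open>f\<close> serve
  as consistent approximations.\<close>

lemma galerkin_approximation:
  assumes H: "\<And>n. finite_dimensional_subspace (H n)" "\<And>n. H n \<subseteq> sdom UNIV"
    and P: "\<And>f. (\<lambda>n. orth_proj (H n) f) \<longlonglongrightarrow> f"
    and PT: "\<And>f. f \<in> sdom UNIV \<Longrightarrow> (\<lambda>n. compression (H n) T (orth_proj (H n) f)) \<longlonglongrightarrow> T f"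
  shows "pencil_approximation (sdom UNIV) T (mult_op J) M H H
    (\<lambda>n. compression (H n) T) (\<lambda>n. compression (H n) (mult_op J))"
proof (rule pencil_approximation.intro[OF lim.selfadjoint_pencil_axioms pencil_approximation_axioms.intro])
  note U = finite_dimensional_subspaceD[OF H(1)]
  have cT: "cinner (compression (H n) T x) x = cinner (T x) x"
    and cJ: "cinner (compression (H n) (mult_op J) x) x = cinner (mult_op J x) x" if "x \<in> H n" for n x
    using cinner_orth_proj[OF U that] by (simp_all add: compression_def)
  show "selfadjoint_pencil (H n) (H n) (compression (H n) T) (compression (H n) (mult_op J)) M" for n
    by (rule selfadjoint_pencil_compression[OF lim.selfadjoint_pencil_axioms U H(2)])
  show "\<exists>F. (\<forall>n>0. F n \<in> H n) \<and> F \<longlonglongrightarrow> f \<and> (\<lambda>n. compression (H n) T (F n)) \<longlonglongrightarrow> T f \<and>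
      (\<lambda>n. compression (H n) (mult_op J) (F n)) \<longlonglongrightarrow> mult_op J f" if f: "f \<in> sdom UNIV" for f
  proof (intro exI[of _ "\<lambda>n. orth_proj (H n) f"] conjI allI impI P PT f)
    show "orth_proj (H n) f \<in> H n" for n by (rule orth_proj_in[OF U])
    \<comment> \<open>Splits the projection of \<open>J P f\<close> into that of
      \<open>J P f - J f\<close>, which is small because projections are contractions, and that of
      \<open>J f\<close>.\<close>
    define d where "d n = mult_op J (orth_proj (H n) f) - mult_op J f" for n
    have "d \<longlonglongrightarrow> mult_op J f - mult_op J f"
      unfolding d_def by (intro tendsto_intros tendsto_mult_op J P)
    then have "(\<lambda>n. norm (d n)) \<longlonglongrightarrow> 0" by (simp add: tendsto_norm_zero)
    then have "(\<lambda>n. orth_proj (H n) (d n)) \<longlonglongrightarrow> 0"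
      by (rule Lim_null_comparison[rotated]) (simp add: norm_orth_proj_le[OF U])
    then have "(\<lambda>n. orth_proj (H n) (d n) + orth_proj (H n) (mult_op J f)) \<longlonglongrightarrow> 0 + mult_op J f"
      by (intro tendsto_add P)
    then show "(\<lambda>n. compression (H n) (mult_op J) (orth_proj (H n) f)) \<longlonglongrightarrow> mult_op J f"
      by (simp add: d_def orth_proj_diff[OF U] compression_def)
  qed
  show "\<exists>t c C \<Phi>. c > 0 \<and> finite \<Phi> \<and> (\<forall>n>0. \<forall>x\<in>H n. c * (norm x)\<^sup>2 \<le>
      Re (cinner (compression (H n) T x) x) -
      (Re z + t * Im z) * Re (cinner (compression (H n) (mult_op J) x) x) +
      C * (\<Sum>\<phi>\<in>\<Phi>. (cmod (cinner x \<phi>))\<^sup>2))" if z: "z \<notin> lim.spec" for z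
  proof -
    obtain t c C \<Phi> where *: "c > 0" "finite \<Phi>" "\<forall>(f, g)\<in>H1_graph UNIV. c * (norm f)\<^sup>2 \<le>
        (norm g)\<^sup>2 + Re (cinner (mult_op V f) f) - (Re z + t * Im z) * Re (cinner (mult_op J f) f) +
        C * (\<Sum>\<phi>\<in>\<Phi>. (cmod (cinner f \<phi>))\<^sup>2)"
      using coercive_form[OF z] by (elim exE conjE)
    have "c * (norm x)\<^sup>2 \<le> Re (cinner (compression (H n) T x) x) -
        (Re z + t * Im z) * Re (cinner (compression (H n) (mult_op J) x) x) +
        C * (\<Sum>\<phi>\<in>\<Phi>. (cmod (cinner x \<phi>))\<^sup>2)" if x: "x \<in> H n" for n x
    proof -
      have xs: "x \<in> sdom UNIV" using x H(2) by auto
      then obtain g where g: "(x, g) \<in> H1_graph UNIV" by (auto simp: sdom_def)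
      show ?thesis
        using bspec[OF *(3) g] by (simp add: cT[OF x] cJ[OF x] Re_form[OF symmetric_interval_UNIV xs g])
    qed
    with *(1,2) show ?thesis by blast
  qed
  show "\<exists>c>0. \<forall>n>0. \<forall>x\<in>H n. c * (norm x)\<^sup>2 \<le> Re (cinner (compression (H n) T x) x)"
    if "uniformly_positive (sdom UNIV) T"
    using that H(2) unfolding uniformly_positive_def by (simp add: cT) blast
qed

text \<open>Extension by zero embeds the form domain of \<open>(-n, n)\<close> into that of the line
  with the same form, so estimates on the line hold with constants free of \<open>n\<close>.\<close>

lemma dirichlet_approximation:
  "pencil_approximation (sdom UNIV) T (mult_op J) M (\<lambda>n. L2_on {- real n<..<real n})
    (\<lambda>n. W22_dirichlet (real n)) (\<lambda>n. schroedinger V {- real n<..<real n}) (\<lambda>_. mult_op J)"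
proof (rule pencil_approximation.intro[OF lim.selfadjoint_pencil_axioms pencil_approximation_axioms.intro])
  let ?S = "\<lambda>n. {- real n<..<real n}"
  have S: "symmetric_interval (?S n)" and D: "W22_dirichlet (real n) = sdom (?S n)" if "n > 0" for n
    using that by (simp_all add: symmetric_interval_Ioo W22_dirichlet_eq_sdom)
  show "selfadjoint_pencil (L2_on (?S n)) (W22_dirichlet (real n)) (schroedinger V (?S n)) (mult_op J) M"
    if "n > 0" for n
    unfolding D[OF that] by (rule pencil_on[OF S[OF that]])
  show "\<exists>F. (\<forall>n>0. F n \<in> W22_dirichlet (real n)) \<and> F \<longlonglongrightarrow> f \<and>
      (\<lambda>n. schroedinger V (?S n) (F n)) \<longlonglongrightarrow> T f \<and> (\<lambda>n. mult_op J (F n)) \<longlonglongrightarrow> mult_op J f"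
    if f: "f \<in> sdom UNIV" for f
  proof -
    obtain F where F: "\<forall>n>0. F n \<in> sdom (?S n)" "F \<longlonglongrightarrow> f" "(\<lambda>n. schroedinger V (?S n) (F n)) \<longlonglongrightarrow> T f"
      using schroedinger_consistent[OF V f] by (elim exE conjE)
    then show ?thesis
      by (intro exI[of _ F]) (simp add: D tendsto_mult_op[OF J])
  qed
  show "\<exists>t c C \<Phi>. c > 0 \<and> finite \<Phi> \<and> (\<forall>n>0. \<forall>x\<in>W22_dirichlet (real n). c * (norm x)\<^sup>2 \<le>
      Re (cinner (schroedinger V (?S n) x) x) - (Re z + t * Im z) * Re (cinner (mult_op J x) x) +
      C * (\<Sum>\<phi>\<in>\<Phi>. (cmod (cinner x \<phi>))\<^sup>2))" if z: "z \<notin> lim.spec" for z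
  proof -
    obtain t c C \<Phi> where *: "c > 0" "finite \<Phi>" "\<forall>(f, g)\<in>H1_graph UNIV. c * (norm f)\<^sup>2 \<le>
        (norm g)\<^sup>2 + Re (cinner (mult_op V f) f) - (Re z + t * Im z) * Re (cinner (mult_op J f) f) +
        C * (\<Sum>\<phi>\<in>\<Phi>. (cmod (cinner f \<phi>))\<^sup>2)"
      using coercive_form[OF z] by (elim exE conjE)
    have "c * (norm x)\<^sup>2 \<le> Re (cinner (schroedinger V (?S n) x) x) -
        (Re z + t * Im z) * Re (cinner (mult_op J x) x) +
        C * (\<Sum>\<phi>\<in>\<Phi>. (cmod (cinner x \<phi>))\<^sup>2)" if n: "n > 0" and x: "x \<in> W22_dirichlet (real n)" for n x
    proof -
      have xs: "x \<in> sdom (?S n)" using x D[OF n] by simp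
      then obtain g where g: "(x, g) \<in> H1_graph (?S n)" by (auto simp: sdom_def)
      then have "(x, g) \<in> H1_graph UNIV" using H1_graph_mono[of "?S n" UNIV] by auto
      from bspec[OF *(3) this] show ?thesis by (simp add: Re_form[OF S[OF n] xs g])
    qed
    with *(1,2) show ?thesis by blast
  qed
  show "\<exists>c>0. \<forall>n>0. \<forall>x\<in>W22_dirichlet (real n). c * (norm x)\<^sup>2 \<le> Re (cinner (schroedinger V (?S n) x) x)"
    if up: "uniformly_positive (sdom UNIV) T"
  proof -
    obtain c where c: "c > 0" "\<And>f. f \<in> sdom UNIV \<Longrightarrow> c * (norm f)\<^sup>2 \<le> Re (cinner (T f) f)"
      using up by (auto simp: uniformly_positive_def)
    have "c * (norm x)\<^sup>2 \<le> Re (cinner (schroedinger V (?S n) x) x)"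
      if n: "n > 0" and x: "x \<in> W22_dirichlet (real n)" for n x
    proof -
      have xs: "x \<in> sdom (?S n)" using x D[OF n] by simp
      then obtain g where g: "(x, g) \<in> H1_graph (?S n)" by (auto simp: sdom_def)
      show ?thesis using form_lower_bound[OF V c(2) g] by (simp add: Re_form[OF S[OF n] xs g])
    qed
    with c(1) show ?thesis by blast
  qed
qed

end

theorem theorem3p8:
  fixes a b m_minus m_plus :: real and J V :: "real \<Rightarrow> real"
  assumes "a \<le> b"
    and "J \<in> L_infinity"
    and "AE x in lebesgue. x < a \<longrightarrow> J x = -1"
    and "AE x in lebesgue. x > b \<longrightarrow> J x = 1"
    and "V \<in> L_infinity"
    and "m_minus > 0" and "m_plus > 0"
    and "ess_tendsto V m_minus at_bot"
    and "ess_tendsto V m_plus at_top"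
  shows
    "let T = schroedinger V UNIV;
         \<Sigma> = pencil_spectrum UNIV (W22 UNIV) T (mult_op J)
     in
       (\<forall>H :: nat \<Rightarrow> L2 set.
          (\<forall>n. finite_dimensional_subspace (H n) \<and> H n \<subseteq> W22 UNIV) \<longrightarrow>
          (\<forall>f. (\<lambda>n. orth_proj (H n) f) \<longlonglongrightarrow> f) \<longrightarrow>
          (\<forall>f\<in>W22 UNIV. (\<lambda>n. compression (H n) T (orth_proj (H n) f)) \<longlonglongrightarrow> T f) \<longrightarrow>
          (let \<Sigma>n = (\<lambda>n. pencil_spectrum (H n) (H n)
                            (compression (H n) T) (compression (H n) (mult_op J)))
           in free_of_spectral_pollution \<Sigma> \<Sigma>n \<and>
              (uniformly_positive (W22 UNIV) T \<longrightarrow> spectrally_exact \<Sigma> \<Sigma>n)))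
       \<and>
       (let \<Sigma>n = (\<lambda>n. pencil_spectrum (L2_on {- real n<..<real n}) (W22_dirichlet (real n))
                         (schroedinger V {- real n<..<real n}) (mult_op J))
        in free_of_spectral_pollution \<Sigma> \<Sigma>n \<and>
           (uniformly_positive (W22 UNIV) T \<longrightarrow> spectrally_exact \<Sigma> \<Sigma>n))"
proof -
  interpret indefinite_sturm_liouville a b m_minus m_plus J V
    using assms by unfold_locales
  show ?thesis
    unfolding Let_def W22_UNIV_eq_sdom
  proof (intro conjI allI impI)
    fix H :: "nat \<Rightarrow> L2 set"
    assume "\<forall>n. finite_dimensional_subspace (H n) \<and> H n \<subseteq> sdom UNIV"
      and "\<forall>f. (\<lambda>n. orth_proj (H n) f) \<longlonglongrightarrow> f"
      and "\<forall>f\<in>sdom UNIV. (\<lambda>n. compression (H n) T (orth_proj (H n) f)) \<longlonglongrightarrow> T f"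
    then interpret galerkin: pencil_approximation "sdom UNIV" T "mult_op J" M H H
      "\<lambda>n. compression (H n) T" "\<lambda>n. compression (H n) (mult_op J)"
      by (intro galerkin_approximation) auto
    show "free_of_spectral_pollution lim.spec
        (\<lambda>n. pencil_spectrum (H n) (H n) (compression (H n) T) (compression (H n) (mult_op J)))"
      by (rule galerkin.free_of_pollution)
    show "spectrally_exact lim.spec
        (\<lambda>n. pencil_spectrum (H n) (H n) (compression (H n) T) (compression (H n) (mult_op J)))"
      if "uniformly_positive (sdom UNIV) T"
      by (rule galerkin.exact[OF that])
  next
    interpret dirichlet: pencil_approximation "sdom UNIV" T "mult_op J" M
      "\<lambda>n. L2_on {- real n<..<real n}" "\<lambda>n. W22_dirichlet (real n)"
      "\<lambda>n. schroedinger V {- real n<..<real n}" "\<lambda>_. mult_op J"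
      by (rule dirichlet_approximation)
    let ?\<Sigma>n = "\<lambda>n. pencil_spectrum (L2_on {- real n<..<real n}) (W22_dirichlet (real n))
      (schroedinger V {- real n<..<real n}) (mult_op J)"
    show "free_of_spectral_pollution lim.spec ?\<Sigma>n" by (rule dirichlet.free_of_pollution)
    show "spectrally_exact lim.spec ?\<Sigma>n" if "uniformly_positive (sdom UNIV) T"
      by (rule dirichlet.exact[OF that])
  qed
qed

end
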